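(* Let $d,s\ge 1$ be integers, let $W_d$ be a $d\times d$ complex Wishart matrix of parameter $s$, and let $$Z_d=\sqrt{ds}\left(\frac{W_d}{ds}-\frac{\mathrm{Id}_d}{d}\right).$$ Then for every integer $p\ge 1$, $$\mathbb E\,\frac1d\,\mathrm{tr}\left(Z_d^{\,p}\right)=\sum_{\substack{\alpha\in\mathcal S_p\\ \alpha\text{ has no fixed points}}} d^{-2g(\alpha)}\left(\frac ds\right)^{|\alpha|-p/2}.$$ Moreover, if $s=s(d)$ is a function of $d$ with $s(d)/d\to\infty$ as $d\to\infty$, then almost surely, as $d\to\infty$, the largest eigenvalue of $Z_d$ converges to $2$ and the smallest eigenvalue of $Z_d$ converges to $-2$.
   Context: A $d\times d$ complex Wishart matrix of parameter $s$ is $W_d=GG^*$, where $G$ is a $d\times s$ matrix with i.i.d. standard complex Gaussian entries (mean $0$, $\mathbb E|G_{ij}|^2=1$). $\mathrm{tr}$ is the non-normalized trace and $\mathrm{Id}_d$ the $d\times d$ identity matrix. $\mathcal S_p$ is the group of permutations of $\{1,\dots,p\}$; $|\alpha|$ is the minimal number of transpositions whose product is $\alpha$ (so $|\alpha|=p-\#\alpha$, with $\#\alpha$ the number of cycles of $\alpha$, fixed points included). With $\gamma=(1\,2\,\cdots\,p)$ the full cycle, the genus of $\alpha\in\mathcal S_p$ is $g(\alpha)=\frac12\left(|\alpha|+|\alpha^{-1}\gamma|-p+1\right)$, a nonnegative integer. In the almost sure statement, the matrices $Z_d$, $d\ge 1$, are defined on a common probability space. *)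

theory Defs
  imports
    "HOL-Probability.Probability"
    "HOL-Combinatorics.Cycles"
    "Jordan_Normal_Form.Spectral_Radius"
begin

text \<open>The second parameter of \<^const>\<open>normal_density\<close> is the standard deviation: the real and the
  imaginary part each have variance 1/2, so the mean is 0 and the expected squared modulus is 1.\<close>

definition std_complex_gaussian :: "'a measure \<Rightarrow> ('a \<Rightarrow> complex) \<Rightarrow> bool" where
  "std_complex_gaussian M X \<longleftrightarrow>
     prob_space.indep_var M borel (\<lambda>\<omega>. Re (X \<omega>)) borel (\<lambda>\<omega>. Im (X \<omega>)) \<and>
     distributed M lborel (\<lambda>\<omega>. Re (X \<omega>)) (normal_density 0 (sqrt (1 / 2))) \<and>
     distributed M lborel (\<lambda>\<omega>. Im (X \<omega>)) (normal_density 0 (sqrt (1 / 2)))"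

definition complex_gaussian_matrix ::
  "'a measure \<Rightarrow> nat \<Rightarrow> nat \<Rightarrow> ('a \<Rightarrow> complex mat) \<Rightarrow> bool" where
  "complex_gaussian_matrix M d s G \<longleftrightarrow>
     (\<forall>\<omega>\<in>space M. G \<omega> \<in> carrier_mat d s) \<and>
     prob_space.indep_vars M (\<lambda>_. borel) (\<lambda>(i, j) \<omega>. G \<omega> $$ (i, j)) ({..<d} \<times> {..<s}) \<and>
     (\<forall>i<d. \<forall>j<s. std_complex_gaussian M (\<lambda>\<omega>. G \<omega> $$ (i, j)))"

definition complex_wishart ::
  "'a measure \<Rightarrow> nat \<Rightarrow> nat \<Rightarrow> ('a \<Rightarrow> complex mat) \<Rightarrow> bool" where
  "complex_wishart M d s W \<longleftrightarrow>
     (\<exists>G. complex_gaussian_matrix M d s G \<and>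
          (\<forall>\<omega>\<in>space M. W \<omega> = G \<omega> * mat_adjoint (G \<omega>)))"

definition recentered_wishart :: "nat \<Rightarrow> nat \<Rightarrow> complex mat \<Rightarrow> complex mat" where
  "recentered_wishart d s W =
     complex_of_real (sqrt (real d * real s)) \<cdot>\<^sub>m
       ((1 / (of_nat d * of_nat s)) \<cdot>\<^sub>m W - (1 / of_nat d) \<cdot>\<^sub>m 1\<^sub>m d)"

definition mat_trace :: "complex mat \<Rightarrow> complex" where
  "mat_trace A = (\<Sum>i<dim_row A. A $$ (i, i))"

text \<open>For Hermitian matrices the spectrum is real, so taking real parts is merely a coercion
  from \<^typ>\<open>complex\<close> to \<^typ>\<open>real\<close>.\<close>

definition largest_eigenvalue :: "complex mat \<Rightarrow> real" where
  "largest_eigenvalue A = Max (Re ` spectrum A)"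

definition smallest_eigenvalue :: "complex mat \<Rightarrow> real" where
  "smallest_eigenvalue A = Min (Re ` spectrum A)"

text \<open>Permutations of \<open>{1..p}\<close> are functions on \<^typ>\<open>nat\<close> that fix every point outside
  \<open>{1..p}\<close>. The proposition \<open>swapidseq n \<alpha>\<close> says that \<open>\<alpha>\<close> is a product of \<open>n\<close> transpositions;
  these may be transpositions of \<^typ>\<open>nat\<close>, but allowing points outside \<open>{1..p}\<close> does not lower
  the minimum.\<close>

definition perm_length :: "(nat \<Rightarrow> nat) \<Rightarrow> nat" where
  "perm_length \<alpha> = (LEAST n. swapidseq n \<alpha>)"

definition full_cycle :: "nat \<Rightarrow> nat \<Rightarrow> nat" where
  "full_cycle p = cycle_of_list [1..<Suc p]"

text \<open>The genus is real-valued so that neither the subtraction nor the halving truncates.\<close>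

definition genus :: "nat \<Rightarrow> (nat \<Rightarrow> nat) \<Rightarrow> real" where
  "genus p \<alpha> =
     (real (perm_length \<alpha>) + real (perm_length (inv_into UNIV \<alpha> \<circ> full_cycle p)) - real p + 1) / 2"

end

theory Submission
  imports Defs "HOL-Real_Asymp.Real_Asymp"
begin

text \<open>Gaussian integration by parts turns the expectation of a product of centred entries
  \<open>(G G\<^sup>*)\<^sub>a\<^sub>b - s \<delta>\<^sub>a\<^sub>b\<close> into a sum over permutations; centring removes the permutations with fixed points.
  Summing over the indices along the full cycle counts index functions constant on the cycles of
  \<open>\<alpha>\<close> and of \<open>\<alpha>\<^sup>-\<^sup>1 \<gamma>\<close>, which gives the powers of \<open>s\<close> and \<open>d\<close>.

  The same integration by parts yields loop equations for the expectations of products of normalized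
  traces of powers of \<open>Z\<close>: a trace either splits in two or, at the cost of \<open>d\<^sup>-\<^sup>2\<close>, merges with another one.
  All coefficients are nonnegative, so a sequence that satisfies the splitting recursion with a little room
  dominates the moments up to an order that is logarithmic in \<open>d\<close>, and Markov's inequality with Borel-Cantelli
  confines the spectrum to \<open>[-2 - \<epsilon>, 2 + \<epsilon>]\<close>. For fixed orders the traces are independent up to
  \<open>O(d\<^sup>-\<^sup>2)\<close>, so they converge almost surely to the moments of the semicircle law, which forces
  eigenvalues near both edges.\<close>

section \<open>Moments of the limiting law\<close>

text \<open>The permutation formula settles every fixed moment, but at orders growing like log d it
  would require counts of permutations by genus that are uniform in the order. Loop equations avoid
  such counts; they close only on products of traces, hence functionals on lists. For a list (n_1,
  ..., n_k) the merging terms carry the weights n_i / d^2, whose numerators add up to at most the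
  total order P, so the single term \<open>\<theta> * bseq \<theta> \<kappa> n\<close> can pay for
  all of them. This needs b(n + q) compared with b(n) b(q), hence growth bounds from above and from
  below with almost the same rate 2: \<open>bseq_le\<close> and \<open>bseq_ge\<close>. The
  parameter \<kappa> is sqrt(d / s): in terms of Z the matrix G G* / s reads \<kappa> Z + 1, and
  this factor enters at every contraction. The matrices for different d may depend on each other in
  any way, so almost sure statements come from summable bounds: d^-2 for the squared deviation of a
  fixed moment, d^-3 at the edge.\<close>

text \<open>For \<open>\<theta> = 0\<close> these are the moments of the centred Marchenko-Pastur law of ratio \<open>\<kappa>\<^sup>2\<close>, and of the
  semicircle law if also \<open>\<kappa> = 0\<close>. The term with \<open>\<theta>\<close> creates the slack that absorbs the finite-size
  corrections.\<close>

fun bseq :: "real \<Rightarrow> real \<Rightarrow> nat \<Rightarrow> real" where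
  "bseq \<theta> \<kappa> 0 = 1"
| "bseq \<theta> \<kappa> (Suc n) = \<theta> * bseq \<theta> \<kappa> n
     + (\<Sum>j<n. (\<kappa> * bseq \<theta> \<kappa> (Suc j) + bseq \<theta> \<kappa> j) * bseq \<theta> \<kappa> (n - 1 - j))"

declare bseq.simps(2) [simp del]

lemma bseq_nonneg:
  assumes "\<theta> \<ge> 0" "\<kappa> \<ge> 0"
  shows "bseq \<theta> \<kappa> n \<ge> 0"
proof (induction n rule: less_induct)
  case (less n)
  show ?case
  proof (cases n)
    case (Suc m)
    have "(\<Sum>j<m. (\<kappa> * bseq \<theta> \<kappa> (Suc j) + bseq \<theta> \<kappa> j) * bseq \<theta> \<kappa> (m - 1 - j)) \<ge> 0"
      using assms Suc by (intro sum_nonneg mult_nonneg_nonneg add_nonneg_nonneg less) auto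
    then show ?thesis using assms less[of m] Suc by (subst Suc, subst bseq.simps(2)) simp
  qed simp
qed

lemma bseq_mono:
  assumes "0 \<le> \<theta>" "\<theta> \<le> \<theta>'" "0 \<le> \<kappa>" "\<kappa> \<le> \<kappa>'"
  shows "bseq \<theta> \<kappa> n \<le> bseq \<theta>' \<kappa>' n"
proof (induction n rule: less_induct)
  case (less n)
  show ?case
  proof (cases n)
    case (Suc m)
    have nn: "bseq \<theta> \<kappa> k \<ge> 0" "bseq \<theta>' \<kappa>' k \<ge> 0" for k
      using assms by (auto intro!: bseq_nonneg)
    have "(\<Sum>j<m. (\<kappa> * bseq \<theta> \<kappa> (Suc j) + bseq \<theta> \<kappa> j) * bseq \<theta> \<kappa> (m - 1 - j))
       \<le> (\<Sum>j<m. (\<kappa>' * bseq \<theta>' \<kappa>' (Suc j) + bseq \<theta>' \<kappa>' j) * bseq \<theta>' \<kappa>' (m - 1 - j))"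
      using assms Suc nn
      by (intro sum_mono mult_mono add_mono less add_nonneg_nonneg mult_nonneg_nonneg) auto
    moreover have "\<theta> * bseq \<theta> \<kappa> m \<le> \<theta>' * bseq \<theta>' \<kappa>' m"
      using assms Suc nn less[of m] by (intro mult_mono) auto
    ultimately show ?thesis unfolding Suc by (subst (1 2) bseq.simps(2)) simp
  qed simp
qed

text \<open>The index pairs (j, n - 1 - j) fill the triangle i + j < N, which lies in a square; the
  products left out are nonnegative. This bounds the convolution in the recursion of
  \<open>bseq\<close> by a product of partial sums.\<close>

lemma sum_convolution_le:
  fixes f g :: "nat \<Rightarrow> real"
  assumes "\<And>n. f n \<ge> 0" "\<And>n. g n \<ge> 0"
  shows "(\<Sum>n\<le>N. \<Sum>j<n. f j * g (n - 1 - j)) \<le> (\<Sum>j<N. f j) * (\<Sum>j<N. g j)"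
proof -
  have "(\<Sum>n\<le>N. \<Sum>j<n. f j * g (n - 1 - j)) = (\<Sum>k<N. \<Sum>j<Suc k. f j * g (k - j))"
    by (subst lessThan_Suc_atMost[symmetric], subst sum.lessThan_Suc_shift) simp
  also have "\<dots> = (\<Sum>(i,j)\<in>{(i,j). i + j < N}. f i * g j)"
    by (subst sum.triangle_reindex) (simp add: lessThan_Suc_atMost)
  also have "\<dots> \<le> (\<Sum>(i,j)\<in>{..<N} \<times> {..<N}. f i * g j)"
    using assms by (intro sum_mono2) (auto intro!: mult_nonneg_nonneg)
  also have "\<dots> = (\<Sum>j<N. f j) * (\<Sum>j<N. g j)"
    by (simp add: sum_product sum.cartesian_product)
  finally show ?thesis .
qed

text \<open>The generating function at \<open>1 / (2u)\<close> stays below the fixed point 2 of the quadratic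
  map that it iterates.\<close>

lemma bseq_le:
  assumes "\<theta> \<ge> 0" "\<kappa> \<ge> 0" "u > 0" and u: "1 / u\<^sup>2 + (\<theta> + 2 * \<kappa>) / u \<le> 1"
  shows "bseq \<theta> \<kappa> n \<le> 2 * (2 * u) ^ n"
proof -
  define x where "x = 1 / (2 * u)"
  define b where "b n = bseq \<theta> \<kappa> n * x ^ n" for n
  have x: "x > 0" using assms by (simp add: x_def)
  have b0: "b n \<ge> 0" for n using bseq_nonneg[OF assms(1,2)] x by (simp add: b_def)
  have quad: "2 * \<theta> * x + 4 * x\<^sup>2 + 4 * \<kappa> * x \<le> 1"
    using u assms(3) by (simp add: x_def field_simps power2_eq_square)
  have S: "(\<Sum>n\<le>N. b n) \<le> 2" for N
  proof (induction N)
    case 0 show ?case by (simp add: b_def)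
  next
    case (Suc N)
    let ?S = "\<Sum>n\<le>N. b n"
    have S0: "?S \<ge> 0" using b0 by (simp add: sum_nonneg)
    have step: "b (Suc n) = \<theta> * x * b n + (\<Sum>j<n. (\<kappa> * x * b (Suc j) + x\<^sup>2 * b j) * b (n - 1 - j))" for n
    proof -
      have "(\<Sum>j<n. (\<kappa> * bseq \<theta> \<kappa> (Suc j) + bseq \<theta> \<kappa> j) * bseq \<theta> \<kappa> (n - 1 - j)) * x ^ Suc n
         = (\<Sum>j<n. (\<kappa> * x * b (Suc j) + x\<^sup>2 * b j) * b (n - 1 - j))"
        unfolding sum_distrib_right
      proof (rule sum.cong[OF refl])
        fix j assume "j \<in> {..<n}"
        then obtain l where n: "n = Suc (j + l)" using less_imp_Suc_add by auto
        then have "n - 1 - j = l" by simp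
        then show "(\<kappa> * bseq \<theta> \<kappa> (Suc j) + bseq \<theta> \<kappa> j) * bseq \<theta> \<kappa> (n - 1 - j) * x ^ Suc n =
          (\<kappa> * x * b (Suc j) + x\<^sup>2 * b j) * b (n - 1 - j)"
          unfolding b_def by (simp add: n power_add power2_eq_square algebra_simps)
      qed
      moreover have "b (Suc n) = \<theta> * x * b n + (\<Sum>j<n. (\<kappa> * bseq \<theta> \<kappa> (Suc j) + bseq \<theta> \<kappa> j) * bseq \<theta> \<kappa> (n - 1 - j)) * x ^ Suc n"
        unfolding b_def by (subst bseq.simps(2)) (simp add: algebra_simps)
      ultimately show ?thesis by simp
    qed
    have sh: "(\<Sum>j<N. b (Suc j)) \<le> ?S" "(\<Sum>j<N. b j) \<le> ?S"
    proof -
      have "(\<Sum>j\<le>N. b j) = b 0 + (\<Sum>j<N. b (Suc j))" by (rule sum.atMost_shift)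
      then show "(\<Sum>j<N. b (Suc j)) \<le> ?S" using b0[of 0] by simp
      show "(\<Sum>j<N. b j) \<le> ?S" using b0 by (intro sum_mono2) auto
    qed
    have "(\<Sum>n\<le>Suc N. b n) = b 0 + (\<Sum>n\<le>N. b (Suc n))" by (rule sum.atMost_Suc_shift)
    also have "\<dots> = 1 + \<theta> * x * ?S + \<kappa> * x * (\<Sum>n\<le>N. \<Sum>j<n. b (Suc j) * b (n - 1 - j))
       + x\<^sup>2 * (\<Sum>n\<le>N. \<Sum>j<n. b j * b (n - 1 - j))"
    proof -
      have "(\<Sum>n\<le>N. b (Suc n)) = (\<Sum>n\<le>N. \<theta> * x * b n
          + (\<kappa> * x * (\<Sum>j<n. b (Suc j) * b (n - 1 - j)) + x\<^sup>2 * (\<Sum>j<n. b j * b (n - 1 - j))))"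
        by (intro sum.cong refl, subst step)
           (simp add: sum_distrib_left sum.distrib distrib_right mult.assoc)
      then show ?thesis by (simp add: b_def[of 0] sum.distrib sum_distrib_left)
    qed
    also have "\<dots> \<le> 1 + \<theta> * x * ?S + \<kappa> * x * (?S * ?S) + x\<^sup>2 * (?S * ?S)"
    proof (intro add_mono mult_left_mono order_refl)
      show "(\<Sum>n\<le>N. \<Sum>j<n. b (Suc j) * b (n - 1 - j)) \<le> ?S * ?S"
        using sum_convolution_le[of "\<lambda>j. b (Suc j)" b N] b0 sh S0
        by (meson mult_mono order_trans sum_nonneg)
      show "(\<Sum>n\<le>N. \<Sum>j<n. b j * b (n - 1 - j)) \<le> ?S * ?S"
        using sum_convolution_le[of b b N] b0 sh S0
        by (meson mult_mono order_trans sum_nonneg)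
    qed (use assms x in auto)
    also have "\<dots> \<le> 1 + \<theta> * x * 2 + \<kappa> * x * (2 * 2) + x\<^sup>2 * (2 * 2)"
      using Suc S0 assms x by (intro add_mono mult_left_mono mult_mono order_refl) auto
    also have "\<dots> \<le> 2" using quad by simp
    finally show ?case .
  qed
  have "b n \<le> (\<Sum>n\<le>n. b n)" using b0 by (intro member_le_sum) auto
  with S[of n] have "b n \<le> 2" by linarith
  then show ?thesis using x assms by (simp add: b_def x_def field_simps power_mult_distrib)
qed

text \<open>The Catalan numbers as the coefficients of (1 - sqrt(1 - 4x)) / (2x). In this form their
  convolution identity is an instance of Vandermonde.\<close>

definition catalan :: "nat \<Rightarrow> real" where
  "catalan k = - ((1/2 gchoose (k + 1)) * (-4) ^ (k + 1)) / 2"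

lemma catalan_0 [simp]: "catalan 0 = 1" by (simp add: catalan_def)

text \<open>Vandermonde for \<open>(1 - 4x)\<^sup>1\<^sup>/\<^sup>2 (1 - 4x)\<^sup>1\<^sup>/\<^sup>2 = 1 - 4x\<close>.\<close>

lemma catalan_Suc: "catalan (Suc k) = (\<Sum>i\<le>k. catalan i * catalan (k - i))"
proof -
  define e :: "nat \<Rightarrow> real" where "e i = (1/2 gchoose i) * (-4) ^ i" for i
  have e0: "e 0 = 1" by (simp add: e_def)
  have eS: "e (Suc i) = - 2 * catalan i" for i by (simp add: e_def catalan_def)
  have "(\<Sum>i\<le>k+2. e i * e (k + 2 - i)) = (-4)^(k+2) * (\<Sum>i\<le>k+2. (1/2 gchoose i) * (1/2 gchoose (k + 2 - i)))"
    unfolding sum_distrib_left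
    by (intro sum.cong refl) (auto simp: e_def power_add[symmetric])
  also have "(\<Sum>i\<le>k+2. (1/2 gchoose i) * ((1/2::real) gchoose (k + 2 - i))) = (1/2 + 1/2) gchoose (k + 2)"
    using gbinomial_Vandermonde[of "1/2::real" "1/2" "k + 2"] by (simp add: atMost_atLeast0)
  also have "(1/2 + 1/2 :: real) gchoose (k + 2) = 0"
    using binomial_gbinomial[of 1 "k + 2", where ?'a=real] by simp
  finally have "(\<Sum>i\<le>k+2. e i * e (k + 2 - i)) = 0" by simp
  moreover have "(\<Sum>i\<le>k+2. e i * e (k + 2 - i)) =
     e (Suc (Suc k)) + (\<Sum>i\<le>k. e (Suc i) * e (Suc (k - i))) + e (Suc (Suc k))"
  proof -
    have "(\<Sum>i\<le>Suc (Suc k). e i * e (Suc (Suc k) - i))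
        = e 0 * e (Suc (Suc k)) + (\<Sum>i\<le>Suc k. e (Suc i) * e (Suc k - i))"
      by (subst sum.atMost_Suc_shift) simp
    also have "(\<Sum>i\<le>Suc k. e (Suc i) * e (Suc k - i)) =
        (\<Sum>i\<le>k. e (Suc i) * e (Suc (k - i))) + e (Suc (Suc k)) * e 0"
      by (subst sum.atMost_Suc) (auto intro!: sum.cong simp: Suc_diff_le)
    finally show ?thesis by (simp add: e0 numeral_2_eq_2)
  qed
  ultimately have "2 * e (Suc (Suc k)) + (\<Sum>i\<le>k. e (Suc i) * e (Suc (k - i))) = 0" by linarith
  moreover have "(\<Sum>i\<le>k. e (Suc i) * e (Suc (k - i))) = 4 * (\<Sum>i\<le>k. catalan i * catalan (k - i))"
    by (simp add: eS sum_distrib_left mult_ac)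
  ultimately show ?thesis by (simp add: eS)
qed

text \<open>Consecutive Catalan numbers have ratio 2 (2k + 1) / (k + 2). The true correction to 4^k
  is of order k^(-3/2); with the weaker (k + 1)^(-2) the induction step is just 4 (k + 1)^2 \<le> 2
  (2k + 1) (k + 2).\<close>

lemma catalan_ge: "catalan k \<ge> 4 ^ k / (real k + 1)\<^sup>2"
proof (induction k)
  case (Suc k)
  have rat: "catalan (Suc k) = catalan k * (2 * (2 * real k + 1) / (real k + 2))"
  proof -
    have "(1/2 gchoose (k + 2)) = (1/2 gchoose (k + 1)) * ((1/2 - (real k + 1)) / (real k + 2))"
      using gbinomial_mult_1[of "1/2::real" "k + 1"] by (simp add: field_simps)
    then have *: "(1/2 gchoose (Suc k + 1)) = (1/2 gchoose (k + 1)) * ((1/2 - (real k + 1)) / (real k + 2))"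
      by simp
    show ?thesis unfolding catalan_def * by (simp add: field_simps)
  qed
  have "4 ^ Suc k / (real (Suc k) + 1)\<^sup>2 = 4 ^ k / (real k + 1)\<^sup>2 * (4 * (real k + 1)\<^sup>2 / (real k + 2)\<^sup>2)"
    by (simp add: field_simps)
  also have "\<dots> \<le> catalan k * (2 * (2 * real k + 1) / (real k + 2))"
  proof (rule mult_mono[OF Suc])
    have "4 * (real k + 1)\<^sup>2 \<le> 2 * (2 * real k + 1) * (real k + 2)"
      by (simp add: power2_eq_square algebra_simps)
    then have "4 * (real k + 1)\<^sup>2 / (real k + 2) / (real k + 2) \<le> 2 * (2 * real k + 1) / (real k + 2)"
      by (intro divide_right_mono) (simp_all add: pos_divide_le_eq)
    then show "4 * (real k + 1)\<^sup>2 / (real k + 2)\<^sup>2 \<le> 2 * (2 * real k + 1) / (real k + 2)"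
      by (simp add: power2_eq_square)
    show "catalan k \<ge> 0" using Suc by (rule order_trans[rotated]) simp
  qed auto
  finally show ?case using rat by simp
qed simp

text \<open>The two indices of each product in the recursion add up to 2k - 1, so one of them is a
  smaller odd number.\<close>

lemma bseq_semicircle_odd: "bseq 0 0 (2 * k + 1) = 0"
proof (induction k rule: less_induct)
  case (less k)
  have "bseq 0 0 j * bseq 0 0 (2 * k - 1 - j) = 0" if "j < 2 * k" for j
  proof (cases "even j")
    case True
    then obtain i where "j = 2 * i" by blast
    with that have "2 * k - 1 - j = 2 * (k - 1 - i) + 1" "k - 1 - i < k" by auto
    with less show ?thesis by (metis mult_zero_right)
  next
    case False
    then obtain i where "j = 2 * i + 1" using oddE by blast
    with that less[of i] show ?thesis by simp
  qed
  then have "(\<Sum>j<2*k. bseq 0 0 j * bseq 0 0 (2 * k - 1 - j)) = 0" by (intro sum.neutral) blast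
  then show ?case by (simp, subst bseq.simps(2)) simp
qed

text \<open>By parity only products of two even-indexed terms survive, and these form the Catalan
  convolution.\<close>

lemma bseq_semicircle_even: "bseq 0 0 (2 * k) = catalan k"
proof (induction k rule: less_induct)
  case (less k)
  show ?case
  proof (cases k)
    case (Suc m)
    have "bseq 0 0 (2 * k) = (\<Sum>j<2*m+1. bseq 0 0 j * bseq 0 0 (2*m - j))"
      using Suc by (simp, subst bseq.simps(2)) simp
    also have "\<dots> = (\<Sum>j\<in>(\<lambda>i. 2 * i) ` {..m}. bseq 0 0 j * bseq 0 0 (2*m - j))"
    proof (rule sum.mono_neutral_right)
      show "\<forall>i\<in>{..<2*m+1} - (\<lambda>i. 2 * i) ` {..m}. bseq 0 0 i * bseq 0 0 (2 * m - i) = 0"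
      proof
        fix i assume i: "i \<in> {..<2*m+1} - (\<lambda>i. 2 * i) ` {..m}"
        have "odd i"
        proof
          assume "even i" then obtain l where "i = 2 * l" by blast
          with i show False by auto
        qed
        then show "bseq 0 0 i * bseq 0 0 (2 * m - i) = 0"
          using bseq_semicircle_odd by (auto elim!: oddE)
      qed
    qed auto
    also have "\<dots> = (\<Sum>i\<le>m. bseq 0 0 (2 * i) * bseq 0 0 (2 * (m - i)))"
      by (subst sum.reindex) (auto simp: inj_on_def diff_mult_distrib2)
    also have "\<dots> = (\<Sum>i\<le>m. catalan i * catalan (m - i))"
      using Suc by (intro sum.cong refl arg_cong2[where f="(*)"] less) auto
    finally show ?thesis by (simp add: Suc catalan_Suc)
  qed simp
qed

text \<open>Each \<open>bseq 0 \<kappa> n\<close> is a polynomial in \<kappa>.\<close>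

lemma tendsto_bseq_semicircle: "((\<lambda>\<kappa>. bseq 0 \<kappa> n) \<longlongrightarrow> bseq 0 0 n) (at 0 within S)"
proof (induction n rule: less_induct)
  case (less n)
  show ?case
  proof (cases n)
    case (Suc m)
    show ?thesis unfolding Suc
      by (subst (1 2) bseq.simps(2)) (intro tendsto_intros less; simp add: Suc)
  qed simp
qed

text \<open>For even n the Catalan bound and monotonicity suffice. Odd semicircle moments vanish, so
  for odd n the bound comes from the \<theta>-term of the recursion, b(2k + 1) \<ge> \<theta> b(2k);
  this is the origin of the factor \<theta> / 2.\<close>

lemma bseq_ge:
  assumes "0 \<le> \<theta>" "\<theta> \<le> 1" "0 \<le> \<kappa>"
  shows "bseq \<theta> \<kappa> n \<ge> \<theta> / 2 * 2 ^ n / (real n + 1)\<^sup>2"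
proof -
  have even: "bseq \<theta> \<kappa> (2 * k) \<ge> 4 ^ k / (real k + 1)\<^sup>2" for k
  proof -
    have "4 ^ k / (real k + 1)\<^sup>2 \<le> bseq 0 0 (2 * k)"
      using catalan_ge by (simp add: bseq_semicircle_even)
    also have "\<dots> \<le> bseq \<theta> \<kappa> (2 * k)" using assms by (intro bseq_mono) auto
    finally show ?thesis .
  qed
  show ?thesis
  proof (cases "even n")
    case True
    then obtain k where n: "n = 2 * k" by blast
    have "\<theta> / 2 * 2 ^ n / (real n + 1)\<^sup>2 \<le> 1 * 2 ^ n / (real k + 1)\<^sup>2"
      using assms by (intro frac_le mult_right_mono power_mono) (auto simp: n)
    also have "\<dots> \<le> bseq \<theta> \<kappa> n" using even[of k] by (simp add: n power_mult)
    finally show ?thesis .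
  next
    case False
    then obtain k where n: "n = 2 * k + 1" using oddE by blast
    have "\<theta> / 2 * 2 ^ n / (real n + 1)\<^sup>2 \<le> \<theta> / 2 * 2 ^ n / (real k + 1)\<^sup>2"
      using assms by (intro frac_le mult_right_mono power_mono) (auto simp: n)
    also have "\<dots> = \<theta> * (4 ^ k / (real k + 1)\<^sup>2)" by (simp add: n power_mult)
    also have "\<dots> \<le> \<theta> * bseq \<theta> \<kappa> (2 * k)" using even[of k] assms by (intro mult_left_mono) auto
    also have "\<dots> \<le> bseq \<theta> \<kappa> n"
      using assms bseq_nonneg[of \<theta> \<kappa>] unfolding n Suc_eq_plus1[symmetric]
      by (subst bseq.simps(2)) (auto intro!: sum_nonneg)
    finally show ?thesis .
  qed
qed

section \<open>Consequences of the loop equations\<close>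

definition remove_nth :: "nat \<Rightarrow> 'b list \<Rightarrow> 'b list" where
  "remove_nth i xs = take i xs @ drop (Suc i) xs"

lemma remove_nth_Cons_0 [simp]: "remove_nth 0 (x # xs) = xs"
  and remove_nth_Cons_Suc [simp]: "remove_nth (Suc i) (x # xs) = x # remove_nth i xs"
  by (simp_all add: remove_nth_def)

lemma sum_list_remove_nth:
  fixes xs :: "nat list"
  assumes "i < length xs"
  shows "xs ! i + sum_list (remove_nth i xs) = sum_list xs"
  using assms by (induction xs arbitrary: i) (auto simp: less_Suc_eq_0_disj)

lemma prod_list_remove_nth:
  fixes f :: "'b \<Rightarrow> 'c :: comm_monoid_mult"
  assumes "i < length xs"
  shows "f (xs ! i) * prod_list (map f (remove_nth i xs)) = prod_list (map f xs)"
  using assms by (induction xs arbitrary: i) (auto simp: less_Suc_eq_0_disj ac_simps)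

lemma length_remove_nth: "i < length xs \<Longrightarrow> Suc (length (remove_nth i xs)) = length xs"
  by (simp add: remove_nth_def)

text \<open>\<open>T [n\<^sub>1, \<dots>, n\<^sub>k]\<close> stands for the expectation of the product of the normalized traces of the
  powers \<open>n\<^sub>1, \<dots>, n\<^sub>k\<close> of a \<open>D \<times> D\<close> matrix.\<close>

abbreviation loop_split :: "real \<Rightarrow> (nat list \<Rightarrow> complex) \<Rightarrow> nat \<Rightarrow> nat list \<Rightarrow> nat \<Rightarrow> complex" where
  "loop_split \<kappa> T n ns j \<equiv> of_real \<kappa> * T (Suc j # (n - 1 - j) # ns) + T (j # (n - 1 - j) # ns)"

abbreviation loop_merge :: "real \<Rightarrow> real \<Rightarrow> (nat list \<Rightarrow> complex) \<Rightarrow> nat \<Rightarrow> nat list \<Rightarrow> nat \<Rightarrow> complex" where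
  "loop_merge \<kappa> D T n ns i \<equiv> of_real (real (ns ! i) / D\<^sup>2) *
     (of_real \<kappa> * T ((n + ns ! i) # remove_nth i ns) + T ((n + ns ! i - 1) # remove_nth i ns))"

text \<open>\<open>T\<close> is an arbitrary functional on lists, so that constants obtained below
  hold for all dimensions at once. The subtraction in \<open>loop_merge\<close> truncates only if n
  and \<open>ns ! i\<close> are both 0, and then the coefficient is 0.\<close>

definition loop_equations :: "real \<Rightarrow> real \<Rightarrow> (nat list \<Rightarrow> complex) \<Rightarrow> bool" where
  "loop_equations \<kappa> D T \<longleftrightarrow> T [] = 1 \<and> (\<forall>ns. T (0 # ns) = T ns) \<and>
     (\<forall>n ns. T (Suc n # ns) =
        (\<Sum>j<n. loop_split \<kappa> T n ns j) + (\<Sum>i<length ns. loop_merge \<kappa> D T n ns i))"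

lemma loop_equations_Suc:
  assumes "loop_equations \<kappa> D T"
  shows "T (Suc n # ns) =
        (\<Sum>j<n. loop_split \<kappa> T n ns j) + (\<Sum>i<length ns. loop_merge \<kappa> D T n ns i)"
  using assms unfolding loop_equations_def by blast

text \<open>Splitting lowers the total order but adds a list entry; merging lowers neither less than
  splitting does nor adds an entry; dropping a 0 only shortens the list. Counting the order twice
  and the length once therefore decreases in every case.\<close>

lemma loop_equations_induct [case_names Nil zero Suc]:
  assumes Nil: "P []" and zero: "\<And>ns. P ns \<Longrightarrow> P (0 # ns)"
    and Suc: "\<And>n ns. (\<And>j. j < n \<Longrightarrow> P (Suc j # (n - 1 - j) # ns)) \<Longrightarrow>
      (\<And>j. j < n \<Longrightarrow> P (j # (n - 1 - j) # ns)) \<Longrightarrow>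
      (\<And>i. i < length ns \<Longrightarrow> P ((n + ns ! i) # remove_nth i ns)) \<Longrightarrow>
      (\<And>i. i < length ns \<Longrightarrow> P ((n + ns ! i - 1) # remove_nth i ns)) \<Longrightarrow> P (Suc n # ns)"
  shows "P ns"
proof (induction ns rule: measure_induct_rule[of "\<lambda>ns. 2 * sum_list ns + length ns"])
  case (less ns)
  show ?case
  proof (cases ns)
    case (Cons m ms)
    show ?thesis
    proof (cases m)
      case 0
      have "P ms" by (rule less) (simp add: Cons)
      then show ?thesis by (simp add: Cons 0 zero)
    next
      case m: (Suc n)
      have rem: "ms ! i + sum_list (remove_nth i ms) = sum_list ms"
        "Suc (length (remove_nth i ms)) = length ms" if "i < length ms" for i
        using that by (auto simp: sum_list_remove_nth length_remove_nth)
      show ?thesis unfolding Cons m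
      proof (rule Suc)
        fix i assume i: "i < length ms"
        show "P ((n + ms ! i) # remove_nth i ms)" "P ((n + ms ! i - 1) # remove_nth i ms)"
          using rem[OF i] by (auto intro!: less simp: Cons m)
      qed (auto intro!: less simp: Cons m)
    qed
  qed (auto intro: Nil)
qed

text \<open>All coefficients are nonnegative, so the product of the \<open>bseq\<close> values is a
  majorant as soon as it satisfies the loop equations with \<ge>. The splitting terms reproduce the
  convolution in \<open>bseq\<close>; hypothesis \<open>merge\<close> makes each merging term at
  most the fraction \<open>ns ! i\<close> / P of the \<theta>-term. Total orders never increase, so
  P stays valid along the induction, and \<kappa>0 replaces a varying \<kappa> by a
  constant.\<close>

lemma loop_equations_bound:
  assumes T: "loop_equations \<kappa> D T" and \<kappa>: "0 \<le> \<kappa>" "\<kappa> \<le> \<kappa>0" and \<theta>: "0 \<le> \<theta>" and "D > 0"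
    and merge: "\<And>n q. 1 \<le> q \<Longrightarrow> n + q < P \<Longrightarrow>
      real P / D\<^sup>2 * (\<kappa>0 * bseq \<theta> \<kappa>0 (n + q) + bseq \<theta> \<kappa>0 (n + q - 1)) \<le> \<theta> * bseq \<theta> \<kappa>0 n * bseq \<theta> \<kappa>0 q"
    and "sum_list ns \<le> P"
  shows "cmod (T ns) \<le> prod_list (map (bseq \<theta> \<kappa>0) ns)"
  using \<open>sum_list ns \<le> P\<close>
proof (induction ns rule: loop_equations_induct)
  case Nil
  then show ?case using T by (simp add: loop_equations_def)
next
  case (zero ns)
  then show ?case using T by (simp add: loop_equations_def)
next
  case (Suc n ns)
  define B where "B = bseq \<theta> \<kappa>0"
  define \<Phi> where "\<Phi> ms = prod_list (map B ms)" for ms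
  have B0: "B k \<ge> 0" for k using bseq_nonneg \<kappa> \<theta> by (simp add: B_def)
  have \<Phi>0: "\<Phi> ms \<ge> 0" for ms unfolding \<Phi>_def by (induction ms) (auto simp: B0)
  have split: "cmod (loop_split \<kappa> T n ns j)
      \<le> (\<kappa>0 * B (Suc j) + B j) * B (n - 1 - j) * \<Phi> ns" if j: "j < n" for j
  proof -
    have "cmod (loop_split \<kappa> T n ns j)
       \<le> \<kappa> * cmod (T (Suc j # (n - 1 - j) # ns)) + cmod (T (j # (n - 1 - j) # ns))"
      using \<kappa> by (intro norm_triangle_le) (simp add: norm_mult)
    also have "\<dots> \<le> \<kappa>0 * (B (Suc j) * (B (n - 1 - j) * \<Phi> ns)) + B j * (B (n - 1 - j) * \<Phi> ns)"
      using Suc.IH(1,2)[OF j] Suc.prems j \<kappa>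
      by (intro add_mono mult_mono) (auto simp: B_def \<Phi>_def)
    finally show ?thesis by (simp add: algebra_simps)
  qed
  have merge': "cmod (loop_merge \<kappa> D T n ns i)
      \<le> real (ns ! i) * (\<theta> * B n * \<Phi> ns / real P)" if i: "i < length ns" for i
  proof (cases "ns ! i = 0")
    case False
    define q where "q = ns ! i"
    have rem: "q + sum_list (remove_nth i ns) = sum_list ns"
      using i by (simp add: q_def sum_list_remove_nth)
    then have P: "n + q < P" "P > 0" using Suc.prems by auto
    have "cmod (of_real \<kappa> * T ((n + q) # remove_nth i ns) + T ((n + q - 1) # remove_nth i ns))
       \<le> \<kappa> * cmod (T ((n + q) # remove_nth i ns)) + cmod (T ((n + q - 1) # remove_nth i ns))"
      using \<kappa> by (intro norm_triangle_le) (simp add: norm_mult)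
    also have "\<dots> \<le> \<kappa>0 * (B (n + q) * \<Phi> (remove_nth i ns)) + B (n + q - 1) * \<Phi> (remove_nth i ns)"
      using Suc.IH(3,4)[OF i] Suc.prems \<kappa> rem
      by (intro add_mono mult_mono) (auto simp: B_def \<Phi>_def q_def)
    finally have 1: "cmod (of_real \<kappa> * T ((n + q) # remove_nth i ns) + T ((n + q - 1) # remove_nth i ns))
      \<le> (\<kappa>0 * B (n + q) + B (n + q - 1)) * \<Phi> (remove_nth i ns)" by (simp add: algebra_simps)
    have "(\<kappa>0 * B (n + q) + B (n + q - 1)) / D\<^sup>2 \<le> \<theta> * B n * B q / real P"
      using merge[of q n] False P by (simp add: B_def q_def field_simps)
    then have "(\<kappa>0 * B (n + q) + B (n + q - 1)) / D\<^sup>2 * \<Phi> (remove_nth i ns)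
        \<le> \<theta> * B n * B q / real P * \<Phi> (remove_nth i ns)"
      using \<Phi>0 by (rule mult_right_mono)
    also have "\<dots> = \<theta> * B n * \<Phi> ns / real P"
      using prod_list_remove_nth[OF i, of B] by (simp add: \<Phi>_def q_def mult.assoc)
    finally have "real q * ((\<kappa>0 * B (n + q) + B (n + q - 1)) / D\<^sup>2 * \<Phi> (remove_nth i ns))
       \<le> real q * (\<theta> * B n * \<Phi> ns / real P)" by (rule mult_left_mono) simp
    moreover have "cmod (of_real (real q / D\<^sup>2) *
         (of_real \<kappa> * T ((n + q) # remove_nth i ns) + T ((n + q - 1) # remove_nth i ns)))
      \<le> real q / D\<^sup>2 * ((\<kappa>0 * B (n + q) + B (n + q - 1)) * \<Phi> (remove_nth i ns))"
      unfolding norm_mult using 1 by (intro mult_mono) (auto simp: norm_divide norm_power)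
    ultimately show ?thesis by (simp add: q_def)
  qed simp
  have "cmod (T (Suc n # ns)) \<le>
     (\<Sum>j<n. (\<kappa>0 * B (Suc j) + B j) * B (n - 1 - j) * \<Phi> ns)
      + (\<Sum>i<length ns. real (ns ! i) * (\<theta> * B n * \<Phi> ns / real P))"
    by (subst loop_equations_Suc[OF T]) (intro norm_triangle_le add_mono sum_norm_le split merge'; simp)
  also have "(\<Sum>i<length ns. real (ns ! i) * (\<theta> * B n * \<Phi> ns / real P))
      = real (sum_list ns) / real P * (\<theta> * B n * \<Phi> ns)"
    unfolding sum_distrib_right[symmetric]
    by (simp add: sum_list_sum_nth atLeast0LessThan)
  \<comment> \<open>The orders in \<open>ns\<close> add up to at most P, so the fractions add up to
    at most 1.\<close>
  also have "\<dots> \<le> 1 * (\<theta> * B n * \<Phi> ns)"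
    using Suc.prems B0 \<Phi>0 \<theta> by (intro mult_right_mono) (auto simp: divide_le_eq)
  also have "(\<Sum>j<n. (\<kappa>0 * B (Suc j) + B j) * B (n - 1 - j) * \<Phi> ns) + 1 * (\<theta> * B n * \<Phi> ns) = B (Suc n) * \<Phi> ns"
    unfolding B_def by (simp add: bseq.simps(2)[of \<theta> \<kappa>0 n] sum_distrib_right distrib_right mult.assoc)
  finally show ?case by (simp add: B_def \<Phi>_def)
qed

text \<open>Merging two traces costs a factor \<open>D\<^sup>-\<^sup>2\<close>, so to leading order the traces are independent.\<close>

lemma loop_equations_approx:
  "\<exists>C. \<forall>\<kappa> D T. loop_equations \<kappa> D T \<longrightarrow> 0 \<le> \<kappa> \<longrightarrow> \<kappa> \<le> 1 \<longrightarrow> D \<ge> 1 \<longrightarrow>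
     cmod (T ns - of_real (prod_list (map (bseq 0 \<kappa>) ns))) \<le> C / D\<^sup>2"
proof (induction ns rule: loop_equations_induct)
  case Nil
  show ?case by (intro exI[of _ 0]) (simp add: loop_equations_def)
next
  case (zero ns)
  then show ?case by (simp add: loop_equations_def)
next
  case (Suc n ns)
  define \<Phi> where "\<Phi> \<kappa> ms = prod_list (map (bseq 0 \<kappa>) ms)" for \<kappa> ms
  let ?good = "\<lambda>\<kappa> D T. loop_equations \<kappa> D T \<and> 0 \<le> \<kappa> \<and> \<kappa> \<le> 1 \<and> D \<ge> 1"
  obtain C1 where C1: "\<And>j \<kappa> D T. j < n \<Longrightarrow> ?good \<kappa> D T \<Longrightarrow>
      cmod (T (Suc j # (n - 1 - j) # ns) - \<Phi> \<kappa> (Suc j # (n - 1 - j) # ns)) \<le> C1 j / D\<^sup>2"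
    using Suc(1) unfolding \<Phi>_def by metis
  obtain C2 where C2: "\<And>j \<kappa> D T. j < n \<Longrightarrow> ?good \<kappa> D T \<Longrightarrow>
      cmod (T (j # (n - 1 - j) # ns) - \<Phi> \<kappa> (j # (n - 1 - j) # ns)) \<le> C2 j / D\<^sup>2"
    using Suc(2) unfolding \<Phi>_def by metis
  \<comment> \<open>An approximation by quantities bounded for \<kappa> \<le> 1 gives a bound
    uniform in \<kappa>, D and T. For merged lists this is all that is needed, since their
    coefficient already contains D^-2.\<close>
  have bounded: "\<exists>K. \<forall>\<kappa> D T. ?good \<kappa> D T \<longrightarrow> cmod (T ms) \<le> K"
    if "\<exists>C. \<forall>\<kappa> D T. loop_equations \<kappa> D T \<longrightarrow> 0 \<le> \<kappa> \<longrightarrow> \<kappa> \<le> 1 \<longrightarrow> D \<ge> 1 \<longrightarrow>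
      cmod (T ms - of_real (prod_list (map (bseq 0 \<kappa>) ms))) \<le> C / D\<^sup>2" for ms
  proof -
    from that obtain C where C: "\<And>\<kappa> D T. ?good \<kappa> D T \<Longrightarrow> cmod (T ms - \<Phi> \<kappa> ms) \<le> C / D\<^sup>2"
      unfolding \<Phi>_def by metis
    have "cmod (T ms) \<le> \<bar>C\<bar> + \<Phi> 1 ms" if g: "?good \<kappa> D T" for \<kappa> D T
    proof -
      have "0 \<le> \<Phi> \<kappa> ms \<and> \<Phi> \<kappa> ms \<le> \<Phi> 1 ms" unfolding \<Phi>_def
        using g by (induction ms) (auto intro!: mult_mono bseq_mono bseq_nonneg mult_nonneg_nonneg)
      moreover have "C / D\<^sup>2 \<le> \<bar>C\<bar> / 1" using g by (intro frac_le) (auto simp: one_le_power)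
      ultimately show ?thesis
        using C[OF g] norm_triangle_ineq2[of "T ms" "of_real (\<Phi> \<kappa> ms)"] by simp
    qed
    then show ?thesis by blast
  qed
  obtain K1 where K1: "\<And>i \<kappa> D T. i < length ns \<Longrightarrow> ?good \<kappa> D T \<Longrightarrow>
      cmod (T ((n + ns ! i) # remove_nth i ns)) \<le> K1 i"
    using bounded[OF Suc(3)] by metis
  obtain K2 where K2: "\<And>i \<kappa> D T. i < length ns \<Longrightarrow> ?good \<kappa> D T \<Longrightarrow>
      cmod (T ((n + ns ! i - 1) # remove_nth i ns)) \<le> K2 i"
    using bounded[OF Suc(4)] by metis
  define C where "C = (\<Sum>j<n. \<bar>C1 j\<bar> + \<bar>C2 j\<bar>) + (\<Sum>i<length ns. real (ns ! i) * (\<bar>K1 i\<bar> + \<bar>K2 i\<bar>))"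
  have "cmod (T (Suc n # ns) - \<Phi> \<kappa> (Suc n # ns)) \<le> C / D\<^sup>2" if g: "?good \<kappa> D T" for \<kappa> D T
  proof -
    have D: "D\<^sup>2 > 0" using g by simp
    have expand: "T (Suc n # ns) - \<Phi> \<kappa> (Suc n # ns) =
      (\<Sum>j<n. of_real \<kappa> * (T (Suc j # (n - 1 - j) # ns) - \<Phi> \<kappa> (Suc j # (n - 1 - j) # ns))
         + (T (j # (n - 1 - j) # ns) - \<Phi> \<kappa> (j # (n - 1 - j) # ns))) +
      (\<Sum>i<length ns. loop_merge \<kappa> D T n ns i)"
    proof -
      have "\<Phi> \<kappa> (Suc n # ns) = (\<Sum>j<n. \<kappa> * \<Phi> \<kappa> (Suc j # (n - 1 - j) # ns) + \<Phi> \<kappa> (j # (n - 1 - j) # ns))"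
        unfolding \<Phi>_def list.map prod_list.Cons
        by (subst bseq.simps(2)) (simp add: sum_distrib_left sum_distrib_right algebra_simps)
      moreover note loop_equations_Suc[OF conjunct1[OF g], of n ns]
      ultimately show ?thesis
        by (simp add: sum_subtractf sum.distrib ring_distribs)
    qed
    have "cmod (T (Suc n # ns) - \<Phi> \<kappa> (Suc n # ns)) \<le> (\<Sum>j<n. (\<bar>C1 j\<bar> + \<bar>C2 j\<bar>) / D\<^sup>2)
       + (\<Sum>i<length ns. real (ns ! i) / D\<^sup>2 * (\<bar>K1 i\<bar> + \<bar>K2 i\<bar>))"
      unfolding expand
    proof (rule order_trans[OF norm_triangle_ineq], rule add_mono; rule sum_norm_le)
      fix j assume "j \<in> {..<n}"
      then have j: "j < n" by simp
      have "cmod (of_real \<kappa> * (T (Suc j # (n - 1 - j) # ns) - \<Phi> \<kappa> (Suc j # (n - 1 - j) # ns)))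
          \<le> 1 * (\<bar>C1 j\<bar> / D\<^sup>2)"
        unfolding norm_mult using g D
        by (intro mult_mono order_trans[OF C1[OF j g]] divide_right_mono) auto
      moreover have "cmod (T (j # (n - 1 - j) # ns) - \<Phi> \<kappa> (j # (n - 1 - j) # ns)) \<le> \<bar>C2 j\<bar> / D\<^sup>2"
        using D by (intro order_trans[OF C2[OF j g]] divide_right_mono) auto
      ultimately show "cmod (of_real \<kappa> * (T (Suc j # (n - 1 - j) # ns) - \<Phi> \<kappa> (Suc j # (n - 1 - j) # ns))
         + (T (j # (n - 1 - j) # ns) - \<Phi> \<kappa> (j # (n - 1 - j) # ns))) \<le> (\<bar>C1 j\<bar> + \<bar>C2 j\<bar>) / D\<^sup>2"
        by (intro norm_triangle_le) (simp add: add_divide_distrib)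
    next
      fix i assume "i \<in> {..<length ns}"
      then have i: "i < length ns" by simp
      have "cmod (of_real \<kappa> * T ((n + ns ! i) # remove_nth i ns)) \<le> 1 * \<bar>K1 i\<bar>"
        unfolding norm_mult using g K1[OF i g] by (intro mult_mono) auto
      then have "cmod (of_real \<kappa> * T ((n + ns ! i) # remove_nth i ns) + T ((n + ns ! i - 1) # remove_nth i ns))
         \<le> \<bar>K1 i\<bar> + \<bar>K2 i\<bar>"
        using K2[OF i g] by (intro norm_triangle_le) auto
      then show "cmod (loop_merge \<kappa> D T n ns i)
        \<le> real (ns ! i) / D\<^sup>2 * (\<bar>K1 i\<bar> + \<bar>K2 i\<bar>)"
        unfolding norm_mult by (intro mult_mono) (auto simp: norm_divide norm_power)
    qed
    also have "\<dots> = C / D\<^sup>2"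
      by (simp add: C_def add_divide_distrib sum_divide_distrib)
    finally show ?thesis .
  qed
  then show ?case by (intro exI[of _ C]) (auto simp: \<Phi>_def)
qed

text \<open>The moment of order \<open>P d\<close>, roughly \<open>log\<^sub>u d\<close>, is used: \<open>u\<^sup>P\<close> is then comparable with \<open>d\<close>, so it
  beats the \<open>d\<close> eigenvalues of the trace while the merging terms, which are of order \<open>u\<^sup>P d\<^sup>-\<^sup>2\<close> up to
  powers of \<open>P\<close>, stay negligible.\<close>

lemma loop_equations_edge:
  assumes "R > 2"
  shows "\<exists>P. (\<forall>d. even (P d)) \<and> (\<forall>\<kappa> T. (\<forall>d\<ge>1. 0 \<le> \<kappa> d \<and> loop_equations (\<kappa> d) (real d) (T d)) \<longrightarrow> \<kappa> \<longlonglongrightarrow> 0 \<longrightarrow>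
     (\<forall>\<^sub>F d in sequentially. real d * (cmod (T d [P d]) / R ^ P d) \<le> 2 / real d ^ 3))"
proof -
  \<comment> \<open>One factor u of R / 2 = u^5 is spent on the growth (2u)^P of the majorant. The
    remaining four give u^(-4P) \<le> d^-4, and d^-3 is left after summing over d
    eigenvalues.\<close>
  define u where "u = root 5 (R / 2)"
  have u: "u > 1" using assms by (simp add: u_def)
  have R: "R = 2 * u ^ 5" using assms by (simp add: u_def)
  \<comment> \<open>Chosen so that 1 / u^2 + 3 \<theta> = 1. As u > 1, the condition of
    \<open>bseq_le\<close> then holds with \<theta> also in the role of \<kappa>.\<close>
  define \<theta> where "\<theta> = (1 - 1 / u\<^sup>2) / 3"
  have \<theta>: "0 < \<theta>" "\<theta> < 1" 
  proof -
    have "0 < 1 / u\<^sup>2" "1 / u\<^sup>2 < 1" using u by (auto simp: one_less_power)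
    then show "0 < \<theta>" unfolding \<theta>_def by simp
    show "\<theta> < 1" 
    proof -
      have "0 < w \<Longrightarrow> (1 - w) / 3 < 1" for w :: real by simp
      then show ?thesis unfolding \<theta>_def using \<open>0 < 1 / u\<^sup>2\<close> by blast
    qed
  qed
  have edge: "1 / u\<^sup>2 + (\<theta> + 2 * \<theta>) / u \<le> 1"
  proof -
    have "3 * \<theta> / u \<le> 3 * \<theta> / 1" using u \<theta> by (intro frac_le) auto
    moreover have "w = 1 - 3 * ((1 - w) / 3)" for w :: real by (simp add: field_simps)
    then have "1 / u\<^sup>2 = 1 - 3 * \<theta>" unfolding \<theta>_def by blast
    ultimately show ?thesis by simp
  qed
  define B where "B = bseq \<theta> \<theta>"
  have Ble: "B n \<le> 2 * (2 * u) ^ n" for n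
    unfolding B_def using \<theta> u edge by (intro bseq_le) auto
  have Bge: "B n \<ge> \<theta> / 2 * 2 ^ n / (real n + 1)\<^sup>2" for n
    unfolding B_def using \<theta> by (intro bseq_ge) auto
  \<comment> \<open>The least even integer that is at least log_u d. Evenness makes the trace of the
    power dominate the power of each |eigenvalue|; rounding costs at most the factor u^2.\<close>
  define P where "P d = 2 * nat \<lceil>log u (real d) / 2\<rceil>" for d
  have P: "real d \<le> u ^ P d" "u ^ P d \<le> u\<^sup>2 * real d" if "d \<ge> 1" for d
  proof -
    have l: "log u (real d) \<ge> 0" using u that by simp
    have "real (P d) = 2 * \<lceil>log u (real d) / 2\<rceil>" using l by (simp add: P_def)
    then have "log u (real d) \<le> real (P d)" "real (P d) \<le> log u (real d) + 2" by linarith+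
    then have "u powr log u (real d) \<le> u powr real (P d)" "u powr real (P d) \<le> u powr (log u (real d) + 2)"
      using u by (auto intro: powr_mono)
    then show "real d \<le> u ^ P d" "u ^ P d \<le> u\<^sup>2 * real d"
      using u that by (auto simp: powr_add powr_realpow mult.commute)
  qed
  have limP: "filterlim P at_top sequentially"
  proof -
    have "filterlim (\<lambda>d. log u (real d)) at_top sequentially" using u by real_asymp
    then have "filterlim (\<lambda>d. real (P d)) at_top sequentially"
    proof (rule filterlim_at_top_mono)
      show "\<forall>\<^sub>F d in sequentially. log u (real d) \<le> real (P d)"
        unfolding P_def by (intro always_eventually allI) linarith
    qed
    then show ?thesis by (simp add: filterlim_sequentially_iff_filterlim_real)
  qed
  \<comment> \<open>This is the merging condition after inserting the bounds on B: the left side of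
    \<open>merge\<close> is at most p d^-2 times 4 * 2^(n+q) u^2 d, and the right side is at least
    \<theta>^3 2^(n+q) / (4 (p + 1)^4). Replacing d by u^p / u^2 raises u^2 to u^4.\<close>
  have "\<forall>\<^sub>F p in sequentially. 16 * real p * (real p + 1) ^ 4 * u ^ 4 \<le> \<theta> ^ 3 * u ^ p"
    using u \<theta> by real_asymp
  then have ev: "\<forall>\<^sub>F d in sequentially. 16 * real (P d) * (real (P d) + 1) ^ 4 * u ^ 4 \<le> \<theta> ^ 3 * u ^ P d"
    using limP by (rule eventually_compose_filterlim)
  have "\<forall>\<^sub>F d in sequentially. real d * (cmod (T d [P d]) / R ^ P d) \<le> 2 / real d ^ 3"
    if T: "\<forall>d\<ge>1. 0 \<le> \<kappa> d \<and> loop_equations (\<kappa> d) (real d) (T d)" and lim: "\<kappa> \<longlonglongrightarrow> 0"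
    for \<kappa> and T :: "nat \<Rightarrow> nat list \<Rightarrow> complex"
  proof -
    have "\<forall>\<^sub>F d in sequentially. \<kappa> d < \<theta>" by (rule order_tendstoD(2)[OF lim \<theta>(1)])
    with ev eventually_ge_at_top[of 1] show ?thesis
    proof eventually_elim
      case (elim d)
      define p where "p = P d"
      have d: "d \<ge> 1" using elim by simp
      have "cmod (T d [p]) \<le> prod_list (map (bseq \<theta> \<theta>) [p])"
      proof (rule loop_equations_bound[where \<kappa> = "\<kappa> d" and D = "real d" and P = p])
        show "loop_equations (\<kappa> d) (real d) (T d)" "0 \<le> \<kappa> d" using T d by auto
        fix n q :: nat assume nq: "1 \<le> q" "n + q < p"
        have "\<theta> * B (n + q) + B (n + q - 1) \<le> 1 * (2 * (2 * u) ^ (n + q)) + 2 * (2 * u) ^ (n + q)"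
        proof (intro add_mono mult_mono Ble)
          have "B (n + q - 1) \<le> 2 * (2 * u) ^ (n + q - 1)" by (rule Ble)
          also have "\<dots> \<le> 2 * (2 * u) ^ (n + q)" using u by (intro mult_left_mono power_increasing) auto
          finally show "B (n + q - 1) \<le> 2 * (2 * u) ^ (n + q)" .
        qed (use \<theta> bseq_nonneg[of \<theta> \<theta>] in \<open>auto simp: B_def\<close>)
        also have "\<dots> = 4 * 2 ^ (n + q) * u ^ (n + q)" by (simp add: power_mult_distrib)
        also have "\<dots> \<le> 4 * 2 ^ (n + q) * (u\<^sup>2 * real d)"
        proof (rule mult_left_mono)
          have "u ^ (n + q) \<le> u ^ P d" using u nq by (intro power_increasing) (auto simp: p_def)
          also note P(2)[OF d]
          finally show "u ^ (n + q) \<le> u\<^sup>2 * real d" .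
        qed simp
        finally have 1: "\<theta> * B (n + q) + B (n + q - 1) \<le> 4 * 2 ^ (n + q) * (u\<^sup>2 * real d)" .
        have 2: "B m \<ge> \<theta> / 2 * 2 ^ m / (real p + 1)\<^sup>2" if "m \<le> p" for m
        proof -
          have "\<theta> / 2 * 2 ^ m / (real p + 1)\<^sup>2 \<le> \<theta> / 2 * 2 ^ m / (real m + 1)\<^sup>2"
            using that \<theta> by (intro divide_left_mono power_mono) auto
          with Bge[of m] show ?thesis by linarith
        qed
        have "16 * real p * (real p + 1) ^ 4 * u ^ 4 \<le> \<theta> ^ 3 * (u\<^sup>2 * real d)"
        proof -
          have "16 * real p * (real p + 1) ^ 4 * u ^ 4 \<le> \<theta> ^ 3 * u ^ p" using elim by (simp add: p_def)
          also have "\<dots> \<le> \<theta> ^ 3 * (u\<^sup>2 * real d)"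
            using P(2)[OF d] \<theta> unfolding p_def by (intro mult_left_mono) auto
          finally show ?thesis .
        qed
        then have 3: "16 * real p * (real p + 1) ^ 4 * u\<^sup>2 \<le> \<theta> ^ 3 * real d"
          using u by (simp add: power4_eq_xxxx power2_eq_square)
        have "real p / (real d)\<^sup>2 * (\<theta> * B (n + q) + B (n + q - 1))
           \<le> real p / (real d)\<^sup>2 * (4 * 2 ^ (n + q) * (u\<^sup>2 * real d))"
          using 1 by (intro mult_left_mono) auto
        also have "\<dots> = (16 * real p * (real p + 1) ^ 4 * u\<^sup>2) * (2 ^ (n + q) / (4 * real d * (real p + 1) ^ 4))"
          using d by (simp add: field_simps power2_eq_square)
        also have "\<dots> \<le> (\<theta> ^ 3 * real d) * (2 ^ (n + q) / (4 * real d * (real p + 1) ^ 4))"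
          using 3 by (intro mult_right_mono) auto
        also have "\<dots> = \<theta> * (\<theta> / 2 * 2 ^ n / (real p + 1)\<^sup>2) * (\<theta> / 2 * 2 ^ q / (real p + 1)\<^sup>2)"
        proof -
          have "t ^ 3 * e * (N * Q / (4 * e * w ^ 4)) = t * (t / 2 * N / w\<^sup>2) * (t / 2 * Q / w\<^sup>2)"
            if "e > 0" "w > 0" for t e N Q w :: real
            using that by (simp add: field_simps power2_eq_square power3_eq_cube power4_eq_xxxx)
          from this[of "real d" "real p + 1" \<theta> "2 ^ n" "2 ^ q"] show ?thesis using d by (simp add: power_add)
        qed
        also have "\<dots> \<le> \<theta> * B n * B q"
          using \<theta> nq by (intro mult_mono 2 order_refl) (auto intro!: mult_nonneg_nonneg bseq_nonneg simp: B_def)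
        finally show "real p / (real d)\<^sup>2 * (\<theta> * bseq \<theta> \<theta> (n + q) + bseq \<theta> \<theta> (n + q - 1))
          \<le> \<theta> * bseq \<theta> \<theta> n * bseq \<theta> \<theta> q" by (simp add: B_def)
      qed (use elim \<theta> d in auto)
      also have "\<dots> \<le> 2 * (2 * u) ^ p" using Ble[of p] by (simp add: B_def)
      finally have "cmod (T d [p]) / R ^ p \<le> 2 * (2 * u) ^ p / R ^ p"
        using assms by (intro divide_right_mono) auto
      also have "\<dots> = 2 / (u ^ p) ^ 4"
        using u by (simp add: R power_mult_distrib field_simps power_mult[symmetric] power_add[symmetric])
      also have "\<dots> \<le> 2 / real d ^ 4"
        using P(1)[OF d] d by (intro frac_le power_mono) (auto simp: p_def)
      finally have "real d * (cmod (T d [p]) / R ^ p) \<le> real d * (2 / real d ^ 4)"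
        by (rule mult_left_mono) simp
      also have "\<dots> = 2 / real d ^ 3" using d by (simp add: field_simps power_numeral_reduce)
      finally show ?case by (simp add: p_def)
    qed
  qed
  moreover have "\<forall>d. even (P d)" by (simp add: P_def)
  ultimately show ?thesis by (intro exI[of _ P]) auto
qed

section \<open>Gaussian integration by parts\<close>

text \<open>The identity E[Y f(Y)] = Var(Y) E[f'(Y)] on monomials, with variance 1/2; it is read off
  from the explicit even and odd moments. At n = 0 the factor n cancels the truncated
  exponent.\<close>

lemma distributed_normal_moment:
  fixes Y :: "'a \<Rightarrow> real"
  assumes D: "distributed M lborel Y (normal_density 0 (sqrt (1 / 2)))"
  shows "integrable M (\<lambda>\<omega>. Y \<omega> ^ n)"
    and "(\<integral>\<omega>. Y \<omega> ^ Suc n \<partial>M) = real n / 2 * (\<integral>\<omega>. Y \<omega> ^ (n - 1) \<partial>M)"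
proof -
  let ?f = "normal_density 0 (sqrt (1 / 2))"
  show "integrable M (\<lambda>\<omega>. Y \<omega> ^ n)"
    using distributed_integrable[OF D, of "\<lambda>x. x ^ n"] integrable_normal_moment[of "sqrt (1/2)" 0 n]
    by simp
  have I: "(\<integral>\<omega>. Y \<omega> ^ k \<partial>M) = (\<integral>x. ?f x * x ^ k \<partial>lborel)" for k
    using distributed_integral[OF D, of "\<lambda>x. x ^ k"] by simp
  have odd: "(\<integral>\<omega>. Y \<omega> ^ (2 * k + 1) \<partial>M) = 0" for k
    using integral_normal_moment_odd[of "sqrt (1/2)" 0 k] unfolding I by simp
  have even: "(\<integral>\<omega>. Y \<omega> ^ (2 * k) \<partial>M) = fact (2 * k) / (4 ^ k * fact k)" for k
    using integral_normal_moment_even[of "sqrt (1/2)" 0 k] unfolding I by (simp add: real_sqrt_divide power_divide)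
  show "(\<integral>\<omega>. Y \<omega> ^ Suc n \<partial>M) = real n / 2 * (\<integral>\<omega>. Y \<omega> ^ (n - 1) \<partial>M)"
  proof (cases "even n")
    case True
    then obtain k where n: "n = 2 * k" by blast
    show ?thesis
    proof (cases k)
      case (Suc j)
      then show ?thesis using odd[of k] odd[of j] by (simp add: n)
    qed (use odd[of 0] n in simp)
  next
    case False
    then obtain k where n: "n = 2 * k + 1" using oddE by blast
    have "(\<integral>\<omega>. Y \<omega> ^ Suc n \<partial>M) = fact (2 * Suc k) / (4 ^ Suc k * fact (Suc k))"
      using even[of "Suc k"] by (simp add: n)
    also have "\<dots> = real n / 2 * (fact (2 * k) / (4 ^ k * fact k))"
      by (simp add: n divide_simps)
    finally show ?thesis using even[of k] by (simp add: n)
  qed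
qed

section \<open>Moments of a single complex Gaussian variable\<close>

definition re_im_monomial :: "('a \<Rightarrow> complex) \<Rightarrow> nat \<Rightarrow> nat \<Rightarrow> nat \<Rightarrow> nat \<Rightarrow> 'a \<Rightarrow> complex" where
  "re_im_monomial X m n p q \<omega> =
     of_real (Re (X \<omega>)) ^ m * of_real (Im (X \<omega>)) ^ n * (X \<omega> ^ p * cnj (X \<omega>) ^ q)"

text \<open>Writing one factor X or its conjugate through real and imaginary part lowers p + q at
  the price of m or n. At p + q = 0 independence of the two parts applies.\<close>

lemma re_im_monomial_Suc:
  "re_im_monomial X m n (Suc p) q =
     (\<lambda>\<omega>. re_im_monomial X (Suc m) n p q \<omega> + \<i> * re_im_monomial X m (Suc n) p q \<omega>)"
  "re_im_monomial X m n p (Suc q) =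
     (\<lambda>\<omega>. re_im_monomial X (Suc m) n p q \<omega> - \<i> * re_im_monomial X m (Suc n) p q \<omega>)"
proof -
  have X: "X \<omega> ^ Suc p = (of_real (Re (X \<omega>)) + \<i> * of_real (Im (X \<omega>))) * X \<omega> ^ p"
    "cnj (X \<omega>) ^ Suc q = (of_real (Re (X \<omega>)) - \<i> * of_real (Im (X \<omega>))) * cnj (X \<omega>) ^ q" for \<omega>
    by (auto simp: complex_eq_iff)
  show "re_im_monomial X m n (Suc p) q =
      (\<lambda>\<omega>. re_im_monomial X (Suc m) n p q \<omega> + \<i> * re_im_monomial X m (Suc n) p q \<omega>)"
    unfolding re_im_monomial_def X by (intro ext) (simp add: algebra_simps)
  show "re_im_monomial X m n p (Suc q) =
      (\<lambda>\<omega>. re_im_monomial X (Suc m) n p q \<omega> - \<i> * re_im_monomial X m (Suc n) p q \<omega>)"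
    unfolding re_im_monomial_def X by (intro ext) (simp add: algebra_simps)
qed

context prob_space
begin

lemma
  assumes "std_complex_gaussian M X"
  shows integrable_re_im: "integrable M (\<lambda>\<omega>. Re (X \<omega>) ^ m * Im (X \<omega>) ^ n)"
    and expectation_re_im: "expectation (\<lambda>\<omega>. Re (X \<omega>) ^ m * Im (X \<omega>) ^ n) =
      expectation (\<lambda>\<omega>. Re (X \<omega>) ^ m) * expectation (\<lambda>\<omega>. Im (X \<omega>) ^ n)"
proof -
  have "indep_var borel (\<lambda>\<omega>. Re (X \<omega>)) borel (\<lambda>\<omega>. Im (X \<omega>))"
    using assms by (simp add: std_complex_gaussian_def)
  then have "indep_var borel ((\<lambda>x. x ^ m) \<circ> (\<lambda>\<omega>. Re (X \<omega>))) borel ((\<lambda>x. x ^ n) \<circ> (\<lambda>\<omega>. Im (X \<omega>)))"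
    by (rule indep_var_compose) auto
  note * = this[unfolded comp_def]
  have "integrable M (\<lambda>\<omega>. Re (X \<omega>) ^ m)" "integrable M (\<lambda>\<omega>. Im (X \<omega>) ^ n)"
    using assms by (auto intro!: distributed_normal_moment(1) simp: std_complex_gaussian_def)
  from indep_var_integrable[OF * this] indep_var_lebesgue_integral[OF * this]
  show "integrable M (\<lambda>\<omega>. Re (X \<omega>) ^ m * Im (X \<omega>) ^ n)"
    "expectation (\<lambda>\<omega>. Re (X \<omega>) ^ m * Im (X \<omega>) ^ n) =
      expectation (\<lambda>\<omega>. Re (X \<omega>) ^ m) * expectation (\<lambda>\<omega>. Im (X \<omega>) ^ n)" by auto
qed

lemma integrable_re_im_monomial:
  assumes "std_complex_gaussian M X"
  shows "integrable M (re_im_monomial X m n p q)"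
proof (induction "p + q" arbitrary: m n p q)
  case 0
  have "integrable M (\<lambda>\<omega>. complex_of_real (Re (X \<omega>) ^ m * Im (X \<omega>) ^ n))"
    using integrable_re_im[OF assms] by (rule integrable_of_real)
  with 0 show ?case by (simp add: re_im_monomial_def[abs_def])
next
  case (Suc r)
  show ?case
  proof (cases p)
    case p: (Suc p')
    show ?thesis using Suc(2) unfolding p re_im_monomial_Suc(1)
      by (intro Bochner_Integration.integrable_add integrable_mult_right Suc(1)) auto
  next
    case 0
    then obtain q' where q: "q = Suc q'" using Suc(2) by (cases q) auto
    show ?thesis using Suc(2) unfolding q re_im_monomial_Suc(2)
      by (intro Bochner_Integration.integrable_diff integrable_mult_right Suc(1)) auto
  qed
qed

lemma std_complex_gaussian_integrable:
  assumes "std_complex_gaussian M X"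
  shows "integrable M (\<lambda>\<omega>. X \<omega> ^ p * cnj (X \<omega>) ^ q)"
  using integrable_re_im_monomial[OF assms, of 0 0] by (simp add: re_im_monomial_def[abs_def])

text \<open>Integration by parts \<open>E[X F] = E[\<partial>F / \<partial>X\<^sup>*]\<close> on monomials. The real and imaginary parts have
  to be kept as additional factors in order to make the induction on \<open>p + q\<close> go through.\<close>

lemma std_complex_gaussian_moment:
  assumes G: "std_complex_gaussian M X"
  shows "expectation (\<lambda>\<omega>. X \<omega> ^ Suc p * cnj (X \<omega>) ^ q) =
    of_nat q * expectation (\<lambda>\<omega>. X \<omega> ^ p * cnj (X \<omega>) ^ (q - 1))"
proof -
  define J where "J m n p q = expectation (re_im_monomial X m n p q)" for m n p q
  note int = integrable_re_im_monomial[OF G]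
  have Jp: "J m n (Suc p) q = J (Suc m) n p q + \<i> * J m (Suc n) p q" for m n p q
    unfolding J_def re_im_monomial_Suc(1)
    by (subst Bochner_Integration.integral_add; (intro integrable_mult_right int)?; simp only: integral_mult_right_zero)
  have Jq: "J m n p (Suc q) = J (Suc m) n p q - \<i> * J m (Suc n) p q" for m n p q
    unfolding J_def re_im_monomial_Suc(2)
    by (subst Bochner_Integration.integral_diff; (intro integrable_mult_right int)?; simp only: integral_mult_right_zero)
  define a where "a m = expectation (\<lambda>\<omega>. Re (X \<omega>) ^ m)" for m
  define b where "b m = expectation (\<lambda>\<omega>. Im (X \<omega>) ^ m)" for m
  have J0: "J m n 0 0 = of_real (a m * b n)" for m n
  proof -
    have "J m n 0 0 = expectation (\<lambda>\<omega>. complex_of_real (Re (X \<omega>) ^ m * Im (X \<omega>) ^ n))"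
      by (simp add: J_def re_im_monomial_def[abs_def])
    then show ?thesis using expectation_re_im[OF G] by (simp only: integral_complex_of_real a_def b_def)
  qed
  have D: "distributed M lborel (\<lambda>\<omega>. Re (X \<omega>)) (normal_density 0 (sqrt (1 / 2)))"
    "distributed M lborel (\<lambda>\<omega>. Im (X \<omega>)) (normal_density 0 (sqrt (1 / 2)))"
    using G by (auto simp: std_complex_gaussian_def)
  \<comment> \<open>The left side is 2 E[X F] and the right side the expectation of 2 \<partial>F /
    \<partial>X*, where 2 \<partial>/\<partial>X* is the derivative in Re X plus \<i> times that in
    Im X: it yields m, \<i> n and 2q from the respective powers and annihilates X^p.\<close>
  have key: "2 * (J (Suc m) n p q + \<i> * J m (Suc n) p q) =
      of_nat m * J (m - 1) n p q + \<i> * of_nat n * J m (n - 1) p q + 2 * of_nat q * J m n p (q - 1)" for m n p q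
  proof (induction "p + q" arbitrary: m n p q)
    case 0
    have ab: "a (Suc m) = real m / 2 * a (m - 1)" "b (Suc n) = real n / 2 * b (n - 1)"
      unfolding a_def b_def by (intro distributed_normal_moment(2) D)+
    show ?case using 0 by (simp add: J0 ab)
  next
    case (Suc r)
    show ?case
    proof (cases p)
      case p: (Suc p')
      have "r = p' + q" using Suc(2) p by simp
      note IH = Suc(1)[OF this]
      have "2 * (J (Suc m) n p q + \<i> * J m (Suc n) p q) =
          2 * (J (Suc (Suc m)) n p' q + \<i> * J (Suc m) (Suc n) p' q)
          + \<i> * (2 * (J (Suc m) (Suc n) p' q + \<i> * J m (Suc (Suc n)) p' q))"
        by (simp add: p Jp algebra_simps)
      also have "\<dots> = of_nat m * J (m - 1) n p q + \<i> * of_nat n * J m (n - 1) p q + 2 * of_nat q * J m n p (q - 1)"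
        unfolding IH by (cases m; cases n; cases q) (simp_all add: p Jp algebra_simps)
      finally show ?thesis .
    next
      case 0
      then obtain q' where q: "q = Suc q'" using Suc(2) by (cases q) auto
      then have "r = p + q'" using Suc(2) by simp
      note IH = Suc(1)[OF this]
      have "2 * (J (Suc m) n p q + \<i> * J m (Suc n) p q) =
          2 * (J (Suc (Suc m)) n p q' + \<i> * J (Suc m) (Suc n) p q')
          - \<i> * (2 * (J (Suc m) (Suc n) p q' + \<i> * J m (Suc (Suc n)) p q'))"
        by (simp add: q Jq algebra_simps)
      also have "\<dots> = of_nat m * J (m - 1) n p q + \<i> * of_nat n * J m (n - 1) p q + 2 * of_nat q * J m n p (q - 1)"
        unfolding IH by (cases m; cases n; cases q') (simp_all add: q Jq algebra_simps)
      finally show ?thesis .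
    qed
  qed
  have "2 * J 0 0 (Suc p) q = 2 * (of_nat q * J 0 0 p (q - 1))"
    using key[of 0 0 p q] by (simp add: Jp mult.assoc)
  then have "J 0 0 (Suc p) q = of_nat q * J 0 0 p (q - 1)" by simp
  then show ?thesis by (simp add: J_def re_im_monomial_def[abs_def])
qed

end

section \<open>Polynomials in the entries of a Gaussian matrix\<close>

locale gaussian_matrix = prob_space M for M :: "'a measure" +
  fixes d s :: nat and G :: "'a \<Rightarrow> complex mat"
  assumes gaussian: "complex_gaussian_matrix M d s G"
begin

abbreviation entries :: "(nat \<times> nat) set" where
  "entries \<equiv> {..<d} \<times> {..<s}"

definition g :: "nat \<times> nat \<Rightarrow> 'a \<Rightarrow> complex" where
  "g v \<omega> = G \<omega> $$ v"

definition monomial :: "(nat \<times> nat \<Rightarrow> nat) \<Rightarrow> (nat \<times> nat \<Rightarrow> nat) \<Rightarrow> 'a \<Rightarrow> complex" where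
  "monomial p q \<omega> = (\<Prod>v\<in>entries. g v \<omega> ^ p v * cnj (g v \<omega>) ^ q v)"

lemma std_complex_gaussian_g: "v \<in> entries \<Longrightarrow> std_complex_gaussian M (g v)"
  using gaussian unfolding complex_gaussian_matrix_def g_def by auto

lemma indep_vars_g: "indep_vars (\<lambda>_. borel) g entries"
proof -
  have "g = (\<lambda>(i, j) \<omega>. G \<omega> $$ (i, j))" by (auto simp: g_def fun_eq_iff)
  then show ?thesis using gaussian by (simp add: complex_gaussian_matrix_def)
qed

lemma
  shows integrable_monomial: "integrable M (monomial p q)"
    and expectation_monomial:
      "expectation (monomial p q) = (\<Prod>v\<in>entries. expectation (\<lambda>\<omega>. g v \<omega> ^ p v * cnj (g v \<omega>) ^ q v))"
proof -
  have "indep_vars (\<lambda>_. borel) (\<lambda>v \<omega>. (\<lambda>z. z ^ p v * cnj z ^ q v) (g v \<omega>)) entries"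
    by (intro indep_vars_compose2[OF indep_vars_g] borel_measurable_continuous_onI continuous_intros)
  note I = this[simplified]
  have int: "integrable M (\<lambda>\<omega>. g v \<omega> ^ p v * cnj (g v \<omega>) ^ q v)" if "v \<in> entries" for v
    using std_complex_gaussian_integrable[OF std_complex_gaussian_g[OF that]] .
  show "integrable M (monomial p q)"
    unfolding monomial_def[abs_def] using int by (intro indep_vars_integrable I) auto
  show "expectation (monomial p q) = (\<Prod>v\<in>entries. expectation (\<lambda>\<omega>. g v \<omega> ^ p v * cnj (g v \<omega>) ^ q v))"
    unfolding monomial_def[abs_def] using int by (intro indep_vars_lebesgue_integral I) auto
qed

lemma monomial_mult:
  assumes "x \<in> entries"
  shows "g x \<omega> * monomial p q \<omega> = monomial (p(x := Suc (p x))) q \<omega>"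
    and "cnj (g x \<omega>) * monomial p q \<omega> = monomial p (q(x := Suc (q x))) \<omega>"
proof -
  have *: "monomial p q \<omega> = g x \<omega> ^ p x * cnj (g x \<omega>) ^ q x *
     (\<Prod>v\<in>entries - {x}. g v \<omega> ^ p v * cnj (g v \<omega>) ^ q v)" for p q
    unfolding monomial_def using assms by (intro prod.remove) auto
  have "(\<Prod>v\<in>entries - {x}. g v \<omega> ^ p v * cnj (g v \<omega>) ^ q v) =
      (\<Prod>v\<in>entries - {x}. g v \<omega> ^ (p(x := Suc (p x))) v * cnj (g v \<omega>) ^ q v)"
    by (intro prod.cong) auto
  then show "g x \<omega> * monomial p q \<omega> = monomial (p(x := Suc (p x))) q \<omega>"
    unfolding * by simp
  have "(\<Prod>v\<in>entries - {x}. g v \<omega> ^ p v * cnj (g v \<omega>) ^ q v) =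
      (\<Prod>v\<in>entries - {x}. g v \<omega> ^ p v * cnj (g v \<omega>) ^ (q(x := Suc (q x))) v)"
    by (intro prod.cong) auto
  then show "cnj (g x \<omega>) * monomial p q \<omega> = monomial p (q(x := Suc (q x))) \<omega>"
    unfolding * by simp
qed

text \<open>The expectation factorizes over the independent entries and only the factor at x
  changes, so the one-variable identity suffices.\<close>

lemma monomial_integration_by_parts:
  assumes x: "x \<in> entries"
  shows "expectation (\<lambda>\<omega>. g x \<omega> * monomial p q \<omega>) =
     of_nat (q x) * expectation (monomial p (q(x := q x - 1)))"
proof -
  let ?E = "\<lambda>p q v. expectation (\<lambda>\<omega>. g v \<omega> ^ p v * cnj (g v \<omega>) ^ q v)"
  have rem: "expectation (monomial p q) = ?E p q x * (\<Prod>v\<in>entries - {x}. ?E p q v)" for p q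
    unfolding expectation_monomial using x by (intro prod.remove) auto
  have "(\<Prod>v\<in>entries - {x}. ?E (p(x := Suc (p x))) q v) = (\<Prod>v\<in>entries - {x}. ?E p (q(x := q x - 1)) v)"
    by (intro prod.cong) auto
  moreover have "?E (p(x := Suc (p x))) q x = of_nat (q x) * ?E p (q(x := q x - 1)) x"
    using std_complex_gaussian_moment[OF std_complex_gaussian_g[OF x], of "p x" "q x"] by simp
  ultimately show ?thesis
    unfolding monomial_mult(1)[OF x] by (simp only: rem mult.assoc)
qed

text \<open>\<open>wirtinger x F F'\<close>: \<open>F\<close> is a polynomial in the entries of \<open>G\<close> and their conjugates, and \<open>F'\<close>
  is its formal derivative with respect to the conjugate of the entry \<open>x\<close>.\<close>

inductive wirtinger :: "nat \<times> nat \<Rightarrow> ('a \<Rightarrow> complex) \<Rightarrow> ('a \<Rightarrow> complex) \<Rightarrow> bool" for x where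
  one: "wirtinger x (\<lambda>\<omega>. 1) (\<lambda>\<omega>. 0)"
| entry: "wirtinger x F F' \<Longrightarrow> y \<in> entries \<Longrightarrow> wirtinger x (\<lambda>\<omega>. g y \<omega> * F \<omega>) (\<lambda>\<omega>. g y \<omega> * F' \<omega>)"
| conj: "wirtinger x F F' \<Longrightarrow> y \<in> entries \<Longrightarrow>
    wirtinger x (\<lambda>\<omega>. cnj (g y \<omega>) * F \<omega>) (\<lambda>\<omega>. (if x = y then F \<omega> else 0) + cnj (g y \<omega>) * F' \<omega>)"
| add: "wirtinger x F F' \<Longrightarrow> wirtinger x H H' \<Longrightarrow> wirtinger x (\<lambda>\<omega>. F \<omega> + H \<omega>) (\<lambda>\<omega>. F' \<omega> + H' \<omega>)"
| cmult: "wirtinger x F F' \<Longrightarrow> wirtinger x (\<lambda>\<omega>. c * F \<omega>) (\<lambda>\<omega>. c * F' \<omega>)"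

definition monomial_deriv :: "nat \<times> nat \<Rightarrow> (nat \<times> nat \<Rightarrow> nat) \<Rightarrow> (nat \<times> nat \<Rightarrow> nat) \<Rightarrow> 'a \<Rightarrow> complex" where
  "monomial_deriv x p q \<omega> = of_nat (q x) * monomial p (q(x := q x - 1)) \<omega>"

lemma monomial_deriv_entry:
  "y \<in> entries \<Longrightarrow> monomial_deriv x (p(y := Suc (p y))) q \<omega> = g y \<omega> * monomial_deriv x p q \<omega>"
  by (simp add: monomial_deriv_def flip: monomial_mult(1))

lemma monomial_deriv_conj:
  assumes y: "y \<in> entries"
  shows "monomial_deriv x p (q(y := Suc (q y))) \<omega> =
    (if x = y then monomial p q \<omega> else 0) + cnj (g y \<omega>) * monomial_deriv x p q \<omega>"
proof (cases "x = y")
  case True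
  have "cnj (g y \<omega>) * (of_nat (q y) * monomial p (q(y := q y - 1)) \<omega>) = of_nat (q y) * monomial p q \<omega>"
  proof (cases "q y")
    case (Suc n)
    have "cnj (g y \<omega>) * monomial p (q(y := n)) \<omega> = monomial p q \<omega>"
      using monomial_mult(2)[OF y, of \<omega> p "q(y := n)"] Suc by (simp add: fun_upd_idem)
    then show ?thesis by (simp add: Suc mult.left_commute)
  qed simp
  then show ?thesis using True by (auto simp: monomial_deriv_def algebra_simps)
next
  case False
  then have "cnj (g y \<omega>) * monomial p (q(x := q x - 1)) \<omega> = monomial p ((q(y := Suc (q y)))(x := q x - 1)) \<omega>"
    using monomial_mult(2)[OF y, of \<omega> p "q(x := q x - 1)"] by (simp add: fun_upd_twist)
  then show ?thesis using False by (simp add: monomial_deriv_def mult.left_commute)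
qed

text \<open>The extra monomial factor makes the induction work: multiplication by an entry or its
  conjugate is absorbed into the exponents. Integrability is carried along because expectations have
  to be split in the additive case.\<close>

lemma wirtinger_monomial:
  assumes "wirtinger x F F'" and x: "x \<in> entries"
  shows "integrable M (\<lambda>\<omega>. F \<omega> * monomial p q \<omega>) \<and> integrable M (\<lambda>\<omega>. F' \<omega> * monomial p q \<omega>) \<and>
    expectation (\<lambda>\<omega>. g x \<omega> * (F \<omega> * monomial p q \<omega>)) =
      expectation (\<lambda>\<omega>. F' \<omega> * monomial p q \<omega> + F \<omega> * monomial_deriv x p q \<omega>)"
  using assms(1)
proof (induction arbitrary: p q)
  case one
  show ?case using monomial_integration_by_parts[OF x, of p q] integrable_monomial[of p q]
    by (simp add: monomial_deriv_def)
next
  case (entry F F' y)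
  have e: "g y \<omega> * F \<omega> * monomial p q \<omega> = F \<omega> * monomial (p(y := Suc (p y))) q \<omega>"
    "g y \<omega> * F \<omega> * monomial_deriv x p q \<omega> = F \<omega> * monomial_deriv x (p(y := Suc (p y))) q \<omega>" for F \<omega>
    unfolding monomial_mult(1)[OF entry.hyps(2), symmetric] monomial_deriv_entry[OF entry.hyps(2)]
    by (simp_all only: mult_ac)
  show ?case unfolding e by (rule entry.IH)
next
  case (conj F F' y)
  have e: "cnj (g y \<omega>) * F \<omega> * monomial p q \<omega> = F \<omega> * monomial p (q(y := Suc (q y))) \<omega>" for F \<omega>
    unfolding monomial_mult(2)[OF conj.hyps(2), symmetric] by (simp only: mult_ac)
  have e': "((if x = y then F \<omega> else 0) + cnj (g y \<omega>) * F' \<omega>) * monomial p q \<omega> =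
     (if x = y then 1 else 0) * (F \<omega> * monomial p q \<omega>) + F' \<omega> * monomial p (q(y := Suc (q y))) \<omega>" for \<omega>
    by (simp add: distrib_right e)
  have e'': "((if x = y then F \<omega> else 0) + cnj (g y \<omega>) * F' \<omega>) * monomial p q \<omega>
      + cnj (g y \<omega>) * F \<omega> * monomial_deriv x p q \<omega> =
     F' \<omega> * monomial p (q(y := Suc (q y))) \<omega> + F \<omega> * monomial_deriv x p (q(y := Suc (q y))) \<omega>" for \<omega>
    unfolding monomial_deriv_conj[OF conj.hyps(2)] e[of _ F', symmetric]
    by (simp add: algebra_simps)
  have "integrable M (\<lambda>\<omega>. (if x = y then 1 else 0) * (F \<omega> * monomial p q \<omega>) + F' \<omega> * monomial p (q(y := Suc (q y))) \<omega>)"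
    using conj.IH by (intro Bochner_Integration.integrable_add integrable_mult_right) auto
  with conj.IH[of p "q(y := Suc (q y))"] show ?case
    unfolding e'' unfolding e' e by (elim conjE, intro conjI) assumption+
next
  case (add F F' H H')
  \<comment> \<open>Multiplying by g x or differentiating the monomial gives again a multiple of a
    monomial, so both integrability claims are instances of the hypothesis for other
    exponents.\<close>
  have gK: "integrable M (\<lambda>\<omega>. g x \<omega> * (K \<omega> * monomial p q \<omega>))"
    and dK: "integrable M (\<lambda>\<omega>. K \<omega> * monomial_deriv x p q \<omega>)"
    if "\<And>p q. integrable M (\<lambda>\<omega>. K \<omega> * monomial p q \<omega>)" for K
  proof -
    have "g x \<omega> * (K \<omega> * monomial p q \<omega>) = K \<omega> * monomial (p(x := Suc (p x))) q \<omega>" for \<omega>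
      unfolding monomial_mult(1)[OF x, symmetric] by (simp only: mult_ac)
    then show "integrable M (\<lambda>\<omega>. g x \<omega> * (K \<omega> * monomial p q \<omega>))"
      by (simp only:) (rule that)
    have "K \<omega> * monomial_deriv x p q \<omega> = of_nat (q x) * (K \<omega> * monomial p (q(x := q x - 1)) \<omega>)" for \<omega>
      by (simp add: monomial_deriv_def)
    then show "integrable M (\<lambda>\<omega>. K \<omega> * monomial_deriv x p q \<omega>)"
      by (simp only:) (intro integrable_mult_right that)
  qed
  have iF: "integrable M (\<lambda>\<omega>. F \<omega> * monomial p q \<omega>)" "integrable M (\<lambda>\<omega>. F' \<omega> * monomial p q \<omega>)"
    and iH: "integrable M (\<lambda>\<omega>. H \<omega> * monomial p q \<omega>)" "integrable M (\<lambda>\<omega>. H' \<omega> * monomial p q \<omega>)" for p q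
    using add.IH by auto
  have e: "(F \<omega> + H \<omega>) * c = F \<omega> * c + H \<omega> * c" "(F' \<omega> + H' \<omega>) * c = F' \<omega> * c + H' \<omega> * c" for c \<omega>
    by (simp_all add: distrib_right)
  have e': "F' \<omega> * m + H' \<omega> * m + (F \<omega> * c + H \<omega> * c) = (F' \<omega> * m + F \<omega> * c) + (H' \<omega> * m + H \<omega> * c)" for m c \<omega>
    by simp
  have "expectation (\<lambda>\<omega>. g x \<omega> * (F \<omega> * monomial p q \<omega>) + g x \<omega> * (H \<omega> * monomial p q \<omega>)) =
      expectation (\<lambda>\<omega>. F' \<omega> * monomial p q \<omega> + F \<omega> * monomial_deriv x p q \<omega>)
      + expectation (\<lambda>\<omega>. H' \<omega> * monomial p q \<omega> + H \<omega> * monomial_deriv x p q \<omega>)"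
    using add.IH[of p q] by (simp only: Bochner_Integration.integral_add[OF gK[OF iF(1)] gK[OF iH(1)]])
  also have "\<dots> = expectation (\<lambda>\<omega>. (F' \<omega> * monomial p q \<omega> + F \<omega> * monomial_deriv x p q \<omega>)
      + (H' \<omega> * monomial p q \<omega> + H \<omega> * monomial_deriv x p q \<omega>))"
    by (intro Bochner_Integration.integral_add[symmetric] Bochner_Integration.integrable_add iF(2) iH(2)
        dK[OF iF(1)] dK[OF iH(1)])
  finally show ?case
    unfolding e e' distrib_left[of "g x _"]
    by (intro conjI Bochner_Integration.integrable_add iF iH)
next
  case (cmult F F' c)
  have "c * F' \<omega> * monomial p q \<omega> + c * F \<omega> * monomial_deriv x p q \<omega> =
     c * (F' \<omega> * monomial p q \<omega> + F \<omega> * monomial_deriv x p q \<omega>)" for \<omega>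
    by (simp add: algebra_simps)
  then show ?case using cmult.IH[of p q] by (simp add: mult.assoc mult.left_commute[of _ c])
qed

lemma wirtinger_integration_by_parts:
  assumes "wirtinger x F F'" "x \<in> entries"
  shows "integrable M F" "integrable M F'" "expectation (\<lambda>\<omega>. g x \<omega> * F \<omega>) = expectation F'"
  using wirtinger_monomial[OF assms, of "\<lambda>_. 0" "\<lambda>_. 0"] by (simp_all add: monomial_def monomial_deriv_def)

lemma wirtinger_cong:
  assumes "wirtinger x F F'" "\<And>\<omega>. F \<omega> = H \<omega>" "\<And>\<omega>. F' \<omega> = H' \<omega>"
  shows "wirtinger x H H'"
proof -
  have "F = H" "F' = H'" using assms(2,3) by auto
  with assms(1) show ?thesis by simp
qed

lemma wirtinger_const: "wirtinger x (\<lambda>\<omega>. c) (\<lambda>\<omega>. 0)"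
  by (rule wirtinger_cong[OF wirtinger.cmult[OF wirtinger.one, of x c]]) auto

lemma wirtinger_entry: "y \<in> entries \<Longrightarrow> wirtinger x (g y) (\<lambda>\<omega>. 0)"
  by (rule wirtinger_cong[OF wirtinger.entry[OF wirtinger.one, of y x]]) auto

lemma wirtinger_conj: "y \<in> entries \<Longrightarrow> wirtinger x (\<lambda>\<omega>. cnj (g y \<omega>)) (\<lambda>\<omega>. if x = y then 1 else 0)"
  by (rule wirtinger_cong[OF wirtinger.conj[OF wirtinger.one, of y x]]) auto

text \<open>The Leibniz rule. The rules of \<open>wirtinger\<close> multiply by one entry at a time,
  so general products need an induction over the construction of one factor.\<close>

lemma wirtinger_mult:
  assumes "wirtinger x F F'" and H: "wirtinger x H H'"
  shows "wirtinger x (\<lambda>\<omega>. F \<omega> * H \<omega>) (\<lambda>\<omega>. F' \<omega> * H \<omega> + F \<omega> * H' \<omega>)"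
  using assms(1)
proof induction
  case one
  show ?case using H by simp
next
  case (entry F F' y)
  show ?case
    by (rule wirtinger_cong[OF wirtinger.entry[OF entry.IH entry.hyps(2)]]) (auto simp: algebra_simps)
next
  case (conj F F' y)
  show ?case
    by (rule wirtinger_cong[OF wirtinger.conj[OF conj.IH conj.hyps(2)]]) (auto simp: algebra_simps)
next
  case (add F F' K K')
  show ?case
    by (rule wirtinger_cong[OF wirtinger.add[OF add.IH]]) (auto simp: algebra_simps)
next
  case (cmult F F' c)
  show ?case
    by (rule wirtinger_cong[OF wirtinger.cmult[OF cmult.IH, of c]]) (auto simp: algebra_simps)
qed

lemma wirtinger_sum:
  "(\<And>i. i \<in> A \<Longrightarrow> wirtinger x (F i) (F' i)) \<Longrightarrow> wirtinger x (\<lambda>\<omega>. \<Sum>i\<in>A. F i \<omega>) (\<lambda>\<omega>. \<Sum>i\<in>A. F' i \<omega>)"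
  by (induction A rule: infinite_finite_induct) (auto intro: wirtinger_const wirtinger.add)

lemma wirtinger_prod:
  assumes "finite A" "\<And>i. i \<in> A \<Longrightarrow> wirtinger x (F i) (F' i)"
  shows "wirtinger x (\<lambda>\<omega>. \<Prod>i\<in>A. F i \<omega>) (\<lambda>\<omega>. \<Sum>i\<in>A. F' i \<omega> * (\<Prod>j\<in>A - {i}. F j \<omega>))"
  using assms
proof (induction A rule: finite_induct)
  case empty
  show ?case by (simp add: wirtinger_const)
next
  case (insert a A)
  have "(\<Sum>i\<in>A. F' i \<omega> * (\<Prod>j\<in>insert a A - {i}. F j \<omega>)) = (\<Sum>i\<in>A. F a \<omega> * (F' i \<omega> * (\<Prod>j\<in>A - {i}. F j \<omega>)))" for \<omega>
  proof (intro sum.cong refl)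
    fix i assume "i \<in> A"
    then have "insert a A - {i} = insert a (A - {i})" using insert by auto
    then show "F' i \<omega> * (\<Prod>j\<in>insert a A - {i}. F j \<omega>) = F a \<omega> * (F' i \<omega> * (\<Prod>j\<in>A - {i}. F j \<omega>))"
      using insert by (simp add: mult.left_commute)
  qed
  note e = this
  have 1: "wirtinger x (F a) (F' a)" using insert.prems by simp
  have 2: "wirtinger x (\<lambda>\<omega>. \<Prod>i\<in>A. F i \<omega>) (\<lambda>\<omega>. \<Sum>i\<in>A. F' i \<omega> * (\<Prod>j\<in>A - {i}. F j \<omega>))"
    using insert.prems by (intro insert.IH) simp
  show ?case
  proof (rule wirtinger_cong[OF wirtinger_mult[OF 1 2]])
    fix \<omega>
    show "F a \<omega> * (\<Prod>i\<in>A. F i \<omega>) = (\<Prod>i\<in>insert a A. F i \<omega>)"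
      using insert.hyps by simp
    have "insert a A - {a} = A" using insert.hyps by auto
    then show "F' a \<omega> * (\<Prod>i\<in>A. F i \<omega>) + F a \<omega> * (\<Sum>i\<in>A. F' i \<omega> * (\<Prod>j\<in>A - {i}. F j \<omega>)) =
        (\<Sum>i\<in>insert a A. F' i \<omega> * (\<Prod>j\<in>insert a A - {i}. F j \<omega>))"
      by (simp only: sum.insert[OF insert.hyps] e sum_distrib_left)
  qed
qed

end

section \<open>Loop equations for the recentred Wishart matrix\<close>

text \<open>Powers of index functions, so that entries are visibly polynomials in the Gaussian
  variables; \<open>pow_mat_entry\<close> makes the link with \<open>complex mat\<close>.\<close>

primrec mpow :: "nat \<Rightarrow> (nat \<Rightarrow> nat \<Rightarrow> complex) \<Rightarrow> nat \<Rightarrow> nat \<Rightarrow> nat \<Rightarrow> complex" where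
  "mpow d A 0 a b = (if a = b then 1 else 0)"
| "mpow d A (Suc n) a b = (\<Sum>u<d. A a u * mpow d A n u b)"

lemma mpow_add:
  assumes "a < d"
  shows "mpow d A (m + n) a b = (\<Sum>u<d. mpow d A m a u * mpow d A n u b)"
  using assms
proof (induction m arbitrary: a)
  case 0
  then show ?case by (simp add: if_distrib[of "\<lambda>x. x * _"] cong: if_cong)
next
  case (Suc m)
  have "mpow d A (Suc m + n) a b = (\<Sum>u<d. \<Sum>v<d. A a u * (mpow d A m u v * mpow d A n v b))"
    using Suc.IH by (simp add: sum_distrib_left)
  also have "\<dots> = (\<Sum>v<d. \<Sum>u<d. A a u * (mpow d A m u v * mpow d A n v b))" by (rule sum.swap)
  finally show ?case by (simp add: sum_distrib_right mult.assoc)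
qed

lemma mpow_1: "a < d \<Longrightarrow> b < d \<Longrightarrow> mpow d A (Suc 0) a b = A a b"
  by (simp add: if_distrib[of "\<lambda>x. _ * x"] cong: if_cong)

locale wishart_matrix = gaussian_matrix +
  assumes d_pos: "d \<ge> 1" and s_pos: "s \<ge> 1"
begin

definition \<kappa> :: real where "\<kappa> = sqrt (real d / real s)"

abbreviation root_ds :: complex where
  "root_ds \<equiv> of_real (sqrt (real d * real s))"

definition Z :: "'a \<Rightarrow> nat \<Rightarrow> nat \<Rightarrow> complex" where
  "Z \<omega> a b = ((\<Sum>l<s. g (a, l) \<omega> * cnj (g (b, l) \<omega>)) - (if a = b then of_nat s else 0)) / root_ds"

definition tr :: "nat \<Rightarrow> 'a \<Rightarrow> complex" where
  "tr n \<omega> = (\<Sum>x<d. mpow d (Z \<omega>) n x x) / of_nat d"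

abbreviation tr_prod :: "nat list \<Rightarrow> 'a \<Rightarrow> complex" where
  "tr_prod ns \<omega> \<equiv> prod_list (map (\<lambda>n. tr n \<omega>) ns)"

definition tr_moment :: "nat list \<Rightarrow> complex" where
  "tr_moment ns = expectation (\<lambda>\<omega>. tr_prod ns \<omega>)"

text \<open>The derivation \<open>F \<mapsto> F'\<close> adjoint to multiplication by the entry \<open>(a, b)\<close> of \<open>Z\<close>.\<close>

definition derivation :: "nat \<Rightarrow> nat \<Rightarrow> ('a \<Rightarrow> complex) \<Rightarrow> ('a \<Rightarrow> complex) \<Rightarrow> bool" where
  "derivation a b F F' \<longleftrightarrow> (\<exists>H. (\<forall>l<s. wirtinger (a, l) F (H l)) \<and>
     (\<forall>\<omega>. F' \<omega> = (\<Sum>l<s. cnj (g (b, l) \<omega>) * H l \<omega>) / root_ds))"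

lemma derivationI:
  "(\<And>l. l < s \<Longrightarrow> wirtinger (a, l) F (H l)) \<Longrightarrow>
   (\<And>\<omega>. F' \<omega> = (\<Sum>l<s. cnj (g (b, l) \<omega>) * H l \<omega>) / root_ds) \<Longrightarrow> derivation a b F F'"
  unfolding derivation_def by blast

lemma derivationE:
  assumes "derivation a b F F'"
  obtains H where "\<And>l. l < s \<Longrightarrow> wirtinger (a, l) F (H l)"
    "F' = (\<lambda>\<omega>. (\<Sum>l<s. cnj (g (b, l) \<omega>) * H l \<omega>) / root_ds)"
  using assms unfolding derivation_def fun_eq_iff by blast

lemma derivation_integrable:
  assumes "derivation a b F F'" "a < d"
  shows "integrable M F"
proof -
  obtain H where "wirtinger (a, 0) F (H 0)"
    using assms(1) s_pos by (elim derivationE) force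
  then show ?thesis using assms(2) s_pos by (intro wirtinger_integration_by_parts(1)) auto
qed

lemma expectation_double_sum:
  fixes f :: "nat \<Rightarrow> nat \<Rightarrow> 'a \<Rightarrow> complex"
  assumes "\<And>a b. a < d \<Longrightarrow> b < d \<Longrightarrow> integrable M (f a b)"
  shows "expectation (\<lambda>\<omega>. c * (\<Sum>a<d. \<Sum>b<d. f a b \<omega>)) = c * (\<Sum>a<d. \<Sum>b<d. expectation (f a b))"
proof -
  have "expectation (\<lambda>\<omega>. \<Sum>a<d. \<Sum>b<d. f a b \<omega>) = (\<Sum>a<d. expectation (\<lambda>\<omega>. \<Sum>b<d. f a b \<omega>))"
    using assms by (intro Bochner_Integration.integral_sum Bochner_Integration.integrable_sum) auto
  also have "\<dots> = (\<Sum>a<d. \<Sum>b<d. expectation (f a b))"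
    using assms by (intro sum.cong refl Bochner_Integration.integral_sum) auto
  finally show ?thesis by simp
qed

text \<open>Integrate each g(a, l) by parts against the conjugate of g(b, l) times F. The derivative
  of the conjugate entry contributes \<delta>_ab E[F] for every l, in total s \<delta>_ab E[F],
  which the centring of Z cancels; what remains is the derivation of F.\<close>

lemma derivation_integration_by_parts:
  assumes D: "derivation a b F F'" and ab: "a < d" "b < d"
  shows "integrable M F'" "expectation (\<lambda>\<omega>. Z \<omega> a b * F \<omega>) = expectation F'"
    "integrable M (\<lambda>\<omega>. Z \<omega> a b * F \<omega>)"
proof -
  obtain H where H: "\<And>l. l < s \<Longrightarrow> wirtinger (a, l) F (H l)"
    and F': "F' = (\<lambda>\<omega>. (\<Sum>l<s. cnj (g (b, l) \<omega>) * H l \<omega>) / root_ds)"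
    using D by (elim derivationE) blast
  have F: "integrable M F" using D ab(1) by (rule derivation_integrable)
  \<comment> \<open>The derivative of the conjugate entry times F is integrable as a whole;
    subtracting the Kronecker term isolates the summand with H.\<close>
  have iH: "integrable M (\<lambda>\<omega>. cnj (g (b, l) \<omega>) * H l \<omega>)" if l: "l < s" for l
  proof -
    have "integrable M (\<lambda>\<omega>. ((if (a, l) = (b, l) then F \<omega> else 0) + cnj (g (b, l) \<omega>) * H l \<omega>)
        - (if (a, l) = (b, l) then 1 else 0) * F \<omega>)"
      using wirtinger_integration_by_parts(2)[OF wirtinger.conj[OF H[OF l], of "(b, l)"]] ab l F
      by (intro Bochner_Integration.integrable_diff integrable_mult_right) auto
    then show ?thesis by (cases "a = b") simp_all
  qed
  show "integrable M F'" unfolding F'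
    by (intro integrable_divide Bochner_Integration.integrable_sum iH) auto
  have iG: "integrable M (\<lambda>\<omega>. g (a, l) \<omega> * (cnj (g (b, l) \<omega>) * F \<omega>))" if l: "l < s" for l
    using ab l
    by (intro wirtinger_integration_by_parts(1)[OF wirtinger.entry[OF wirtinger.conj[OF H[OF l]]]]) auto
  have E: "expectation (\<lambda>\<omega>. g (a, l) \<omega> * (cnj (g (b, l) \<omega>) * F \<omega>)) =
      (if a = b then 1 else 0) * expectation F + expectation (\<lambda>\<omega>. cnj (g (b, l) \<omega>) * H l \<omega>)" if l: "l < s" for l
  proof -
    have "expectation (\<lambda>\<omega>. g (a, l) \<omega> * (cnj (g (b, l) \<omega>) * F \<omega>)) =
       expectation (\<lambda>\<omega>. (if (a, l) = (b, l) then F \<omega> else 0) + cnj (g (b, l) \<omega>) * H l \<omega>)"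
      using ab l by (intro wirtinger_integration_by_parts(3) wirtinger.conj H) auto
    also have "\<dots> = expectation (\<lambda>\<omega>. (if a = b then 1 else 0) * F \<omega> + cnj (g (b, l) \<omega>) * H l \<omega>)"
      by (intro Bochner_Integration.integral_cong) auto
    also have "\<dots> = (if a = b then 1 else 0) * expectation F + expectation (\<lambda>\<omega>. cnj (g (b, l) \<omega>) * H l \<omega>)"
      using F iH[OF l] by (subst Bochner_Integration.integral_add) auto
    finally show ?thesis .
  qed
  have e: "Z \<omega> a b * F \<omega> = ((\<Sum>l<s. g (a, l) \<omega> * (cnj (g (b, l) \<omega>) * F \<omega>)) - (if a = b then of_nat s else 0) * F \<omega>) / root_ds" for \<omega>
    by (simp add: Z_def sum_distrib_right left_diff_distrib mult.assoc)
  show "integrable M (\<lambda>\<omega>. Z \<omega> a b * F \<omega>)" unfolding e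
    using F by (intro integrable_divide Bochner_Integration.integrable_diff Bochner_Integration.integrable_sum integrable_mult_right iG) auto
  have "expectation (\<lambda>\<omega>. Z \<omega> a b * F \<omega>) =
     ((\<Sum>l<s. expectation (\<lambda>\<omega>. g (a, l) \<omega> * (cnj (g (b, l) \<omega>) * F \<omega>))) - (if a = b then of_nat s else 0) * expectation F) / root_ds"
  proof -
    have "expectation (\<lambda>\<omega>. (\<Sum>l<s. g (a, l) \<omega> * (cnj (g (b, l) \<omega>) * F \<omega>)) - c * F \<omega>) =
        expectation (\<lambda>\<omega>. \<Sum>l<s. g (a, l) \<omega> * (cnj (g (b, l) \<omega>) * F \<omega>)) - expectation (\<lambda>\<omega>. c * F \<omega>)" for c
      using F by (intro Bochner_Integration.integral_diff Bochner_Integration.integrable_sum integrable_mult_right iG) auto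
    moreover have "expectation (\<lambda>\<omega>. \<Sum>l<s. g (a, l) \<omega> * (cnj (g (b, l) \<omega>) * F \<omega>)) =
        (\<Sum>l<s. expectation (\<lambda>\<omega>. g (a, l) \<omega> * (cnj (g (b, l) \<omega>) * F \<omega>)))"
      by (intro Bochner_Integration.integral_sum iG) auto
    ultimately show ?thesis unfolding e integral_divide_zero integral_mult_right_zero by (simp only:)
  qed
  also have "\<dots> = (\<Sum>l<s. expectation (\<lambda>\<omega>. cnj (g (b, l) \<omega>) * H l \<omega>)) / root_ds"
    by (simp add: E sum.distrib)
  also have "\<dots> = expectation F'" unfolding F' using iH
    by (simp add: Bochner_Integration.integral_sum del: of_real_mult)
  finally show "expectation (\<lambda>\<omega>. Z \<omega> a b * F \<omega>) = expectation F'" .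
qed

lemma derivation_cong:
  assumes "derivation a b F F'" "\<And>\<omega>. F \<omega> = H \<omega>" "\<And>\<omega>. F' \<omega> = H' \<omega>"
  shows "derivation a b H H'"
proof -
  have "F = H" "F' = H'" using assms(2,3) by auto
  with assms(1) show ?thesis by simp
qed

lemma derivation_const: "derivation a b (\<lambda>\<omega>. c) (\<lambda>\<omega>. 0)"
  by (rule derivationI[where H = "\<lambda>l \<omega>. 0"]) (auto intro: wirtinger_const)

lemma derivation_add:
  assumes "derivation a b F F'" "derivation a b K K'"
  shows "derivation a b (\<lambda>\<omega>. F \<omega> + K \<omega>) (\<lambda>\<omega>. F' \<omega> + K' \<omega>)"
proof -
  from assms obtain H J where "\<And>l. l < s \<Longrightarrow> wirtinger (a, l) F (H l)" "\<And>l. l < s \<Longrightarrow> wirtinger (a, l) K (J l)"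
    "F' = (\<lambda>\<omega>. (\<Sum>l<s. cnj (g (b, l) \<omega>) * H l \<omega>) / root_ds)"
    "K' = (\<lambda>\<omega>. (\<Sum>l<s. cnj (g (b, l) \<omega>) * J l \<omega>) / root_ds)"
    by (elim derivationE) blast
  then show ?thesis
    by (intro derivationI[where H = "\<lambda>l \<omega>. H l \<omega> + J l \<omega>"] wirtinger.add)
       (auto simp: distrib_left sum.distrib add_divide_distrib)
qed

lemma derivation_mult:
  assumes "derivation a b F F'" "derivation a b K K'"
  shows "derivation a b (\<lambda>\<omega>. F \<omega> * K \<omega>) (\<lambda>\<omega>. F' \<omega> * K \<omega> + F \<omega> * K' \<omega>)"
proof -
  from assms obtain H J where "\<And>l. l < s \<Longrightarrow> wirtinger (a, l) F (H l)" "\<And>l. l < s \<Longrightarrow> wirtinger (a, l) K (J l)"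
    "F' = (\<lambda>\<omega>. (\<Sum>l<s. cnj (g (b, l) \<omega>) * H l \<omega>) / root_ds)"
    "K' = (\<lambda>\<omega>. (\<Sum>l<s. cnj (g (b, l) \<omega>) * J l \<omega>) / root_ds)"
    by (elim derivationE) blast
  then show ?thesis
    by (intro derivationI[where H = "\<lambda>l \<omega>. H l \<omega> * K \<omega> + F \<omega> * J l \<omega>"] wirtinger_mult)
       (auto simp: distrib_left sum.distrib add_divide_distrib sum_distrib_left sum_distrib_right mult_ac)
qed

lemma derivation_cmult:
  assumes "derivation a b F F'"
  shows "derivation a b (\<lambda>\<omega>. c * F \<omega>) (\<lambda>\<omega>. c * F' \<omega>)"
  by (rule derivation_cong[OF derivation_mult[OF derivation_const[of a b c] assms]]) auto

lemma derivation_sum: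
  "(\<And>i. i \<in> A \<Longrightarrow> derivation a b (F i) (F' i)) \<Longrightarrow> derivation a b (\<lambda>\<omega>. \<Sum>i\<in>A. F i \<omega>) (\<lambda>\<omega>. \<Sum>i\<in>A. F' i \<omega>)"
  by (induction A rule: infinite_finite_induct) (auto intro: derivation_const derivation_add)

lemma sqrt_ds: "sqrt (real d * real s) = real d / \<kappa>"
  using d_pos s_pos by (simp add: \<kappa>_def real_sqrt_mult real_sqrt_divide field_simps)

lemma \<kappa>_pos: "\<kappa> > 0"
  using d_pos s_pos by (simp add: \<kappa>_def)

lemma s_eq: "real s = real d / \<kappa>\<^sup>2"
  using d_pos s_pos by (simp add: \<kappa>_def)

lemma derivation_Z:
  assumes "a < d" "b < d" "x < d" "y < d"
  shows "derivation a b (\<lambda>\<omega>. Z \<omega> x y)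
    (\<lambda>\<omega>. if a = y then (of_real \<kappa> * Z \<omega> x b + (if x = b then 1 else 0)) / of_nat d else 0)"
proof (rule derivationI)
  fix l assume l: "l < s"
  have "wirtinger (a, l) (\<lambda>\<omega>. \<Sum>k<s. g (x, k) \<omega> * cnj (g (y, k) \<omega>))
      (\<lambda>\<omega>. \<Sum>k<s. 0 * cnj (g (y, k) \<omega>) + g (x, k) \<omega> * (if (a, l) = (y, k) then 1 else 0))"
    using assms by (intro wirtinger_sum wirtinger_mult wirtinger_entry wirtinger_conj) auto
  note w = wirtinger.cmult[OF wirtinger.add[OF this wirtinger_const[of _ "- (if x = y then of_nat s else 0)"]], of "1 / root_ds"]
  show "wirtinger (a, l) (\<lambda>\<omega>. Z \<omega> x y) (\<lambda>\<omega>. if a = y then g (x, l) \<omega> / root_ds else 0)"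
    by (rule wirtinger_cong[OF w])
       (use l in \<open>auto simp: Z_def if_distrib[of "\<lambda>x. _ * x"] cong: if_cong\<close>)
next
  fix \<omega>
  let ?S = "\<Sum>l<s. g (x, l) \<omega> * cnj (g (b, l) \<omega>)"
  have k: "complex_of_real \<kappa> \<noteq> 0" using \<kappa>_pos by simp
  have s: "of_nat s = complex_of_real (real d / \<kappa>\<^sup>2)" using s_eq by (metis of_real_of_nat_eq)
  have "(of_real \<kappa> * Z \<omega> x b + (if x = b then 1 else 0)) / of_nat d = ?S / root_ds / root_ds"
    unfolding Z_def sqrt_ds s using d_pos k
    by (simp add: field_simps power2_eq_square)
  then show "(if a = y then (of_real \<kappa> * Z \<omega> x b + (if x = b then 1 else 0)) / of_nat d else 0) =
     (\<Sum>l<s. cnj (g (b, l) \<omega>) * (if a = y then g (x, l) \<omega> / root_ds else 0)) / root_ds"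
    by (simp add: sum_divide_distrib mult.commute)
qed

text \<open>The derivative hits one of the n factors; j counts the factors to its left. The power is
  cut there: the left piece, completed by \<kappa> Z + 1, ends in b and the right piece starts in
  a.\<close>

lemma derivation_mpow:
  assumes "a < d" "b < d" "x < d" "y < d"
  shows "derivation a b (\<lambda>\<omega>. mpow d (Z \<omega>) n x y)
    (\<lambda>\<omega>. (\<Sum>j<n. (of_real \<kappa> * mpow d (Z \<omega>) (Suc j) x b + mpow d (Z \<omega>) j x b) * mpow d (Z \<omega>) (n - 1 - j) a y) / of_nat d)"
  using assms(3)
proof (induction n arbitrary: x)
  case 0
  then show ?case by (simp add: derivation_const)
next
  case (Suc n)
  note D = derivation_sum[OF derivation_mult[OF derivation_Z[OF assms(1,2) Suc.prems] Suc.IH], of "{..<d}" "\<lambda>x. x" "\<lambda>x. x"]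
  show ?case
  proof (rule derivation_cong[OF D])
    fix \<omega>
    let ?P = "mpow d (Z \<omega>)"
    let ?K = "\<lambda>j u. of_real \<kappa> * ?P (Suc j) u b + ?P j u b"
    \<comment> \<open>The first factor is hit; \<open>2\<close> treats the hits further to the
      right, which the induction hypothesis supplies.\<close>
    have 1: "(\<Sum>u<d. (if a = u then (of_real \<kappa> * Z \<omega> x b + (if x = b then 1 else 0)) / of_nat d else 0) * ?P n u y)
       = ?K 0 x * ?P n a y / of_nat d"
      using assms Suc.prems by (simp add: if_distrib[of "\<lambda>x. x * _"] mpow_1 del: mpow.simps(2) cong: if_cong)
    have 2: "(\<Sum>u<d. Z \<omega> x u * ((\<Sum>j<n. ?K j u * ?P (n - 1 - j) a y) / of_nat d))
       = (\<Sum>j<n. ?K (Suc j) x * ?P (n - 1 - j) a y) / of_nat d"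
    proof -
      have "(\<Sum>u<d. Z \<omega> x u * ((\<Sum>j<n. ?K j u * ?P (n - 1 - j) a y) / of_nat d))
        = (\<Sum>u<d. \<Sum>j<n. Z \<omega> x u * ?K j u * ?P (n - 1 - j) a y) / of_nat d"
        by (simp add: sum_divide_distrib sum_distrib_left mult.assoc del: mpow.simps)
      also have "(\<Sum>u<d. \<Sum>j<n. Z \<omega> x u * ?K j u * ?P (n - 1 - j) a y) =
         (\<Sum>j<n. \<Sum>u<d. Z \<omega> x u * ?K j u * ?P (n - 1 - j) a y)" by (rule sum.swap)
      also have "\<dots> = (\<Sum>j<n. ?K (Suc j) x * ?P (n - 1 - j) a y)"
      proof (rule sum.cong[OF refl])
        fix j
        have "?K (Suc j) x = (\<Sum>u<d. Z \<omega> x u * ?K j u)"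
          unfolding mpow.simps(2)[of d "Z \<omega>" "Suc j" x b] mpow.simps(2)[of d "Z \<omega>" j x b]
          by (simp add: sum_distrib_left sum.distrib distrib_left mult.left_commute del: mpow.simps)
        then show "(\<Sum>u<d. Z \<omega> x u * ?K j u * ?P (n - 1 - j) a y) = ?K (Suc j) x * ?P (n - 1 - j) a y"
          by (simp only: sum_distrib_right)
      qed
      finally show ?thesis .
    qed
    show "(\<Sum>u<d. (if a = u then (of_real \<kappa> * Z \<omega> x b + (if x = b then 1 else 0)) / of_nat d else 0) * ?P n u y +
        Z \<omega> x u * ((\<Sum>j<n. ?K j u * ?P (n - 1 - j) a y) / of_nat d))
      = (\<Sum>j<Suc n. ?K j x * ?P (Suc n - 1 - j) a y) / of_nat d"
      unfolding sum.distrib 1 2 sum.lessThan_Suc_shift by (simp add: add_divide_distrib del: mpow.simps)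
  qed (auto)
qed

text \<open>Closing the trace glues the two pieces to one power of total order n or n - 1, wherever
  the cut was. Hence n equal terms, with one 1 / d from the normalization and one from
  \<open>derivation_Z\<close>.\<close>

lemma derivation_tr:
  assumes "a < d" "b < d"
  shows "derivation a b (tr n)
    (\<lambda>\<omega>. of_real (real n / (real d)\<^sup>2) * (of_real \<kappa> * mpow d (Z \<omega>) n a b + mpow d (Z \<omega>) (n - 1) a b))"
proof -
  have D: "derivation a b (\<lambda>\<omega>. 1 / of_nat d * (\<Sum>x<d. mpow d (Z \<omega>) n x x))
    (\<lambda>\<omega>. 1 / of_nat d * (\<Sum>x<d. (\<Sum>j<n. (of_real \<kappa> * mpow d (Z \<omega>) (Suc j) x b + mpow d (Z \<omega>) j x b) * mpow d (Z \<omega>) (n - 1 - j) a x) / of_nat d))"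
    using assms by (intro derivation_cmult derivation_sum derivation_mpow) auto
  show ?thesis
  proof (rule derivation_cong[OF D])
    fix \<omega>
    let ?P = "mpow d (Z \<omega>)"
    have "(\<Sum>x<d. \<Sum>j<n. (of_real \<kappa> * ?P (Suc j) x b + ?P j x b) * ?P (n - 1 - j) a x)
      = (\<Sum>j<n. \<Sum>x<d. (of_real \<kappa> * ?P (Suc j) x b + ?P j x b) * ?P (n - 1 - j) a x)" by (rule sum.swap)
    also have "\<dots> = (\<Sum>j<n. of_real \<kappa> * ?P n a b + ?P (n - 1) a b)"
    proof (rule sum.cong[OF refl])
      fix j assume "j \<in> {..<n}"
      then have "n = (n - 1 - j) + Suc j" "n - 1 = (n - 1 - j) + j" by auto
      then have "?P n a b = (\<Sum>x<d. ?P (n - 1 - j) a x * ?P (Suc j) x b)"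
        "?P (n - 1) a b = (\<Sum>x<d. ?P (n - 1 - j) a x * ?P j x b)"
        using mpow_add[OF assms(1)] by metis+
      then show "(\<Sum>x<d. (of_real \<kappa> * ?P (Suc j) x b + ?P j x b) * ?P (n - 1 - j) a x) =
        of_real \<kappa> * ?P n a b + ?P (n - 1) a b"
        by (simp add: sum_distrib_left sum.distrib algebra_simps del: mpow.simps)
    qed
    finally show "1 / of_nat d * (\<Sum>x<d. (\<Sum>j<n. (of_real \<kappa> * ?P (Suc j) x b + ?P j x b) * ?P (n - 1 - j) a x) / of_nat d)
      = of_real (real n / (real d)\<^sup>2) * (of_real \<kappa> * ?P n a b + ?P (n - 1) a b)"
      by (simp add: sum_divide_distrib[symmetric] power2_eq_square del: mpow.simps)
  qed (simp add: tr_def)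
qed

lemma derivation_prod_tr:
  assumes "a < d" "b < d"
  shows "derivation a b (\<lambda>\<omega>. tr_prod ns \<omega>)
    (\<lambda>\<omega>. \<Sum>i<length ns. of_real (real (ns ! i) / (real d)\<^sup>2) *
      (of_real \<kappa> * mpow d (Z \<omega>) (ns ! i) a b + mpow d (Z \<omega>) (ns ! i - 1) a b) *
      tr_prod (remove_nth i ns) \<omega>)"
proof (induction ns)
  case Nil
  show ?case by (simp add: derivation_const)
next
  case (Cons n ns)
  show ?case
    by (rule derivation_cong[OF derivation_mult[OF derivation_tr[OF assms, of n] Cons.IH]])
       (simp_all add: sum.lessThan_Suc_shift sum_distrib_left mult_ac del: mpow.simps sum.lessThan_Suc)
qed

lemma integrable_prod_tr: "integrable M (\<lambda>\<omega>. tr_prod ns \<omega>)"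
  using derivation_integrable[OF derivation_prod_tr] d_pos by auto

text \<open>Write the first trace as 1 / d times the sum of Z_ab (Z^n)_ba and integrate Z_ab by
  parts. The derivation acting on (Z^n)_ba gives a diagonal entry at b and one at a, thus two
  separate traces; acting on another trace it gives an (a, b) entry, which (Z^n)_ba closes to one
  merged trace.\<close>

theorem tr_moment_loop_equations: "loop_equations \<kappa> (real d) tr_moment"
  unfolding loop_equations_def
proof (intro conjI allI)
  show "tr_moment [] = 1" by (simp add: tr_moment_def prob_space)
  show "tr_moment (0 # ns) = tr_moment ns" for ns
    using d_pos by (simp add: tr_moment_def tr_def)
next
  fix n ns
  define F where "F ms \<omega> = prod_list (map (\<lambda>n. tr n \<omega>) ms)" for ms \<omega>
  define D where "D ms a b \<omega> = (\<Sum>i<length ms. of_real (real (ms ! i) / (real d)\<^sup>2) *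
      (of_real \<kappa> * mpow d (Z \<omega>) (ms ! i) a b + mpow d (Z \<omega>) (ms ! i - 1) a b) * F (remove_nth i ms) \<omega>)" for ms a b \<omega>
  have intF: "integrable M (F ms)" for ms
    unfolding F_def[abs_def] by (rule integrable_prod_tr)
  let ?P = "\<lambda>\<omega>. mpow d (Z \<omega>)"
  define R where "R a b \<omega> = (\<Sum>j<n. (of_real \<kappa> * ?P \<omega> (Suc j) b b + ?P \<omega> j b b) * ?P \<omega> (n - 1 - j) a a) / of_nat d * F ns \<omega>
      + ?P \<omega> n b a * D ns a b \<omega>" for a b \<omega>
  have R: "derivation a b (\<lambda>\<omega>. ?P \<omega> n b a * F ns \<omega>) (R a b)" if "a < d" "b < d" for a b
    unfolding R_def[abs_def] F_def D_def
    using that by (intro derivation_mult derivation_mpow derivation_prod_tr)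
  note ibp = derivation_integration_by_parts[OF R]
  have "tr_moment (Suc n # ns) = expectation (\<lambda>\<omega>. 1 / of_nat d * (\<Sum>a<d. \<Sum>b<d. Z \<omega> a b * (?P \<omega> n b a * F ns \<omega>)))"
    unfolding tr_moment_def
    by (intro Bochner_Integration.integral_cong refl)
       (simp add: F_def tr_def sum_distrib_left sum_distrib_right sum_divide_distrib mult.assoc)
  also have "\<dots> = 1 / of_nat d * (\<Sum>a<d. \<Sum>b<d. expectation (\<lambda>\<omega>. Z \<omega> a b * (?P \<omega> n b a * F ns \<omega>)))"
    using ibp(3) by (rule expectation_double_sum)
  also have "\<dots> = 1 / of_nat d * (\<Sum>a<d. \<Sum>b<d. expectation (R a b))"
    using ibp(2) by simp
  also have "\<dots> = expectation (\<lambda>\<omega>. 1 / of_nat d * (\<Sum>a<d. \<Sum>b<d. R a b \<omega>))"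
    using ibp(1) by (rule expectation_double_sum[symmetric])
  also have "\<dots> = expectation (\<lambda>\<omega>.
     (\<Sum>j<n. of_real \<kappa> * F (Suc j # (n - 1 - j) # ns) \<omega> + F (j # (n - 1 - j) # ns) \<omega>) +
     (\<Sum>i<length ns. of_real (real (ns ! i) / (real d)\<^sup>2) *
        (of_real \<kappa> * F ((n + ns ! i) # remove_nth i ns) \<omega> + F ((n + ns ! i - 1) # remove_nth i ns) \<omega>)))"
  proof (intro Bochner_Integration.integral_cong refl)
    fix \<omega>
    let ?Q = "mpow d (Z \<omega>)"
    have tr: "(\<Sum>x<d. ?Q k x x) = of_nat d * tr k \<omega>" for k
      using d_pos by (simp add: tr_def)
    have 1: "(\<Sum>a<d. \<Sum>b<d. (\<Sum>j<n. (of_real \<kappa> * ?Q (Suc j) b b + ?Q j b b) * ?Q (n - 1 - j) a a) / of_nat d * F ns \<omega>)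
      = of_nat d * (\<Sum>j<n. (of_real \<kappa> * tr (Suc j) \<omega> + tr j \<omega>) * tr (n - 1 - j) \<omega>) * F ns \<omega>"
    proof -
      have "(\<Sum>a<d. \<Sum>b<d. \<Sum>j<n. (of_real \<kappa> * ?Q (Suc j) b b + ?Q j b b) * ?Q (n - 1 - j) a a)
         = (\<Sum>j<n. \<Sum>a<d. \<Sum>b<d. (of_real \<kappa> * ?Q (Suc j) b b + ?Q j b b) * ?Q (n - 1 - j) a a)"
        by (simp only: sum.swap[of _ "{..<n}"])
      also have "\<dots> = (\<Sum>j<n. (of_real \<kappa> * (\<Sum>b<d. ?Q (Suc j) b b) + (\<Sum>b<d. ?Q j b b)) * (\<Sum>a<d. ?Q (n - 1 - j) a a))"
        by (intro sum.cong refl) (simp only: sum_distrib_left sum_distrib_right sum.distrib[symmetric])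
      also have "\<dots> = of_nat d * of_nat d * (\<Sum>j<n. (of_real \<kappa> * tr (Suc j) \<omega> + tr j \<omega>) * tr (n - 1 - j) \<omega>)"
        unfolding tr sum_distrib_left by (intro sum.cong refl) (simp add: algebra_simps)
      finally show ?thesis
        unfolding sum_divide_distrib[symmetric] sum_distrib_right[symmetric] using d_pos by simp
    qed
    have 2: "(\<Sum>a<d. \<Sum>b<d. ?Q n b a * D ns a b \<omega>) = of_nat d * (\<Sum>i<length ns. of_real (real (ns ! i) / (real d)\<^sup>2) *
        (of_real \<kappa> * tr (n + ns ! i) \<omega> + tr (n + ns ! i - 1) \<omega>) * F (remove_nth i ns) \<omega>)"
    proof -
      have "(\<Sum>a<d. \<Sum>b<d. ?Q n b a * D ns a b \<omega>) = (\<Sum>i<length ns. \<Sum>a<d. \<Sum>b<d. ?Q n b a * (of_real (real (ns ! i) / (real d)\<^sup>2) *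
      (of_real \<kappa> * ?Q (ns ! i) a b + ?Q (ns ! i - 1) a b) * F (remove_nth i ns) \<omega>))"
        unfolding D_def sum_distrib_left by (simp only: sum.swap[of _ "{..<length ns}"])
      also have "\<dots> = (\<Sum>i<length ns. of_nat d * (of_real (real (ns ! i) / (real d)\<^sup>2) *
        (of_real \<kappa> * tr (n + ns ! i) \<omega> + tr (n + ns ! i - 1) \<omega>) * F (remove_nth i ns) \<omega>))"
      proof (intro sum.cong refl)
        fix i assume "i \<in> {..<length ns}"
        let ?c = "of_real (real (ns ! i) / (real d)\<^sup>2) * F (remove_nth i ns) \<omega>"
        have cyc: "(\<Sum>a<d. \<Sum>b<d. ?Q n b a * ?Q k a b) = of_nat d * tr (n + k) \<omega>" for k
        proof -
          have "(\<Sum>a<d. \<Sum>b<d. ?Q n b a * ?Q k a b) = (\<Sum>b<d. \<Sum>a<d. ?Q n b a * ?Q k a b)" by (rule sum.swap)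
          also have "\<dots> = (\<Sum>b<d. ?Q (n + k) b b)" by (intro sum.cong refl) (simp add: mpow_add)
          finally show ?thesis by (simp add: tr)
        qed
        have "(\<Sum>a<d. \<Sum>b<d. ?Q n b a * (of_real (real (ns ! i) / (real d)\<^sup>2) *
            (of_real \<kappa> * ?Q (ns ! i) a b + ?Q (ns ! i - 1) a b) * F (remove_nth i ns) \<omega>))
          = ?c * (of_real \<kappa> * (\<Sum>a<d. \<Sum>b<d. ?Q n b a * ?Q (ns ! i) a b) + (\<Sum>a<d. \<Sum>b<d. ?Q n b a * ?Q (ns ! i - 1) a b))"
          unfolding sum_distrib_left sum.distrib[symmetric]
          by (intro sum.cong refl) (simp add: algebra_simps del: mpow.simps)
        also have "\<dots> = ?c * (of_real \<kappa> * (of_nat d * tr (n + ns ! i) \<omega>) + of_nat d * tr (n + (ns ! i - 1)) \<omega>)"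
          by (simp only: cyc)
        \<comment> \<open>The exponents n + (\<open>ns ! i\<close> - 1) and n +
          \<open>ns ! i\<close> - 1 can differ only for \<open>ns ! i\<close> = 0, when the
          coefficient vanishes.\<close>
        also have "\<dots> = of_nat d * (of_real (real (ns ! i) / (real d)\<^sup>2) *
           (of_real \<kappa> * tr (n + ns ! i) \<omega> + tr (n + ns ! i - 1) \<omega>) * F (remove_nth i ns) \<omega>)"
          by (cases "ns ! i") (simp_all add: algebra_simps)
        finally show "(\<Sum>a<d. \<Sum>b<d. ?Q n b a * (of_real (real (ns ! i) / (real d)\<^sup>2) *
            (of_real \<kappa> * ?Q (ns ! i) a b + ?Q (ns ! i - 1) a b) * F (remove_nth i ns) \<omega>)) = \<dots>" .
      qed
      finally show ?thesis by (simp only: sum_distrib_left)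
    qed
    have F2: "F (k # ms) \<omega> = tr k \<omega> * F ms \<omega>" for k ms by (simp add: F_def)
    show "1 / of_nat d * (\<Sum>a<d. \<Sum>b<d. R a b \<omega>) =
      (\<Sum>j<n. of_real \<kappa> * F (Suc j # (n - 1 - j) # ns) \<omega> + F (j # (n - 1 - j) # ns) \<omega>) +
     (\<Sum>i<length ns. of_real (real (ns ! i) / (real d)\<^sup>2) *
        (of_real \<kappa> * F ((n + ns ! i) # remove_nth i ns) \<omega> + F ((n + ns ! i - 1) # remove_nth i ns) \<omega>))"
      unfolding R_def sum.distrib 1 2 F2 using d_pos
      by (simp add: distrib_left distrib_right sum_distrib_right sum.distrib mult.assoc)
  qed
  also have "\<dots> = (\<Sum>j<n. of_real \<kappa> * expectation (F (Suc j # (n - 1 - j) # ns)) + expectation (F (j # (n - 1 - j) # ns))) +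
     (\<Sum>i<length ns. of_real (real (ns ! i) / (real d)\<^sup>2) *
        (of_real \<kappa> * expectation (F ((n + ns ! i) # remove_nth i ns)) + expectation (F ((n + ns ! i - 1) # remove_nth i ns))))"
    using intF by (simp add: Bochner_Integration.integral_sum Bochner_Integration.integral_add)
  finally show "tr_moment (Suc n # ns) =
     (\<Sum>j<n. loop_split \<kappa> tr_moment n ns j) +
     (\<Sum>i<length ns. loop_merge \<kappa> (real d) tr_moment n ns i)"
    by (simp only: tr_moment_def F_def[abs_def])
qed

end

section \<open>Spectrum and traces of powers\<close>

lemma mat_trace_mult_comm:
  assumes "A \<in> carrier_mat n m" "B \<in> carrier_mat m n"
  shows "mat_trace (A * B) = mat_trace (B * A)"
proof -
  have "mat_trace (A * B) = (\<Sum>i<n. \<Sum>j<m. A $$ (i, j) * B $$ (j, i))"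
    using assms by (auto simp: mat_trace_def scalar_prod_def atLeast0LessThan)
  also have "\<dots> = (\<Sum>j<m. \<Sum>i<n. A $$ (i, j) * B $$ (j, i))" by (rule sum.swap)
  also have "\<dots> = mat_trace (B * A)"
    using assms by (auto simp: mat_trace_def scalar_prod_def atLeast0LessThan mult.commute)
  finally show ?thesis .
qed

lemma mat_trace_similar:
  assumes "similar_mat_wit A B P Q" "A \<in> carrier_mat n n"
  shows "mat_trace A = mat_trace B"
proof -
  note w = similar_mat_witD2[OF assms(2,1)]
  have "mat_trace A = mat_trace (P * (B * Q))" using w by (simp add: assoc_mult_mat[of P n n B n Q n])
  also have "\<dots> = mat_trace (B * Q * P)" using w by (intro mat_trace_mult_comm[of _ n n]) auto
  also have "B * Q * P = B" using w by (simp add: assoc_mult_mat[of B n n Q n P n])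
  finally show ?thesis .
qed

lemma upper_triangular_pow:
  assumes B: "B \<in> carrier_mat n n" "upper_triangular (B :: complex mat)"
  shows "upper_triangular (B ^\<^sub>m k) \<and> (\<forall>i<n. (B ^\<^sub>m k) $$ (i, i) = (B $$ (i, i)) ^ k)"
proof (induction k)
  case 0
  then show ?case using B by (auto simp: upper_triangular_def)
next
  case (Suc k)
  have C: "B ^\<^sub>m k \<in> carrier_mat n n" using B by (intro pow_carrier_mat)
  have lowB: "j < i \<Longrightarrow> i < n \<Longrightarrow> B $$ (i, j) = 0" for i j
    using B by (auto simp: upper_triangular_def)
  have lowC: "j < i \<Longrightarrow> i < n \<Longrightarrow> (B ^\<^sub>m k) $$ (i, j) = 0" for i j
    using Suc C by (auto simp: upper_triangular_def)
  have entry: "(B ^\<^sub>m Suc k) $$ (i, j) = (\<Sum>u<n. (B ^\<^sub>m k) $$ (i, u) * B $$ (u, j))" if "i < n" "j < n" for i j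
    using that B C by (auto simp: scalar_prod_def atLeast0LessThan)
  have 1: "(B ^\<^sub>m Suc k) $$ (i, j) = 0" if "j < i" "i < n" for i j
  proof -
    have "(B ^\<^sub>m k) $$ (i, u) * B $$ (u, j) = 0" if "u < n" for u
      using lowB[of j u] lowC[of u i] \<open>j < i\<close> \<open>i < n\<close> that by (cases "u < i") auto
    then show ?thesis using that by (simp only: entry) (simp add: sum.neutral)
  qed
  have 2: "(B ^\<^sub>m Suc k) $$ (i, i) = (B $$ (i, i)) ^ Suc k" if i: "i < n" for i
  proof -
    have "(B ^\<^sub>m k) $$ (i, u) * B $$ (u, i) = (if u = i then (B $$ (i, i)) ^ Suc k else 0)" if "u < n" for u
      using lowB[of i u] lowC[of u i] i that Suc by (cases u i rule: linorder_cases) auto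
    then have "(\<Sum>u<n. (B ^\<^sub>m k) $$ (i, u) * B $$ (u, i)) = (\<Sum>u<n. if u = i then (B $$ (i, i)) ^ Suc k else 0)"
      by (intro sum.cong) auto
    then show ?thesis using i by (simp only: entry) simp
  qed
  have "B ^\<^sub>m Suc k \<in> carrier_mat n n" using B by (intro pow_carrier_mat)
  then have "upper_triangular (B ^\<^sub>m Suc k)"
    unfolding upper_triangular_def using 1 by auto
  with 2 show ?case by blast
qed

text \<open>For an eigenvector v the number v* A v equals \<mu> |v|^2 and is its own
  conjugate.\<close>

lemma hermitian_eigenvalue_real:
  assumes A: "A \<in> carrier_mat n n" and herm: "\<And>i j. i < n \<Longrightarrow> j < n \<Longrightarrow> A $$ (j, i) = cnj (A $$ (i, j))"
    and \<mu>: "\<mu> \<in> spectrum A"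
  shows "\<mu> = of_real (Re \<mu>)"
proof -
  from \<mu> obtain v where v: "v \<in> carrier_vec n" "v \<noteq> 0\<^sub>v n" "A *\<^sub>v v = \<mu> \<cdot>\<^sub>v v"
    using A unfolding spectrum_def eigenvalue_def eigenvector_def by auto
  have Av: "(\<Sum>j<n. A $$ (i, j) * v $ j) = \<mu> * v $ i" if "i < n" for i
    using arg_cong[OF v(3), of "\<lambda>w. w $ i"] that A v(1)
    by (simp add: scalar_prod_def atLeast0LessThan)
  define N where "N = (\<Sum>i<n. (cmod (v $ i))\<^sup>2)"
  have N: "complex_of_real N = (\<Sum>i<n. cnj (v $ i) * v $ i)"
    unfolding N_def of_real_sum by (intro sum.cong refl) (metis complex_norm_square mult.commute of_real_power)
  define S where "S = (\<Sum>i<n. \<Sum>j<n. cnj (v $ i) * A $$ (i, j) * v $ j)"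
  have "S = (\<Sum>i<n. cnj (v $ i) * (\<Sum>j<n. A $$ (i, j) * v $ j))"
    by (simp add: S_def sum_distrib_left mult.assoc)
  also have "\<dots> = (\<Sum>i<n. cnj (v $ i) * (\<mu> * v $ i))" using Av by simp
  also have "\<dots> = \<mu> * N" unfolding N sum_distrib_left by (intro sum.cong refl) simp
  finally have S: "S = \<mu> * N" .
  have "S = (\<Sum>j<n. \<Sum>i<n. cnj (v $ i) * A $$ (i, j) * v $ j)" unfolding S_def by (rule sum.swap)
  also have "\<dots> = (\<Sum>j<n. \<Sum>i<n. cnj (cnj (v $ j) * A $$ (j, i) * v $ i))"
  proof (intro sum.cong refl)
    fix i j assume "i \<in> {..<n}" "j \<in> {..<n}"
    then have "cnj (A $$ (j, i)) = A $$ (i, j)" using herm[of i j] by simp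
    then show "cnj (v $ i) * A $$ (i, j) * v $ j = cnj (cnj (v $ j) * A $$ (j, i) * v $ i)" by simp
  qed
  also have "\<dots> = cnj S" by (simp add: S_def cnj_sum)
  finally have "S = cnj S" .
  then have "\<mu> * N = cnj \<mu> * N" unfolding S complex_cnj_mult complex_cnj_complex_of_real .
  moreover have "N > 0"
  proof -
    have "\<exists>i<n. v $ i \<noteq> 0"
    proof (rule ccontr)
      assume "\<not> (\<exists>i<n. v $ i \<noteq> 0)"
      then have "v = 0\<^sub>v n" using v(1) by (intro eq_vecI) auto
      with v(2) show False by simp
    qed
    then obtain i where "i < n" "v $ i \<noteq> 0" by blast
    then show ?thesis unfolding N_def by (intro sum_pos2[of _ i]) auto
  qed
  ultimately have "cnj \<mu> = \<mu>" by (metis less_irrefl mult_right_cancel of_real_eq_0_iff)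
  then show ?thesis by (auto simp: complex_eq_iff)
qed

text \<open>The diagonal of a Schur triangular form lists the eigenvalues with multiplicity, which
  the set \<open>spectrum A\<close> forgets, and powers act entrywise on this diagonal.\<close>

lemma hermitian_power_traces:
  assumes A: "A \<in> carrier_mat n n" and herm: "\<And>i j. i < n \<Longrightarrow> j < n \<Longrightarrow> A $$ (j, i) = cnj (A $$ (i, j))"
  obtains ev :: "nat \<Rightarrow> real" where "Re ` spectrum A = ev ` {..<n}"
    "\<And>k. mat_trace (A ^\<^sub>m k) = of_real (\<Sum>i<n. ev i ^ k)"
proof -
  obtain es where es: "char_poly A = (\<Prod>a\<leftarrow>es. [:- a, 1:])"
    using char_poly_factorized[OF A] by blast
  obtain B where B: "B \<in> carrier_mat n n" "upper_triangular B" "similar_mat A B"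
    using schur_decomposition_exists[OF A es] by blast
  obtain P Q where PQ: "similar_mat_wit A B P Q" using B(3) by (auto simp: similar_mat_def)
  define ev where "ev i = Re (B $$ (i, i))" for i
  have spec: "spectrum A = (\<lambda>i. B $$ (i, i)) ` {..<n}"
  proof -
    have "char_poly A = (\<Prod>a\<leftarrow>diag_mat B. [:- a, 1:])"
      using char_poly_similar[OF B(3)] char_poly_upper_triangular[OF B(1,2)] by simp
    then have "spectrum A = set (diag_mat B)"
      unfolding spectrum_root_char_poly[OF A] by (auto simp: poly_prod_list prod_list_zero_iff)
    then show ?thesis using B(1) by (auto simp: diag_mat_def atLeast0LessThan)
  qed
  have real: "B $$ (i, i) = of_real (ev i)" if "i < n" for i
    unfolding ev_def using that spec by (intro hermitian_eigenvalue_real[OF A herm]) auto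
  show ?thesis
  proof (rule that[of ev])
    show "Re ` spectrum A = ev ` {..<n}" unfolding spec ev_def by (simp add: image_image)
    fix k
    have "mat_trace (A ^\<^sub>m k) = mat_trace (B ^\<^sub>m k)"
      using similar_mat_wit_pow[OF PQ, of k] pow_carrier_mat[OF A, of k] by (rule mat_trace_similar)
    also have "\<dots> = (\<Sum>i<n. (B $$ (i, i)) ^ k)"
      using upper_triangular_pow[OF B(1,2), of k] pow_carrier_mat[OF B(1), of k]
      by (auto simp: mat_trace_def)
    also have "\<dots> = of_real (\<Sum>i<n. ev i ^ k)" using real by simp
    finally show "mat_trace (A ^\<^sub>m k) = of_real (\<Sum>i<n. ev i ^ k)" .
  qed
qed

text \<open>Up to order n the semicircle moments are at least (n + 1)^-2 times those of the law with
  mass 1/2 at 2 and at -2. The latter, shifted by 3, has n-th moment (5^n + 1) / 2.\<close>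

lemma semicircle_shifted_moment_ge:
  "(\<Sum>j\<le>n. of_nat (n choose j) * 3 ^ (n - j) * bseq 0 0 j) \<ge> 5 ^ n / (2 * (real n + 1)\<^sup>2)"
proof -
  have "5 ^ n / (2 * (real n + 1)\<^sup>2) \<le> (5 ^ n + 1) / (2 * (real n + 1)\<^sup>2)"
    by (intro divide_right_mono) auto
  also have "(5 ^ n + 1) = (\<Sum>j\<le>n. of_nat (n choose j) * 2 ^ j * 3 ^ (n - j)) + (\<Sum>j\<le>n. of_nat (n choose j) * (-2) ^ j * (3::real) ^ (n - j))"
    using binomial_ring[of "2::real" 3 n] binomial_ring[of "-2::real" 3 n] by simp
  also have "\<dots> = (\<Sum>j\<le>n. of_nat (n choose j) * 3 ^ (n - j) * (2 ^ j + (-2) ^ j))"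
    unfolding sum.distrib[symmetric] by (intro sum.cong refl) (simp add: algebra_simps)
  also have "\<dots> / (2 * (real n + 1)\<^sup>2) = (\<Sum>j\<le>n. of_nat (n choose j) * 3 ^ (n - j) * ((2 ^ j + (-2) ^ j) / (2 * (real n + 1)\<^sup>2)))"
    by (simp only: sum_divide_distrib times_divide_eq_right)
  also have "\<dots> \<le> (\<Sum>j\<le>n. of_nat (n choose j) * 3 ^ (n - j) * bseq 0 0 j)"
  proof (intro sum_mono mult_left_mono)
    fix j assume j: "j \<in> {..n}"
    show "((2 ^ j + (-2) ^ j) / (2 * (real n + 1)\<^sup>2)) \<le> bseq 0 0 j"
    proof (cases "even j")
      case True
      then obtain k where k: "j = 2 * k" by blast
      have "(2 ^ j + (-2) ^ j) / (2 * (real n + 1)\<^sup>2) = 4 ^ k / (real n + 1)\<^sup>2"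
        by (simp add: k power_mult)
      also have "\<dots> \<le> 4 ^ k / (real k + 1)\<^sup>2" using j k by (intro divide_left_mono power_mono) auto
      also have "\<dots> \<le> bseq 0 0 j" using catalan_ge[of k] by (simp add: k bseq_semicircle_even)
      finally show ?thesis .
    next
      case False
      then obtain k where "j = 2 * k + 1" using oddE by blast
      then show ?thesis using bseq_semicircle_odd[of k] by simp
    qed
  qed auto
  finally show ?thesis .
qed

text \<open>The shift by 3 makes the spectrum positive, so that high moments see only its upper edge.\<close>

lemma Max_tendsto_semicircle_edge:
  fixes ev :: "nat \<Rightarrow> nat \<Rightarrow> real"
  assumes mom: "\<And>j. (\<lambda>d. (\<Sum>i<d. ev d i ^ j) / real d) \<longlonglongrightarrow> bseq 0 0 j"
    and bnd: "\<And>R. R > 2 \<Longrightarrow> \<forall>\<^sub>F d in sequentially. \<forall>i<d. \<bar>ev d i\<bar> < R"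
  shows "(\<lambda>d. Max (ev d ` {..<d})) \<longlonglongrightarrow> 2"
proof (rule order_tendstoI)
  fix a :: real assume "2 < a"
  from bnd[OF this] eventually_ge_at_top[of 1]
  show "\<forall>\<^sub>F d in sequentially. Max (ev d ` {..<d}) < a"
  proof eventually_elim
    case (elim d)
    then have "ev d ` {..<d} \<noteq> {}" by (auto simp: lessThan_empty_iff)
    with elim show ?case by (subst Max_less_iff) (auto simp: abs_less_iff)
  qed
next
  fix a :: real assume "a < 2"
  \<comment> \<open>The maximum with 0 keeps the base b + 3 positive for very negative a.\<close>
  define b where "b = max a 0"
  have b: "0 \<le> b" "b < 2" "a \<le> b" using \<open>a < 2\<close> by (auto simp: b_def)
  \<comment> \<open>The shifted semicircle moments grow like 5^n up to a polynomial factor, those of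
    a law below b at most like (b + 3)^n; c is the ratio of the rates.\<close>
  define c where "c = 5 / (b + 3)"
  have "c > 1" using b by (simp add: c_def)
  then have "\<forall>\<^sub>F n in sequentially. 2 * (real n + 1)\<^sup>2 < c ^ n" by real_asymp
  then obtain n where n: "2 * (real n + 1)\<^sup>2 < (5 / (b + 3)) ^ n"
    by (auto simp: eventually_at_top_linorder c_def)
  define A where "A = (\<Sum>j\<le>n. of_nat (n choose j) * 3 ^ (n - j) * bseq 0 0 j)"
  have "(b + 3) ^ n < 5 ^ n / (2 * (real n + 1)\<^sup>2)"
    using n b by (simp add: field_simps power_divide)
  also have "\<dots> \<le> A" unfolding A_def by (rule semicircle_shifted_moment_ge)
  finally have A: "(b + 3) ^ n < A" .
  have "(\<lambda>d. \<Sum>j\<le>n. of_nat (n choose j) * 3 ^ (n - j) * ((\<Sum>i<d. ev d i ^ j) / real d)) \<longlonglongrightarrow> A"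
    unfolding A_def by (intro tendsto_intros mom)
  then have "\<forall>\<^sub>F d in sequentially. (b + 3) ^ n < (\<Sum>j\<le>n. of_nat (n choose j) * 3 ^ (n - j) * ((\<Sum>i<d. ev d i ^ j) / real d))"
    using A by (rule order_tendstoD)
  \<comment> \<open>This makes every shifted eigenvalue positive, so that n-th powers are monotone
    in it.\<close>
  moreover have "\<forall>\<^sub>F d in sequentially. \<forall>i<d. \<bar>ev d i\<bar> < 3" by (rule bnd) simp
  ultimately show "\<forall>\<^sub>F d in sequentially. a < Max (ev d ` {..<d})"
    using eventually_ge_at_top[of 1]
  proof eventually_elim
    case (elim d)
    define m where "m = Max (ev d ` {..<d})"
    have le: "ev d i \<le> m" if "i < d" for i unfolding m_def using that by (intro Max_ge) auto
    have "(\<Sum>j\<le>n. of_nat (n choose j) * 3 ^ (n - j) * ((\<Sum>i<d. ev d i ^ j) / real d))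
       = (\<Sum>j\<le>n. \<Sum>i<d. of_nat (n choose j) * ev d i ^ j * 3 ^ (n - j)) / real d"
      by (simp add: sum_divide_distrib sum_distrib_left mult_ac)
    also have "(\<Sum>j\<le>n. \<Sum>i<d. of_nat (n choose j) * ev d i ^ j * 3 ^ (n - j)) =
       (\<Sum>i<d. \<Sum>j\<le>n. of_nat (n choose j) * ev d i ^ j * 3 ^ (n - j))" by (rule sum.swap)
    also have "\<dots> = (\<Sum>i<d. (ev d i + 3) ^ n)" by (simp only: binomial_ring)
    also have "\<dots> \<le> (\<Sum>i<d. (m + 3) ^ n)"
      using le elim by (intro sum_mono power_mono) (auto simp: abs_less_iff)
    also have "\<dots> / real d = (m + 3) ^ n" using elim by simp
    finally have "(b + 3) ^ n < (m + 3) ^ n" using elim(1) by (simp add: divide_right_mono)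
    moreover have "0 \<le> m + 3" using le[of 0] elim by (auto simp: abs_less_iff)
    ultimately have "b + 3 < m + 3" by (rule power_less_imp_less_base)
    then show ?case using b by (simp add: m_def)
  qed
qed

text \<open>Borel-Cantelli in the form used here: the expectation of the sum of the f n is finite,
  so almost surely the series converges and its terms tend to 0. The joint law of the f n does not
  enter.\<close>

lemma (in prob_space) AE_tendsto_zero_of_summable:
  fixes f :: "nat \<Rightarrow> 'a \<Rightarrow> real"
  assumes bound: "\<forall>\<^sub>F n in sequentially. integrable M (f n) \<and> (AE \<omega> in M. f n \<omega> \<ge> 0) \<and> expectation (f n) \<le> h n"
    and "summable h"
  shows "AE \<omega> in M. (\<lambda>n. f n \<omega>) \<longlonglongrightarrow> 0"
proof -
  obtain N where N: "\<And>n. n \<ge> N \<Longrightarrow> integrable M (f n)" "\<And>n. n \<ge> N \<Longrightarrow> AE \<omega> in M. f n \<omega> \<ge> 0"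
    "\<And>n. n \<ge> N \<Longrightarrow> expectation (f n) \<le> h n"
    using bound unfolding eventually_sequentially by blast
  define F where "F n = f (n + N)" for n
  have m: "(\<lambda>\<omega>. ennreal (F n \<omega>)) \<in> borel_measurable M" for n
    using N(1)[of "n + N"] by (auto simp: F_def)
  have h0: "0 \<le> h (n + N)" for n
    using N(2,3)[of "n + N"] integral_nonneg_AE[of "f (n + N)" M] by simp
  have "(\<integral>\<^sup>+\<omega>. (\<Sum>n. ennreal (F n \<omega>)) \<partial>M) = (\<Sum>n. \<integral>\<^sup>+\<omega>. ennreal (F n \<omega>) \<partial>M)"
    by (intro nn_integral_suminf m)
  also have "\<dots> \<le> (\<Sum>n. ennreal (h (n + N)))"
    using N by (intro suminf_le summableI) (auto simp: F_def nn_integral_eq_integral intro!: ennreal_leI)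
  also have "\<dots> = ennreal (\<Sum>n. h (n + N))"
    using h0 assms(2) by (intro suminf_ennreal2) (auto simp: summable_iff_shift)
  also have "\<dots> < \<infinity>" by simp
  finally have "AE \<omega> in M. (\<Sum>n. ennreal (F n \<omega>)) \<noteq> \<infinity>"
    using m by (intro nn_integral_noteq_infinite borel_measurable_suminf_order) auto
  moreover have "AE \<omega> in M. \<forall>n. 0 \<le> F n \<omega>" unfolding AE_all_countable F_def using N(2) by simp
  ultimately show ?thesis
  proof eventually_elim
    case (elim \<omega>)
    then have "summable (\<lambda>n. F n \<omega>)" by (intro summable_suminf_not_top) auto
    then have "(\<lambda>n. F n \<omega>) \<longlonglongrightarrow> 0" by (rule summable_LIMSEQ_zero)
    then show ?case unfolding F_def by (rule LIMSEQ_offset)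
  qed
qed

text \<open>Matrix powers of the library multiply on the right, \<open>mpow\<close> on the left;
  \<open>mpow_add\<close> with a last factor of order 1 reconciles the two.\<close>

lemma pow_mat_entry:
  assumes A: "A \<in> carrier_mat d d" and ab: "a < d" "b < d"
  shows "(A ^\<^sub>m n) $$ (a, b) = mpow d (\<lambda>x y. A $$ (x, y)) n a b"
  using ab(2)
proof (induction n arbitrary: b)
  case 0
  then show ?case using A ab by simp
next
  case (Suc n)
  have C: "A ^\<^sub>m n \<in> carrier_mat d d" using A by (rule pow_carrier_mat)
  have "(A ^\<^sub>m Suc n) $$ (a, b) = (\<Sum>u<d. (A ^\<^sub>m n) $$ (a, u) * A $$ (u, b))"
    using A C ab Suc.prems by (auto simp: scalar_prod_def atLeast0LessThan)
  also have "\<dots> = (\<Sum>u<d. mpow d (\<lambda>x y. A $$ (x, y)) n a u * mpow d (\<lambda>x y. A $$ (x, y)) (Suc 0) u b)"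
    using Suc by (intro sum.cong refl) (simp only: lessThan_iff mpow_1)
  also have "\<dots> = mpow d (\<lambda>x y. A $$ (x, y)) (n + Suc 0) a b"
    using ab(1) by (rule mpow_add[symmetric])
  finally show ?case by simp
qed

lemma mat_adjoint_entry:
  assumes "A \<in> carrier_mat n m" "i < n" "j < m"
  shows "mat_adjoint A $$ (j, i) = cnj (A $$ (i, j))"
  using assms by (simp add: mat_adjoint_def mat_of_rows_index)

section \<open>Identification of \<open>Z\<close> and \<open>tr\<close> with the matrix, its traces
  and its eigenvalues\<close>

context wishart_matrix
begin

abbreviation Z_mat :: "'a \<Rightarrow> complex mat" where
  "Z_mat \<omega> \<equiv> recentered_wishart d s (G \<omega> * mat_adjoint (G \<omega>))"

lemma G_carrier: "\<omega> \<in> space M \<Longrightarrow> G \<omega> \<in> carrier_mat d s"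
  using gaussian by (simp add: complex_gaussian_matrix_def)

lemma Z_mat_carrier: "\<omega> \<in> space M \<Longrightarrow> Z_mat \<omega> \<in> carrier_mat d d"
  using G_carrier[of \<omega>] by (auto simp: recentered_wishart_def)

lemma Z_mat_entry:
  assumes \<omega>: "\<omega> \<in> space M" and ab: "a < d" "b < d"
  shows "Z_mat \<omega> $$ (a, b) = Z \<omega> a b"
proof -
  note G = G_carrier[OF \<omega>]
  have adj: "mat_adjoint (G \<omega>) \<in> carrier_mat s d" using G by (auto simp: mat_adjoint_def)
  have W: "(G \<omega> * mat_adjoint (G \<omega>)) $$ (a, b) = (\<Sum>l<s. g (a, l) \<omega> * cnj (g (b, l) \<omega>))"
    using G adj ab by (auto simp: scalar_prod_def atLeast0LessThan g_def mat_adjoint_entry intro!: sum.cong)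
  define r where "r = complex_of_real (sqrt (real d * real s))"
  have "r * r = of_real (real d * real s)" by (simp add: r_def flip: of_real_mult)
  then have r: "r * r = of_nat d * of_nat s" "r \<noteq> 0"
    using d_pos s_pos by (simp, simp add: r_def)
  have "Z_mat \<omega> $$ (a, b) = r * (1 / (of_nat d * of_nat s) * (\<Sum>l<s. g (a, l) \<omega> * cnj (g (b, l) \<omega>))
      - 1 / of_nat d * (if a = b then 1 else 0))"
    using G adj ab W by (simp add: recentered_wishart_def r_def)
  also have "\<dots> = Z \<omega> a b"
  proof -
    have ds: "of_nat d \<noteq> (0 :: complex)" "of_nat s \<noteq> (0 :: complex)" using d_pos s_pos by auto
    have "r * (1 / (of_nat d * of_nat s) * S - 1 / of_nat d * t) = (S - of_nat s * t) / r" for S t :: complex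
    proof -
      have "r * (r * (1 / (of_nat d * of_nat s) * S - 1 / of_nat d * t)) = (r * r) * (1 / (of_nat d * of_nat s) * S - 1 / of_nat d * t)"
        by (simp only: mult.assoc)
      also have "\<dots> = S - of_nat s * t" unfolding r(1) using ds by (simp add: field_simps)
      finally show ?thesis using r(2) by (simp add: nonzero_eq_divide_eq mult.commute)
    qed
    then show ?thesis unfolding Z_def r_def[symmetric] by simp
  qed
  finally show ?thesis .
qed

lemma Z_hermitian: "Z \<omega> b a = cnj (Z \<omega> a b)"
  by (auto simp: Z_def mult.commute)

lemma mpow_cong:
  assumes "\<And>x y. x < d \<Longrightarrow> y < d \<Longrightarrow> A x y = B x y" "a < d"
  shows "mpow d A n a b = mpow d B n a b"
  using assms(2) by (induction n arbitrary: a) (auto simp: assms(1))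

lemma tr_eq:
  assumes \<omega>: "\<omega> \<in> space M"
  shows "tr n \<omega> = 1 / of_nat d * mat_trace (Z_mat \<omega> ^\<^sub>m n)"
proof -
  note Z = Z_mat_carrier[OF \<omega>]
  have "mat_trace (Z_mat \<omega> ^\<^sub>m n) = (\<Sum>x<d. mpow d (\<lambda>x y. Z_mat \<omega> $$ (x, y)) n x x)"
    using pow_carrier_mat[OF Z, of n] pow_mat_entry[OF Z] carrier_matD[OF Z] by (simp add: mat_trace_def)
  also have "\<dots> = (\<Sum>x<d. mpow d (Z \<omega>) n x x)"
    using Z_mat_entry[OF \<omega>] by (intro sum.cong refl mpow_cong) auto
  finally show ?thesis by (simp add: tr_def)
qed

text \<open>A choice, outcome by outcome, of a list with multiplicities. Only traces are integrated;
  the eigenvalues serve to interpret them pointwise.\<close>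

definition eigenvalues :: "'a \<Rightarrow> nat \<Rightarrow> real" where
  "eigenvalues \<omega> = (SOME ev. Re ` spectrum (Z_mat \<omega>) = ev ` {..<d} \<and>
     (\<forall>k. mat_trace (Z_mat \<omega> ^\<^sub>m k) = of_real (\<Sum>i<d. ev i ^ k)))"

lemma
  assumes \<omega>: "\<omega> \<in> space M"
  shows Re_spectrum_eq: "Re ` spectrum (Z_mat \<omega>) = eigenvalues \<omega> ` {..<d}"
    and tr_eigenvalues: "tr k \<omega> = of_real ((\<Sum>i<d. eigenvalues \<omega> i ^ k) / real d)"
proof -
  have "Z_mat \<omega> $$ (j, i) = cnj (Z_mat \<omega> $$ (i, j))" if "i < d" "j < d" for i j
    using Z_mat_entry[OF \<omega>] that Z_hermitian[of \<omega> j i] by simp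
  then obtain ev where "Re ` spectrum (Z_mat \<omega>) = ev ` {..<d}"
    "\<And>k. mat_trace (Z_mat \<omega> ^\<^sub>m k) = of_real (\<Sum>i<d. ev i ^ k)"
    using hermitian_power_traces[OF Z_mat_carrier[OF \<omega>]] by metis
  then have "\<exists>ev. Re ` spectrum (Z_mat \<omega>) = ev ` {..<d} \<and>
     (\<forall>k. mat_trace (Z_mat \<omega> ^\<^sub>m k) = of_real (\<Sum>i<d. ev i ^ k))" by blast
  from someI_ex[OF this] show "Re ` spectrum (Z_mat \<omega>) = eigenvalues \<omega> ` {..<d}"
    "tr k \<omega> = of_real ((\<Sum>i<d. eigenvalues \<omega> i ^ k) / real d)"
    unfolding eigenvalues_def[symmetric] by (auto simp: tr_eq[OF \<omega>])
qed

lemma tr_real: "\<omega> \<in> space M \<Longrightarrow> tr k \<omega> = of_real (Re (tr k \<omega>))"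
  by (simp add: tr_eigenvalues)

lemma tr_nonneg: "\<omega> \<in> space M \<Longrightarrow> even k \<Longrightarrow> Re (tr k \<omega>) \<ge> 0"
  by (auto simp: tr_eigenvalues intro!: sum_nonneg zero_le_even_power divide_nonneg_nonneg)

lemma integrable_tr: "integrable M (tr k)"
  using integrable_prod_tr[of "[k]"] by simp

lemma expectation_Re_tr: "expectation (\<lambda>\<omega>. Re (tr k \<omega>)) = Re (tr_moment [k])"
  using integral_Re[OF integrable_tr[of k]] by (simp add: tr_moment_def)

text \<open>The right side is grouped so that, for c the limiting moment, both differences are of
  order d^-2 by \<open>loop_equations_approx\<close>.\<close>

lemma integrable_tr_square: "integrable M (\<lambda>\<omega>. (Re (tr k \<omega>) - c)\<^sup>2)"
  and expectation_tr_square: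
    "complex_of_real (expectation (\<lambda>\<omega>. (Re (tr k \<omega>) - c)\<^sup>2)) =
      (tr_moment [k, k] - of_real (c * c)) - 2 * of_real c * (tr_moment [k] - of_real c)"
proof -
  have i2: "integrable M (\<lambda>\<omega>. tr k \<omega> * tr k \<omega>)"
    using integrable_prod_tr[of "[k, k]"] by simp
  have e: "complex_of_real ((Re (tr k \<omega>) - c)\<^sup>2) = tr k \<omega> * tr k \<omega> - 2 * of_real c * tr k \<omega> + of_real (c * c)"
    if "\<omega> \<in> space M" for \<omega>
  proof -
    define x where "x = Re (tr k \<omega>)"
    have "tr k \<omega> = of_real x" using tr_real[OF that] by (simp add: x_def)
    then show ?thesis by (simp add: power2_eq_square algebra_simps)
  qed
  have i: "integrable M (\<lambda>\<omega>. tr k \<omega> * tr k \<omega> - 2 * of_real c * tr k \<omega> + of_real (c * c))"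
    by (intro Bochner_Integration.integrable_add Bochner_Integration.integrable_diff i2 integrable_mult_right integrable_tr) simp
  then have ii: "integrable M (\<lambda>\<omega>. complex_of_real ((Re (tr k \<omega>) - c)\<^sup>2))"
    using e by (subst Bochner_Integration.integrable_cong[OF refl]) auto
  have "(\<lambda>\<omega>. (Re (tr k \<omega>) - c)\<^sup>2) = (\<lambda>\<omega>. Re (complex_of_real ((Re (tr k \<omega>) - c)\<^sup>2)))" by simp
  then show "integrable M (\<lambda>\<omega>. (Re (tr k \<omega>) - c)\<^sup>2)" using integrable_Re[OF ii] by simp
  have "complex_of_real (expectation (\<lambda>\<omega>. (Re (tr k \<omega>) - c)\<^sup>2)) =
     expectation (\<lambda>\<omega>. complex_of_real ((Re (tr k \<omega>) - c)\<^sup>2))" by (rule integral_complex_of_real[symmetric])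
  also have "\<dots> = expectation (\<lambda>\<omega>. tr k \<omega> * tr k \<omega> - 2 * of_real c * tr k \<omega> + of_real (c * c))"
    using e by (intro Bochner_Integration.integral_cong) auto
  also have "\<dots> = expectation (\<lambda>\<omega>. tr k \<omega> * tr k \<omega> - 2 * of_real c * tr k \<omega>) + of_real (c * c)"
    using i2 integrable_tr by (subst Bochner_Integration.integral_add) (auto simp: prob_space)
  also have "expectation (\<lambda>\<omega>. tr k \<omega> * tr k \<omega> - 2 * of_real c * tr k \<omega>) = tr_moment [k, k] - 2 * of_real c * tr_moment [k]"
    using i2 integrable_tr by (subst Bochner_Integration.integral_diff) (auto simp: tr_moment_def)
  finally show "complex_of_real (expectation (\<lambda>\<omega>. (Re (tr k \<omega>) - c)\<^sup>2)) =
      (tr_moment [k, k] - of_real (c * c)) - 2 * of_real c * (tr_moment [k] - of_real c)"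
    by (simp add: algebra_simps)
qed

end

lemma complex_wishart_matrix:
  assumes "prob_space M" "complex_wishart M d s W" "d \<ge> 1" "s \<ge> 1"
  shows "\<exists>G. wishart_matrix M d s G \<and> (\<forall>\<omega>\<in>space M. W \<omega> = G \<omega> * mat_adjoint (G \<omega>))"
proof -
  from assms(2) obtain G where G: "complex_gaussian_matrix M d s G"
    "\<forall>\<omega>\<in>space M. W \<omega> = G \<omega> * mat_adjoint (G \<omega>)"
    unfolding complex_wishart_def by (elim exE conjE)
  have "wishart_matrix M d s G"
    by (intro wishart_matrix.intro gaussian_matrix.intro gaussian_matrix_axioms.intro
        wishart_matrix_axioms.intro assms G(1))
  with G(2) show ?thesis by (intro exI[of _ G] conjI)
qed

section \<open>Convergence of the extreme eigenvalues\<close>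

theorem extreme_eigenvalues_tendsto:
  fixes W :: "nat \<Rightarrow> 'a \<Rightarrow> complex mat" and s :: "nat \<Rightarrow> nat"
  assumes M: "prob_space M"
    and W: "\<And>d. d \<ge> 1 \<Longrightarrow> s d \<ge> 1 \<and> complex_wishart M d (s d) (W d)"
    and lim: "filterlim (\<lambda>d. real (s d) / real d) at_top sequentially"
  shows "AE \<omega> in M. (\<lambda>d. largest_eigenvalue (recentered_wishart d (s d) (W d \<omega>))) \<longlonglongrightarrow> 2 \<and>
      (\<lambda>d. smallest_eigenvalue (recentered_wishart d (s d) (W d \<omega>))) \<longlonglongrightarrow> - 2"
proof -
  interpret prob_space M by fact
  have "\<forall>d\<in>{1..}. \<exists>G. wishart_matrix M d (s d) G \<and> (\<forall>\<omega>\<in>space M. W d \<omega> = G \<omega> * mat_adjoint (G \<omega>))"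
    using W by (intro ballI complex_wishart_matrix[OF M]) auto
  from bchoice[OF this] obtain G where
    GW: "\<forall>d\<in>{1..}. wishart_matrix M d (s d) (G d) \<and> (\<forall>\<omega>\<in>space M. W d \<omega> = G d \<omega> * mat_adjoint (G d \<omega>))" ..
  have G: "wishart_matrix M d (s d) (G d)"
    and WG: "\<forall>\<omega>\<in>space M. W d \<omega> = G d \<omega> * mat_adjoint (G d \<omega>)" if "d \<ge> 1" for d
    using GW that by auto
  define \<kappa> where "\<kappa> d = wishart_matrix.\<kappa> d (s d)" for d
  define T where "T d = wishart_matrix.tr_moment M d (s d) (G d)" for d
  define t where "t k d \<omega> = Re (wishart_matrix.tr d (s d) (G d) k \<omega>)" for k d \<omega>
  define ev where "ev d \<omega> = wishart_matrix.eigenvalues d (s d) (G d) \<omega>" for d \<omega>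
  have \<kappa>0: "\<kappa> d > 0" if "d \<ge> 1" for d
    using wishart_matrix.\<kappa>_pos[OF G[OF that]] by (simp add: \<kappa>_def)
  have loop: "loop_equations (\<kappa> d) (real d) (T d)" if "d \<ge> 1" for d
    using wishart_matrix.tr_moment_loop_equations[OF G[OF that]] by (simp add: \<kappa>_def T_def)
  have \<kappa>lim: "\<kappa> \<longlonglongrightarrow> 0"
  proof -
    have "(\<lambda>d. sqrt (inverse (real (s d) / real d))) \<longlonglongrightarrow> sqrt 0"
      by (intro tendsto_real_sqrt tendsto_inverse_0_at_top lim)
    moreover have "\<forall>\<^sub>F d in sequentially. sqrt (inverse (real (s d) / real d)) = \<kappa> d"
      using eventually_ge_at_top[of 1]
      by eventually_elim (simp add: \<kappa>_def wishart_matrix.\<kappa>_def[OF G])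
    ultimately show ?thesis by (simp add: tendsto_cong)
  qed
  have t_ev: "t k d \<omega> = (\<Sum>i<d. ev d \<omega> i ^ k) / real d" if "d \<ge> 1" "\<omega> \<in> space M" for k d \<omega>
    using wishart_matrix.tr_eigenvalues[OF G[OF that(1)] that(2)] by (simp add: t_def ev_def)
  have moments: "AE \<omega> in M. (\<lambda>d. t k d \<omega>) \<longlonglongrightarrow> bseq 0 0 k" for k
  proof -
    obtain C1 where C1: "\<And>\<kappa> D T. loop_equations \<kappa> D T \<Longrightarrow> 0 \<le> \<kappa> \<Longrightarrow> \<kappa> \<le> 1 \<Longrightarrow> D \<ge> 1 \<Longrightarrow>
       cmod (T [k] - of_real (bseq 0 \<kappa> k)) \<le> C1 / D\<^sup>2"
      using loop_equations_approx[of "[k]"] by auto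
    obtain C2 where C2: "\<And>\<kappa> D T. loop_equations \<kappa> D T \<Longrightarrow> 0 \<le> \<kappa> \<Longrightarrow> \<kappa> \<le> 1 \<Longrightarrow> D \<ge> 1 \<Longrightarrow>
       cmod (T [k, k] - of_real (bseq 0 \<kappa> k * bseq 0 \<kappa> k)) \<le> C2 / D\<^sup>2"
      using loop_equations_approx[of "[k, k]"] by auto
    define C where "C = C2 + 2 * bseq 0 1 k * C1"
    let ?q = "\<lambda>d \<omega>. (t k d \<omega> - bseq 0 (\<kappa> d) k)\<^sup>2"
    \<comment> \<open>The deviation is measured from \<open>bseq 0 (\<kappa> d) k\<close>, not from
      the semicircle moment: \<kappa> may tend to 0 arbitrarily slowly, and only for this centre is
      the error of the summable order d^-2. The deterministic limit in \<kappa> is taken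
      afterwards.\<close>
    have sq: "AE \<omega> in M. (\<lambda>d. ?q d \<omega>) \<longlonglongrightarrow> 0"
    proof (rule AE_tendsto_zero_of_summable)
      show "summable (\<lambda>d. C * (1 / real d ^ 2))"
        using inverse_power_summable[of 2, where ?'a = real]
        by (intro summable_mult) (simp add: divide_inverse)
      have "\<forall>\<^sub>F d in sequentially. \<kappa> d < 1" using \<kappa>lim by (rule order_tendstoD) simp
      with eventually_ge_at_top[of 1]
      show "\<forall>\<^sub>F d in sequentially. integrable M (\<lambda>\<omega>. ?q d \<omega>) \<and>
        (AE \<omega> in M. 0 \<le> ?q d \<omega>) \<and>
        expectation (\<lambda>\<omega>. ?q d \<omega>) \<le> C * (1 / real d ^ 2)"
      proof eventually_elim
        case (elim d)
        interpret w: wishart_matrix M d "s d" "G d" using elim by (intro G)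
        let ?b = "bseq 0 (\<kappa> d) k"
        have b: "0 \<le> ?b" "?b \<le> bseq 0 1 k"
          using \<kappa>0[of d] elim by (auto intro!: bseq_nonneg bseq_mono)
        note l = loop[OF elim(1)]
        have c1: "cmod (T d [k] - of_real ?b) \<le> C1 / (real d)\<^sup>2"
          using l \<kappa>0[of d] elim by (intro C1) auto
        have c2: "cmod (T d [k, k] - of_real (?b * ?b)) \<le> C2 / (real d)\<^sup>2"
          using l \<kappa>0[of d] elim by (intro C2) auto
        have "expectation (\<lambda>\<omega>. (t k d \<omega> - ?b)\<^sup>2) \<le> cmod (complex_of_real (expectation (\<lambda>\<omega>. (t k d \<omega> - ?b)\<^sup>2)))"
          by simp
        also have "\<dots> = cmod ((T d [k, k] - of_real (?b * ?b)) - 2 * of_real ?b * (T d [k] - of_real ?b))"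
          using w.expectation_tr_square[of k ?b] by (simp only: t_def T_def)
        also have "\<dots> \<le> cmod (T d [k, k] - of_real (?b * ?b)) + cmod (2 * of_real ?b * (T d [k] - of_real ?b))"
          by (rule norm_triangle_ineq4)
        also have "\<dots> \<le> C2 / (real d)\<^sup>2 + 2 * bseq 0 1 k * (C1 / (real d)\<^sup>2)"
          unfolding norm_mult using b c1 c2 by (intro add_mono mult_mono) auto
        also have "\<dots> = C * (1 / real d ^ 2)" by (simp add: C_def add_divide_distrib)
        finally show ?case using w.integrable_tr_square[of k ?b] by (simp add: t_def)
      qed
    qed
    have blim: "(\<lambda>d. bseq 0 (\<kappa> d) k) \<longlonglongrightarrow> bseq 0 0 k"
    proof -
      have "isCont (\<lambda>\<kappa>. bseq 0 \<kappa> k) 0" unfolding isCont_def by (rule tendsto_bseq_semicircle)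
      then show ?thesis using \<kappa>lim by (rule isCont_tendsto_compose)
    qed
    from sq show ?thesis
    proof eventually_elim
      case (elim \<omega>)
      have "(\<lambda>d. \<bar>t k d \<omega> - bseq 0 (\<kappa> d) k\<bar>) \<longlonglongrightarrow> 0"
        using tendsto_real_sqrt[OF elim] by simp
      then have "(\<lambda>d. t k d \<omega> - bseq 0 (\<kappa> d) k) \<longlonglongrightarrow> 0" by (rule tendsto_rabs_zero_cancel)
      from tendsto_add[OF this blim] show ?case by simp
    qed
  qed
  have edge: "AE \<omega> in M. \<forall>\<^sub>F d in sequentially. \<forall>i<d. \<bar>ev d \<omega> i\<bar> < R" if R: "R > 2" for R
  proof -
    from loop_equations_edge[OF R] obtain P where P: "\<forall>d. even (P d)"
      and *: "\<forall>\<kappa> T. (\<forall>d\<ge>1. 0 \<le> \<kappa> d \<and> loop_equations (\<kappa> d) (real d) (T d)) \<longrightarrow> \<kappa> \<longlonglongrightarrow> 0 \<longrightarrow>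
        (\<forall>\<^sub>F d in sequentially. real d * (cmod (T d [P d]) / R ^ P d) \<le> 2 / real d ^ 3)"
      by (elim exE conjE)
    have bound: "\<forall>\<^sub>F d in sequentially. real d * (cmod (T d [P d]) / R ^ P d) \<le> 2 / real d ^ 3"
      using \<kappa>0 loop \<kappa>lim by (intro *[rule_format]) (auto intro: less_imp_le)
    let ?f = "\<lambda>d \<omega>. real d * (t (P d) d \<omega> / R ^ P d)"
    \<comment> \<open>As P d is even, \<open>?f\<close> is the sum of the (|eigenvalue| / R)^P, so a
      value below 1 forces every eigenvalue into (-R, R).\<close>
    have "AE \<omega> in M. (\<lambda>d. ?f d \<omega>) \<longlonglongrightarrow> 0"
    proof (rule AE_tendsto_zero_of_summable)
      show "summable (\<lambda>d. 2 / real d ^ 3)"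
        using summable_mult[OF inverse_power_summable[of 3, where ?'a = real], of 2] by (simp add: divide_inverse)
      from bound eventually_ge_at_top[of 1]
      show "\<forall>\<^sub>F d in sequentially. integrable M (\<lambda>\<omega>. ?f d \<omega>) \<and>
        (AE \<omega> in M. 0 \<le> ?f d \<omega>) \<and>
        expectation (\<lambda>\<omega>. ?f d \<omega>) \<le> 2 / real d ^ 3"
      proof eventually_elim
        case (elim d)
        interpret w: wishart_matrix M d "s d" "G d" using elim by (intro G)
        have "integrable M (\<lambda>\<omega>. t (P d) d \<omega>)"
          unfolding t_def by (intro integrable_Re w.integrable_tr)
        moreover have "AE \<omega> in M. 0 \<le> t (P d) d \<omega>"
          using w.tr_nonneg P by (intro AE_I2) (simp add: t_def)
        moreover have "expectation (\<lambda>\<omega>. ?f d \<omega>) \<le> 2 / real d ^ 3"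
        proof -
          have "expectation (\<lambda>\<omega>. ?f d \<omega>) = real d * (Re (T d [P d]) / R ^ P d)"
            using w.expectation_Re_tr by (simp add: t_def T_def)
          also have "\<dots> \<le> real d * (cmod (T d [P d]) / R ^ P d)"
            using R by (intro mult_left_mono divide_right_mono complex_Re_le_cmod) auto
          finally show ?thesis using elim by simp
        qed
        ultimately show ?case using R by auto
      qed
    qed
    then show ?thesis using AE_space
    proof eventually_elim
      case (elim \<omega>)
      then have "\<forall>\<^sub>F d in sequentially. ?f d \<omega> < 1"
        by (intro order_tendstoD(2)) auto
      with eventually_ge_at_top[of 1] show ?case
      proof eventually_elim
        case (elim d)
        show ?case
        proof (intro allI impI)
          fix i assume i: "i < d"
          have "\<bar>ev d \<omega> i\<bar> ^ P d = ev d \<omega> i ^ P d" using P by (simp add: power_even_abs)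
          also have "\<dots> \<le> (\<Sum>i<d. ev d \<omega> i ^ P d)"
            using i P by (intro member_le_sum) (auto intro: zero_le_even_power)
          also have "\<dots> = real d * t (P d) d \<omega>" using t_ev[of d \<omega> "P d"] elim \<open>\<omega> \<in> space M\<close> by simp
          also have "\<dots> < R ^ P d" using elim R by (simp add: divide_less_eq)
          finally have "\<bar>ev d \<omega> i\<bar> ^ P d < R ^ P d" .
          then show "\<bar>ev d \<omega> i\<bar> < R" by (rule power_less_imp_less_base) (use R in simp)
        qed
      qed
    qed
  qed
  \<comment> \<open>A countable family of radii decreasing to 2, so that one null set serves all R >
    2.\<close>
  have "AE \<omega> in M. \<forall>n::nat. \<forall>\<^sub>F d in sequentially. \<forall>i<d. \<bar>ev d \<omega> i\<bar> < 2 + 1 / real (Suc n)"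
    unfolding AE_all_countable by (intro allI edge) (simp del: of_nat_Suc)
  moreover have "AE \<omega> in M. \<forall>k. (\<lambda>d. t k d \<omega>) \<longlonglongrightarrow> bseq 0 0 k"
    unfolding AE_all_countable by (intro allI moments)
  ultimately show ?thesis using AE_space
  proof eventually_elim
    case (elim \<omega>)
    have bnd: "\<forall>\<^sub>F d in sequentially. \<forall>i<d. \<bar>ev d \<omega> i\<bar> < R" if "R > 2" for R
    proof -
      have "0 < R - 2" using that by simp
      then obtain n where n: "1 / real (Suc n) < R - 2" by (rule nat_approx_posE)
      from elim(1) have "\<forall>\<^sub>F d in sequentially. \<forall>i<d. \<bar>ev d \<omega> i\<bar> < 2 + 1 / real (Suc n)" by blast
      then show ?thesis
      proof eventually_elim
        case (elim d)
        show ?case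
        proof (intro allI impI)
          fix i assume "i < d"
          with elim have "\<bar>ev d \<omega> i\<bar> < 2 + 1 / real (Suc n)" by blast
          with n show "\<bar>ev d \<omega> i\<bar> < R" by linarith
        qed
      qed
    qed
    have mom: "(\<lambda>d. (\<Sum>i<d. ev d \<omega> i ^ j) / real d) \<longlonglongrightarrow> bseq 0 0 j" for j
    proof -
      have "(\<lambda>d. t j d \<omega>) \<longlonglongrightarrow> bseq 0 0 j" using elim by blast
      moreover have "\<forall>\<^sub>F d in sequentially. t j d \<omega> = (\<Sum>i<d. ev d \<omega> i ^ j) / real d"
        using eventually_ge_at_top[of 1] by eventually_elim (use t_ev elim in auto)
      ultimately show ?thesis by (simp add: tendsto_cong)
    qed
    \<comment> \<open>The semicircle law is symmetric, so -Z has the same limiting moments and the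
      lower edge follows from the upper one.\<close>
    have mom': "(\<lambda>d. (\<Sum>i<d. (- ev d \<omega> i) ^ j) / real d) \<longlonglongrightarrow> bseq 0 0 j" for j
    proof (cases "even j")
      case True
      then show ?thesis using mom[of j] by simp
    next
      case False
      then obtain k where "j = 2 * k + 1" using oddE by blast
      then have "bseq 0 0 j = 0" using bseq_semicircle_odd by simp
      then show ?thesis using tendsto_minus[OF mom[of j]] False by (simp add: sum_negf)
    qed
    define Z where "Z d = recentered_wishart d (s d) (W d \<omega>)" for d
    have spec: "Re ` spectrum (Z d) = ev d \<omega> ` {..<d}" if "d \<ge> 1" for d
      using wishart_matrix.Re_spectrum_eq[OF G[OF that] \<open>\<omega> \<in> space M\<close>] WG[OF that] \<open>\<omega> \<in> space M\<close>
      by (simp add: ev_def Z_def)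
    have "(\<lambda>d. Max (ev d \<omega> ` {..<d})) \<longlonglongrightarrow> 2" using mom bnd by (rule Max_tendsto_semicircle_edge)
    moreover have "\<forall>\<^sub>F d in sequentially. Max (ev d \<omega> ` {..<d}) = largest_eigenvalue (Z d)"
      using eventually_ge_at_top[of 1] by eventually_elim (simp add: largest_eigenvalue_def spec)
    ultimately have 1: "(\<lambda>d. largest_eigenvalue (Z d)) \<longlonglongrightarrow> 2"
      by (simp add: tendsto_cong)
    have "(\<lambda>d. Max ((\<lambda>i. - ev d \<omega> i) ` {..<d})) \<longlonglongrightarrow> 2"
      using mom' by (rule Max_tendsto_semicircle_edge) (use bnd in auto)
    then have "(\<lambda>d. - Max ((\<lambda>i. - ev d \<omega> i) ` {..<d})) \<longlonglongrightarrow> - 2" by (rule tendsto_minus)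
    moreover have "\<forall>\<^sub>F d in sequentially. - Max ((\<lambda>i. - ev d \<omega> i) ` {..<d}) = smallest_eigenvalue (Z d)"
      using eventually_ge_at_top[of 1]
    proof eventually_elim
      case (elim d)
      have "- Max ((\<lambda>i. - ev d \<omega> i) ` {..<d}) = Min (uminus ` (\<lambda>i. - ev d \<omega> i) ` {..<d})"
        using elim by (intro minus_Max_eq_Min) (auto simp: lessThan_empty_iff)
      then show ?case using elim by (simp add: smallest_eigenvalue_def spec image_image)
    qed
    ultimately have 2: "(\<lambda>d. smallest_eigenvalue (Z d)) \<longlonglongrightarrow> - 2"
      by (simp add: tendsto_cong)
    from 1 2 show ?case by (simp add: Z_def)
  qed
qed

section \<open>Counting colourings invariant under a permutation\<close>

text \<open>Colourings that are constant on the cycles of \<alpha>. There are s^#\<alpha> of them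
  when \<alpha> permutes the finite set K, so this cardinality encodes the number of cycles, and it
  is also what sums over matrix indices produce.\<close>

definition colourings :: "nat set \<Rightarrow> (nat \<Rightarrow> nat) \<Rightarrow> nat \<Rightarrow> (nat \<Rightarrow> nat) set" where
  "colourings K \<alpha> s = {l \<in> PiE K (\<lambda>_. {..<s}). \<forall>k\<in>K. l (\<alpha> k) = l k}"

lemma finite_colourings: "finite K \<Longrightarrow> finite (colourings K \<alpha> s)"
  unfolding colourings_def by (intro finite_subset[OF _ finite_PiE[of K "\<lambda>_. {..<s}"]]) auto

lemma card_colourings_id:
  assumes "finite K"
  shows "card (colourings K id s) = s ^ card K"
proof -
  have "colourings K id s = PiE K (\<lambda>_. {..<s})" by (auto simp: colourings_def)
  then show ?thesis using assms by (simp add: card_PiE)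
qed

text \<open>The composed permutation fixes x and otherwise follows \<alpha> with x skipped in its
  cycle. As \<alpha> x = y, the colour of x is dictated by that of y, so restriction loses
  nothing.\<close>

lemma card_colourings_transpose:
  assumes \<alpha>: "\<alpha> permutes K" and x: "x \<in> K" and y: "\<alpha> x = y" "y \<noteq> x"
  shows "card (colourings K \<alpha> s) = card (colourings (K - {x}) (Transposition.transpose x y \<circ> \<alpha>) s)"
proof -
  let ?\<beta> = "Transposition.transpose x y \<circ> \<alpha>"
  have yK: "y \<in> K" using \<alpha> x y by (metis permutes_in_image)
  have \<alpha>x: "\<alpha> k = y \<longleftrightarrow> k = x" for k using y(1) permutes_inj[OF \<alpha>] by (auto dest: injD)
  have "bij_betw (\<lambda>l. restrict l (K - {x})) (colourings K \<alpha> s) (colourings (K - {x}) ?\<beta> s)"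
  proof (rule bij_betw_byWitness[where f' = "\<lambda>l. l(x := l y)"])
    show "\<forall>l\<in>colourings K \<alpha> s. (restrict l (K - {x}))(x := restrict l (K - {x}) y) = l"
    proof
      fix l assume l: "l \<in> colourings K \<alpha> s"
      then have "l y = l x" using x y by (auto simp: colourings_def)
      with l y yK x show "(restrict l (K - {x}))(x := restrict l (K - {x}) y) = l"
        by (auto simp: colourings_def fun_eq_iff restrict_def PiE_def extensional_def)
    qed
    show "\<forall>l\<in>colourings (K - {x}) ?\<beta> s. restrict (l(x := l y)) (K - {x}) = l"
      by (auto simp: colourings_def fun_eq_iff restrict_def PiE_def extensional_def)
    show "(\<lambda>l. restrict l (K - {x})) ` colourings K \<alpha> s \<subseteq> colourings (K - {x}) ?\<beta> s"
    proof (rule image_subsetI)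
      fix l assume l: "l \<in> colourings K \<alpha> s"
      then have inv: "l (\<alpha> k) = l k" if "k \<in> K" for k using that by (auto simp: colourings_def)
      have "restrict l (K - {x}) (?\<beta> k) = restrict l (K - {x}) k" if k: "k \<in> K - {x}" for k
      proof -
        have \<alpha>k: "\<alpha> k \<in> K" using \<alpha> k by (simp add: permutes_in_image)
        have "\<alpha> k \<noteq> y" using \<alpha>x k by auto
        show ?thesis
        proof (cases "\<alpha> k = x")
          case True
          then show ?thesis using inv[of k] inv[of x] k x y yK by simp
        next
          case False
          then have "?\<beta> k = \<alpha> k" using \<open>\<alpha> k \<noteq> y\<close> by (simp add: transpose_apply_other)
          then show ?thesis using False \<alpha>k k inv[of k] by simp
        qed
      qed
      with l show "restrict l (K - {x}) \<in> colourings (K - {x}) ?\<beta> s"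
        by (auto simp: colourings_def)
    qed
    show "(\<lambda>l. l(x := l y)) ` colourings (K - {x}) ?\<beta> s \<subseteq> colourings K \<alpha> s"
    proof (rule image_subsetI)
      fix l assume l: "l \<in> colourings (K - {x}) ?\<beta> s"
      then have inv: "l (?\<beta> k) = l k" if "k \<in> K - {x}" for k using that by (auto simp: colourings_def)
      have "(l(x := l y)) (\<alpha> k) = (l(x := l y)) k" if k: "k \<in> K" for k
      proof (cases "k = x")
        case True
        then show ?thesis using y by simp
      next
        case False
        then have "\<alpha> k \<noteq> y" using \<alpha>x by auto
        then show ?thesis using inv[of k] k False by (cases "\<alpha> k = x") (auto simp: transpose_apply_other)
      qed
      moreover have "l(x := l y) \<in> PiE K (\<lambda>_. {..<s})"
      proof -
        have "l y \<in> {..<s}" using l y yK by (auto simp: colourings_def)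
        moreover have "l \<in> PiE (K - {x}) (\<lambda>_. {..<s})" using l by (simp add: colourings_def)
        ultimately have "l(x := l y) \<in> PiE (insert x (K - {x})) (\<lambda>_. {..<s})" by (intro PiE_fun_upd) auto
        then show ?thesis using x by (simp add: insert_absorb)
      qed
      ultimately show "l(x := l y) \<in> colourings K \<alpha> s" by (simp add: colourings_def)
    qed
  qed
  then show ?thesis by (rule bij_betw_same_card)
qed

text \<open>Removing a point that is not fixed costs one transposition and one free colour; removing
  a fixed point costs neither. The same m has to work for every larger K, since competing
  factorizations may use points outside L.\<close>

lemma ex_swapidseq_card_colourings:
  assumes "finite L" "\<alpha> permutes L"
  shows "\<exists>m. swapidseq m \<alpha> \<and> (\<forall>K s. finite K \<longrightarrow> L \<subseteq> K \<longrightarrow>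
    card (colourings K \<alpha> s) * s ^ m = s ^ card K)"
  using assms
proof (induction L arbitrary: \<alpha> rule: finite_induct)
  case empty
  then have "\<alpha> = id" by simp
  show ?case
  proof (intro exI[of _ 0] conjI allI impI)
    show "swapidseq 0 \<alpha>" using \<open>\<alpha> = id\<close> swapidseq.id by simp
    show "card (colourings K \<alpha> s) * s ^ 0 = s ^ card K" if "finite K" for K s
      using that \<open>\<alpha> = id\<close> by (simp add: card_colourings_id)
  qed
next
  case (insert x L)
  show ?case
  proof (cases "\<alpha> x = x")
    case True
    then have "\<alpha> permutes L" using insert.prems by (auto intro: permutes_superset)
    from insert.IH[OF this] show ?thesis by auto
  next
    case False
    define y where "y = \<alpha> x"
    let ?\<beta> = "Transposition.transpose x y \<circ> \<alpha>"
    have "?\<beta> permutes insert x L"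
      using permutes_in_image[OF insert.prems, of x]
      by (intro permutes_compose[OF insert.prems] permutes_swap_id) (auto simp: y_def)
    then have "?\<beta> permutes L" by (rule permutes_superset) (auto simp: y_def)
    from insert.IH[OF this] obtain m where m: "swapidseq m ?\<beta>"
      and card: "\<And>K s. finite K \<Longrightarrow> L \<subseteq> K \<Longrightarrow> card (colourings K ?\<beta> s) * s ^ m = s ^ card K" by blast
    have "Transposition.transpose x y \<circ> ?\<beta> = \<alpha>" by (simp add: fun_eq_iff)
    moreover have "swapidseq (Suc m) (Transposition.transpose x y \<circ> ?\<beta>)"
      using m False by (intro swapidseq.comp_Suc) (auto simp: y_def)
    ultimately have "swapidseq (Suc m) \<alpha>" by simp
    moreover have "card (colourings K \<alpha> s) * s ^ Suc m = s ^ card K"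
      if K: "finite K" "insert x L \<subseteq> K" for K s
    proof -
      have "\<alpha> permutes K" using insert.prems K by (auto intro: permutes_subset)
      then have "card (colourings K \<alpha> s) = card (colourings (K - {x}) ?\<beta> s)"
        using K False by (intro card_colourings_transpose) (auto simp: y_def)
      moreover have "card (colourings (K - {x}) ?\<beta> s) * s ^ m = s ^ card (K - {x})"
        using K insert.hyps by (intro card) auto
      moreover have "card K = Suc (card (K - {x}))" using K by (intro card_Suc_Diff1[symmetric]) auto
      ultimately show ?thesis by simp
    qed
    ultimately show ?thesis by blast
  qed
qed

text \<open>Two-colourings form a vector space over the field with two elements, and one more
  transposition imposes at most one further linear condition on it.\<close>

lemma card_colourings_le_double:
  assumes K: "finite K" "a \<in> K" "b \<in> K" and \<beta>: "\<beta> permutes K"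
  shows "card (colourings K \<beta> 2) \<le> 2 * card (colourings K (Transposition.transpose a b \<circ> \<beta>) 2)"
proof -
  let ?G = "colourings K \<beta> 2"
  define H where "H = {l \<in> ?G. l a = l b}"
  have fin: "finite ?G" "finite (colourings K (Transposition.transpose a b \<circ> \<beta>) 2)"
    using K by (auto intro: finite_colourings)
  have "card (?G - H) \<le> card H"
  proof (cases "?G - H = {}")
    case False
    then obtain l0 where l0: "l0 \<in> ?G" "l0 a \<noteq> l0 b" by (auto simp: H_def)
    have lt: "l k < 2" if "l \<in> ?G" "k \<in> K" for l k
      using that by (auto simp: colourings_def PiE_def Pi_def)
    \<comment> \<open>Translation by l0 modulo 2 flips whether a and b have equal colours, so it
      embeds the colourings outside H into H.\<close>
    define \<phi> where "\<phi> l = restrict (\<lambda>k. (l k + l0 k) mod 2) K" for l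
    show ?thesis
    proof (rule card_inj_on_le[of \<phi>])
      show "inj_on \<phi> (?G - H)"
      proof (rule inj_onI)
        fix l l' assume l: "l \<in> ?G - H" "l' \<in> ?G - H" "\<phi> l = \<phi> l'"
        have "l k = l' k" for k
        proof (cases "k \<in> K")
          case True
          have "(l k + l0 k) mod 2 = (l' k + l0 k) mod 2"
            using fun_cong[OF l(3), of k] True by (simp add: \<phi>_def)
          then show ?thesis using lt[of l k] lt[of l' k] l True by (auto simp: less_2_cases_iff) presburger+
        next
          case False
          then show ?thesis using l by (auto simp: colourings_def PiE_def extensional_def)
        qed
        then show "l = l'" by auto
      qed
      show "\<phi> ` (?G - H) \<subseteq> H"
      proof (rule image_subsetI)
        fix l assume l: "l \<in> ?G - H"
        have "\<phi> l \<in> ?G"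
          using l l0 \<beta> by (auto simp: \<phi>_def colourings_def permutes_in_image)
        moreover have "\<phi> l a = \<phi> l b"
        proof -
          have "l a \<noteq> l b" using l by (auto simp: H_def)
          then have "(l a + l0 a) mod 2 = (l b + l0 b) mod 2"
            using l0 lt[of l a] lt[of l b] lt[of l0 a] lt[of l0 b] l K by (auto simp: less_2_cases_iff)
          then show ?thesis using K by (simp add: \<phi>_def)
        qed
        ultimately show "\<phi> l \<in> H" by (simp add: H_def)
      qed
      show "finite H" using fin by (simp add: H_def)
    qed
  next
    case True
    then have "card (?G - H) = 0" by (simp only: card.empty)
    then show ?thesis by simp
  qed
  moreover have "card ?G = card (?G - H) + card H"
  proof -
    have "H \<subseteq> ?G" by (auto simp: H_def)
    then show ?thesis using fin card_mono[of ?G H] card_Diff_subset[of H ?G] finite_subset[of H ?G] by simp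
  qed
  moreover have "card H \<le> card (colourings K (Transposition.transpose a b \<circ> \<beta>) 2)"
  proof (rule card_mono[OF fin(2)])
    show "H \<subseteq> colourings K (Transposition.transpose a b \<circ> \<beta>) 2"
    proof
      fix l assume l: "l \<in> H"
      have "l (Transposition.transpose a b (\<beta> k)) = l k" if "k \<in> K" for k
      proof -
        have "l (\<beta> k) = l k" "l a = l b" using l that by (auto simp: H_def colourings_def)
        moreover have "Transposition.transpose a b (\<beta> k) = (if \<beta> k = a then b else if \<beta> k = b then a else \<beta> k)"
          by (simp add: Transposition.transpose_def)
        ultimately show ?thesis by presburger
      qed
      with l show "l \<in> colourings K (Transposition.transpose a b \<circ> \<beta>) 2"
        by (auto simp: H_def colourings_def)
    qed
  qed
  ultimately show ?thesis by linarith
qed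

text \<open>The identity has 2^|K| two-colourings and each transposition at most halves their
  number. K0 collects the points used by the transpositions.\<close>

lemma swapidseq_card_colourings:
  assumes "swapidseq n p"
  shows "\<exists>K0. finite K0 \<and> (\<forall>K. finite K \<longrightarrow> K0 \<subseteq> K \<longrightarrow> p permutes K \<and>
    2 ^ card K \<le> 2 ^ n * card (colourings K p 2))"
  using assms
proof induction
  case id
  show ?case
  proof (intro exI[of _ "{}"] conjI allI impI)
    show "2 ^ card K \<le> 2 ^ 0 * card (colourings K id 2)" if "finite K" for K
      using that by (simp only: card_colourings_id) simp
  qed (simp_all only: finite.emptyI permutes_id)
next
  case (comp_Suc n p a b)
  then obtain K0 where fin: "finite K0" and K0: "\<forall>K. finite K \<longrightarrow> K0 \<subseteq> K \<longrightarrow> p permutes K \<and>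
      2 ^ card K \<le> 2 ^ n * card (colourings K p 2)" by (elim exE conjE)
  have step: "Transposition.transpose a b \<circ> p permutes K"
      "2 ^ card K \<le> 2 ^ Suc n * card (colourings K (Transposition.transpose a b \<circ> p) 2)"
    if K: "finite K" "insert a (insert b K0) \<subseteq> K" for K
  proof -
    have p: "p permutes K" and le: "2 ^ card K \<le> 2 ^ n * card (colourings K p 2)"
      using K K0[rule_format, of K] by auto
    show "Transposition.transpose a b \<circ> p permutes K"
      using K by (intro permutes_compose[OF p] permutes_swap_id) auto
    have "2 ^ card K \<le> 2 ^ n * card (colourings K p 2)" by (rule le)
    also have "\<dots> \<le> 2 ^ n * (2 * card (colourings K (Transposition.transpose a b \<circ> p) 2))"
      using K p by (intro mult_left_mono card_colourings_le_double) auto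
    finally show "2 ^ card K \<le> 2 ^ Suc n * card (colourings K (Transposition.transpose a b \<circ> p) 2)" by simp
  qed
  show ?case
  proof (intro exI[of _ "insert a (insert b K0)"] conjI allI impI)
    show "finite (insert a (insert b K0))" using fin by simp
  qed (erule step, assumption)+
qed

text \<open>The explicit factorization of length m attains the lower bound that two-colourings put
  on the length of any factorization, so m is minimal.\<close>

theorem card_colourings:
  assumes "finite K" "\<alpha> permutes K"
  shows "card (colourings K \<alpha> s) * s ^ perm_length \<alpha> = s ^ card K"
proof -
  obtain m where m: "swapidseq m \<alpha>" "\<And>K' s. finite K' \<Longrightarrow> K \<subseteq> K' \<Longrightarrow>
      card (colourings K' \<alpha> s) * s ^ m = s ^ card K'"
    using ex_swapidseq_card_colourings[OF assms] by blast
  have "m \<le> n" if n: "swapidseq n \<alpha>" for n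
  proof -
    from swapidseq_card_colourings[OF n] obtain K0 where K0: "finite K0"
      "\<forall>K. finite K \<longrightarrow> K0 \<subseteq> K \<longrightarrow> \<alpha> permutes K \<and>
        2 ^ card K \<le> 2 ^ n * card (colourings K \<alpha> 2)" by (elim exE conjE)
    \<comment> \<open>An arbitrary factorization of \<alpha> may involve points outside K, so both
      counts are compared on the union.\<close>
    define L where "L = K \<union> K0"
    define c where "c = card (colourings L \<alpha> 2)"
    have L: "2 ^ card L \<le> 2 ^ n * c" "c * 2 ^ m = 2 ^ card L"
      using assms K0 m(2)[of L 2] by (auto simp: L_def c_def)
    then have "c > 0" by (cases c) auto
    with L have "(2::nat) ^ m \<le> 2 ^ n" by (metis mult.commute mult_le_cancel1)
    then show ?thesis by simp
  qed
  then have "perm_length \<alpha> = m" unfolding perm_length_def using m(1) by (intro Least_equality)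
  then show ?thesis using m(2)[of K s] assms by simp
qed

lemma colourings_inv:
  assumes "\<alpha> permutes K"
  shows "colourings K (inv_into UNIV \<alpha>) s = colourings K \<alpha> s"
proof -
  note perm = permutes_in_image[OF assms] permutes_in_image[OF permutes_inv[OF assms]] permutes_inverses[OF assms]
  have "(\<forall>k\<in>K. l (inv_into UNIV \<alpha> k) = l k) \<longleftrightarrow> (\<forall>k\<in>K. l (\<alpha> k) = l k)" for l :: "nat \<Rightarrow> nat"
  proof (intro iffI ballI)
    fix k assume k: "k \<in> K"
    show "l (\<alpha> k) = l k" if "\<forall>k\<in>K. l (inv_into UNIV \<alpha> k) = l k"
      using bspec[OF that, of "\<alpha> k"] k perm by simp
    show "l (inv_into UNIV \<alpha> k) = l k" if "\<forall>k\<in>K. l (\<alpha> k) = l k"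
      using bspec[OF that, of "inv_into UNIV \<alpha> k"] k perm by simp
  qed
  then show ?thesis by (simp add: colourings_def)
qed

text \<open>The two products are conjugate by \<alpha>, and precomposition with \<alpha> carries
  invariant colourings over.\<close>

lemma card_colourings_commute:
  assumes \<alpha>: "\<alpha> permutes K" and \<beta>: "\<beta> permutes K"
  shows "card (colourings K (\<alpha> \<circ> \<beta>) s) = card (colourings K (\<beta> \<circ> \<alpha>) s)"
proof -
  have "bij_betw (\<lambda>l. restrict (l \<circ> \<alpha>) K) (colourings K (\<alpha> \<circ> \<beta>) s) (colourings K (\<beta> \<circ> \<alpha>) s)"
  proof (rule bij_betw_byWitness[where f' = "\<lambda>l. restrict (l \<circ> inv_into UNIV \<alpha>) K"])
    note perm = permutes_in_image[OF \<alpha>] permutes_in_image[OF \<beta>] permutes_in_image[OF permutes_inv[OF \<alpha>]]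
      permutes_inverses[OF \<alpha>]
    show "\<forall>l\<in>colourings K (\<alpha> \<circ> \<beta>) s. restrict (restrict (l \<circ> \<alpha>) K \<circ> inv_into UNIV \<alpha>) K = l"
      by (auto simp: colourings_def fun_eq_iff restrict_def PiE_def extensional_def perm)
    show "\<forall>l\<in>colourings K (\<beta> \<circ> \<alpha>) s. restrict (restrict (l \<circ> inv_into UNIV \<alpha>) K \<circ> \<alpha>) K = l"
      by (auto simp: colourings_def fun_eq_iff restrict_def PiE_def extensional_def perm)
    show "(\<lambda>l. restrict (l \<circ> \<alpha>) K) ` colourings K (\<alpha> \<circ> \<beta>) s \<subseteq> colourings K (\<beta> \<circ> \<alpha>) s"
      by (auto simp: colourings_def perm)
    show "(\<lambda>l. restrict (l \<circ> inv_into UNIV \<alpha>) K) ` colourings K (\<beta> \<circ> \<alpha>) s \<subseteq> colourings K (\<alpha> \<circ> \<beta>) s"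
    proof (rule image_subsetI)
      fix l assume l: "l \<in> colourings K (\<beta> \<circ> \<alpha>) s"
      have "l (\<beta> k) = l (inv_into UNIV \<alpha> k)" if "k \<in> K" for k
      proof -
        have "l ((\<beta> \<circ> \<alpha>) (inv_into UNIV \<alpha> k)) = l (inv_into UNIV \<alpha> k)"
          using l that perm(3) unfolding colourings_def by blast
        then show ?thesis using perm by simp
      qed
      then show "restrict (l \<circ> inv_into UNIV \<alpha>) K \<in> colourings K (\<alpha> \<circ> \<beta>) s"
        using l by (auto simp: colourings_def perm)
    qed
  qed
  then show ?thesis by (rule bij_betw_same_card)
qed

section \<open>The full cycle and traces as sums over closed paths\<close>

lemma full_cycle_permutes: "full_cycle p permutes {1..p}"
  using cycle_permutes[of "[1..<Suc p]"] by (simp add: full_cycle_def atLeastLessThanSuc_atLeastAtMost del: upt_Suc)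

lemma full_cycle_apply:
  assumes "1 \<le> k" "k \<le> p"
  shows "full_cycle p k = (if k = p then 1 else Suc k)"
proof -
  \<comment> \<open>Generalized to intervals starting at any m, because \<open>cycle_of_list\<close>
    peels off the first element.\<close>
  have "cycle_of_list [m..<m + n] k = (if k = m + n - 1 then m else Suc k)" if "m \<le> k" "k < m + n" for m n k :: nat
    using that
  proof (induction n arbitrary: m)
    case (Suc n)
    show ?case
    proof (cases n)
      case 0
      then show ?thesis using Suc.prems by (simp add: upt_rec)
    next
      case (Suc n')
      have u: "[m..<m + Suc n] = m # Suc m # [Suc (Suc m)..<m + Suc n]" "[Suc m..<Suc m + n] = Suc m # [Suc (Suc m)..<m + Suc n]"
        by (simp_all add: Suc upt_conv_Cons del: upt_Suc)
      have e: "cycle_of_list [m..<m + Suc n] = Transposition.transpose m (Suc m) \<circ> cycle_of_list [Suc m..<Suc m + n]"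
        unfolding u by simp
      show ?thesis
      proof (cases "k = m")
        case True
        have "cycle_of_list [Suc m..<Suc m + n] m = m" by (rule id_outside_supp) auto
        then show ?thesis unfolding e using True Suc by simp
      next
        case False
        then have "cycle_of_list [Suc m..<Suc m + n] k = (if k = Suc m + n - 1 then Suc m else Suc k)"
          using Suc.prems by (intro Suc.IH) auto
        then show ?thesis unfolding e using False Suc.prems by (auto simp: Transposition.transpose_def)
      qed
    qed
  qed simp
  from this[of 1 k p] show ?thesis using assms by (simp add: full_cycle_def)
qed

lemma sum_PiE_atLeastAtMost_Suc:
  fixes h :: "(nat \<Rightarrow> 'b) \<Rightarrow> 'c :: comm_monoid_add"
  assumes "finite S"
  shows "(\<Sum>i\<in>PiE {1..Suc n} (\<lambda>_. S). h i) = (\<Sum>i\<in>PiE {1..n} (\<lambda>_. S). \<Sum>z\<in>S. h (i(Suc n := z)))"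
proof -
  have "PiE {1..Suc n} (\<lambda>_. S) = (\<lambda>(y, g). g(Suc n := y)) ` (S \<times> PiE {1..n} (\<lambda>_. S))"
    by (simp add: atLeastAtMostSuc_conv PiE_insert_eq)
  moreover have "inj_on (\<lambda>(y, g). g(Suc n := y)) (S \<times> PiE {1..n} (\<lambda>_. S))"
    by (rule inj_combinator) simp
  ultimately have "(\<Sum>i\<in>PiE {1..Suc n} (\<lambda>_. S). h i) = (\<Sum>(y, g)\<in>S \<times> PiE {1..n} (\<lambda>_. S). h (g(Suc n := y)))"
    by (simp add: sum.reindex case_prod_unfold)
  also have "\<dots> = (\<Sum>z\<in>S. \<Sum>i\<in>PiE {1..n} (\<lambda>_. S). h (i(Suc n := z)))"
    by (simp add: sum.cartesian_product)
  also have "\<dots> = (\<Sum>i\<in>PiE {1..n} (\<lambda>_. S). \<Sum>z\<in>S. h (i(Suc n := z)))" by (rule sum.swap)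
  finally show ?thesis .
qed

text \<open>The free weight h of the two endpoints lets the induction absorb the last edge into h.
  It is later instantiated with the edge that closes the path.\<close>

lemma sum_paths_mpow:
  "(\<Sum>i\<in>PiE {1..Suc n} (\<lambda>_. {..<d}). (\<Prod>k\<in>{1..n}. A (i k) (i (Suc k))) * h (i 1) (i (Suc n))) =
   (\<Sum>x<d. \<Sum>y<d. mpow d A n x y * h x y)"
proof (induction n arbitrary: h)
  case 0
  have "(\<Sum>i\<in>PiE {1..Suc 0} (\<lambda>_. {..<d}). h (i 1) (i (Suc 0))) = (\<Sum>z<d. h z z)"
    by (subst sum_PiE_atLeastAtMost_Suc) auto
  then show ?case by (simp add: if_distrib[of "\<lambda>x. x * _"] cong: if_cong)
next
  case (Suc n)
  have "(\<Sum>i\<in>PiE {1..Suc (Suc n)} (\<lambda>_. {..<d}). (\<Prod>k\<in>{1..Suc n}. A (i k) (i (Suc k))) * h (i 1) (i (Suc (Suc n))))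
    = (\<Sum>i\<in>PiE {1..Suc n} (\<lambda>_. {..<d}). \<Sum>z<d. (\<Prod>k\<in>{1..n}. A (i k) (i (Suc k))) * (A (i (Suc n)) z * h (i 1) z))"
    by (subst sum_PiE_atLeastAtMost_Suc) (auto intro!: sum.cong prod.cong simp: mult.assoc)
  also have "\<dots> = (\<Sum>i\<in>PiE {1..Suc n} (\<lambda>_. {..<d}). (\<Prod>k\<in>{1..n}. A (i k) (i (Suc k))) * (\<Sum>z<d. A (i (Suc n)) z * h (i 1) z))"
    by (simp add: sum_distrib_left)
  also have "\<dots> = (\<Sum>x<d. \<Sum>y<d. mpow d A n x y * (\<Sum>z<d. A y z * h x z))"
    by (rule Suc.IH)
  also have "\<dots> = (\<Sum>x<d. \<Sum>z<d. mpow d A (Suc n) x z * h x z)"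
  proof (rule sum.cong[OF refl])
    fix x assume "x \<in> {..<d}"
    then have x: "x < d" by simp
    have pw: "mpow d A (Suc n) x z = (\<Sum>y<d. mpow d A n x y * A y z)" if "z < d" for z
      using mpow_add[OF x, of A n "Suc 0" z] that by (simp add: mpow_1 del: mpow.simps)
    have "(\<Sum>y<d. mpow d A n x y * (\<Sum>z<d. A y z * h x z)) = (\<Sum>y<d. \<Sum>z<d. mpow d A n x y * A y z * h x z)"
      by (simp add: sum_distrib_left mult.assoc)
    also have "\<dots> = (\<Sum>z<d. \<Sum>y<d. mpow d A n x y * A y z * h x z)" by (rule sum.swap)
    also have "\<dots> = (\<Sum>z<d. mpow d A (Suc n) x z * h x z)"
      by (intro sum.cong refl) (simp add: pw sum_distrib_right del: mpow.simps)
    finally show "(\<Sum>y<d. mpow d A n x y * (\<Sum>z<d. A y z * h x z)) = (\<Sum>z<d. mpow d A (Suc n) x z * h x z)" .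
  qed
  finally show ?case .
qed

lemma trace_mpow_eq_sum_full_cycle:
  assumes "p \<ge> 1"
  shows "(\<Sum>x<d. mpow d A p x x) = (\<Sum>i\<in>PiE {1..p} (\<lambda>_. {..<d}). \<Prod>k\<in>{1..p}. A (i k) (i (full_cycle p k)))"
proof -
  obtain n where p: "p = Suc n" using assms by (cases p) auto
  have "(\<Prod>k\<in>{1..p}. A (i k) (i (full_cycle p k))) = (\<Prod>k\<in>{1..n}. A (i k) (i (Suc k))) * A (i (Suc n)) (i 1)" for i
  proof -
    have "(\<Prod>k\<in>{1..p}. A (i k) (i (full_cycle p k))) = (\<Prod>k\<in>{1..n}. A (i k) (i (full_cycle p k))) * A (i p) (i (full_cycle p p))"
      by (simp add: p)
    also have "full_cycle p p = 1" using assms by (simp add: full_cycle_apply)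
    also have "(\<Prod>k\<in>{1..n}. A (i k) (i (full_cycle p k))) = (\<Prod>k\<in>{1..n}. A (i k) (i (Suc k)))"
      by (intro prod.cong refl) (auto simp: full_cycle_apply p)
    finally show ?thesis by (simp add: p)
  qed
  then have "(\<Sum>i\<in>PiE {1..p} (\<lambda>_. {..<d}). \<Prod>k\<in>{1..p}. A (i k) (i (full_cycle p k))) =
    (\<Sum>x<d. \<Sum>y<d. mpow d A n x y * A y x)"
    using sum_paths_mpow[where A = A and h = "\<lambda>x y. A y x" and n = n and d = d] by (simp add: p)
  also have "\<dots> = (\<Sum>x<d. mpow d A p x x)"
    using mpow_add[of _ d A n "Suc 0"] by (intro sum.cong refl) (simp add: p mpow_1 del: mpow.simps)
  finally show ?thesis by simp
qed

section \<open>Wick formula and the moments\<close>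

context gaussian_matrix
begin

text \<open>Integrating g (x a) by parts removes one conjugate factor with y b = x a. The remaining
  factors are relabelled by the transposition of a and b to be indexed by K again, and the
  permutations of \<open>insert a K\<close> are exactly these transpositions composed with
  permutations q of K.\<close>

lemma wick:
  fixes x y :: "nat \<Rightarrow> nat \<times> nat"
  assumes "finite K" "\<And>k. k \<in> K \<Longrightarrow> x k \<in> entries" "\<And>k. k \<in> K \<Longrightarrow> y k \<in> entries"
  shows "integrable M (\<lambda>\<omega>. \<Prod>k\<in>K. g (x k) \<omega> * cnj (g (y k) \<omega>)) \<and>
    expectation (\<lambda>\<omega>. \<Prod>k\<in>K. g (x k) \<omega> * cnj (g (y k) \<omega>)) =
      (\<Sum>\<alpha> | \<alpha> permutes K. \<Prod>k\<in>K. if x k = y (\<alpha> k) then 1 else 0)"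
  using assms
proof (induction K arbitrary: y rule: finite_induct)
  case empty
  then show ?case by (simp add: prob_space)
next
  case (insert a K)
  have xK: "x k \<in> entries" if "k \<in> insert a K" for k using insert.prems that by auto
  have yK: "y k \<in> entries" if "k \<in> insert a K" for k using insert.prems that by auto
  let ?T = "\<lambda>b. Transposition.transpose a b"
  define P where "P \<omega> = (\<Prod>k\<in>K. g (x k) \<omega>)" for \<omega>
  define Q where "Q B \<omega> = (\<Prod>k\<in>B. cnj (g (y k) \<omega>))" for B \<omega>
  have "wirtinger (x a) P (\<lambda>\<omega>. \<Sum>k\<in>K. 0 * (\<Prod>j\<in>K - {k}. g (x j) \<omega>))"
    unfolding P_def[abs_def] using insert.hyps xK by (intro wirtinger_prod wirtinger_entry) auto
  then have dP: "wirtinger (x a) P (\<lambda>\<omega>. 0)" by simp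
  have dQ: "wirtinger (x a) (Q (insert a K)) (\<lambda>\<omega>. \<Sum>b\<in>insert a K. (if x a = y b then 1 else 0) * Q (insert a K - {b}) \<omega>)"
    unfolding Q_def[abs_def] using insert.hyps yK by (intro wirtinger_prod wirtinger_conj) auto
  note D = wirtinger_mult[OF dP dQ]
  have split: "(\<Prod>k\<in>insert a K. g (x k) \<omega> * cnj (g (y k) \<omega>)) = g (x a) \<omega> * (P \<omega> * Q (insert a K) \<omega>)" for \<omega>
    using insert.hyps by (simp add: P_def Q_def prod.distrib mult_ac)
  have Q': "Q (insert a K - {b}) \<omega> = (\<Prod>k\<in>K. cnj (g (y (?T b k)) \<omega>))" if b: "b \<in> insert a K" for b \<omega>
  proof -
    have "?T b ` K = insert a K - {b}"
    proof (cases "b = a")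
      case True
      then show ?thesis using insert.hyps by auto
    next
      case False
      then have "?T b ` K = insert a (K - {b})"
        using b insert.hyps by (auto simp: Transposition.transpose_def image_iff)
      then show ?thesis using False b by auto
    qed
    then have "Q (insert a K - {b}) \<omega> = (\<Prod>k\<in>?T b ` K. cnj (g (y k) \<omega>))" by (simp add: Q_def)
    also have "\<dots> = (\<Prod>k\<in>K. cnj (g (y (?T b k)) \<omega>))"
      by (subst prod.reindex) (auto intro: inj_on_transpose)
    finally show ?thesis .
  qed
  have PQ: "P \<omega> * Q (insert a K - {b}) \<omega> = (\<Prod>k\<in>K. g (x k) \<omega> * cnj (g (y (?T b k)) \<omega>))"
    if "b \<in> insert a K" for b \<omega>
    unfolding Q'[OF that] P_def by (simp add: prod.distrib)
  have IH: "integrable M (\<lambda>\<omega>. P \<omega> * Q (insert a K - {b}) \<omega>)"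
    "expectation (\<lambda>\<omega>. P \<omega> * Q (insert a K - {b}) \<omega>) =
      (\<Sum>q | q permutes K. \<Prod>k\<in>K. if x k = y (?T b (q k)) then 1 else 0)" if b: "b \<in> insert a K" for b
  proof -
    have "y (?T b k) \<in> entries" if "k \<in> K" for k
      using that b by (intro yK) (auto simp: Transposition.transpose_def)
    with insert.IH[of "\<lambda>k. y (?T b k)"] xK
    show "integrable M (\<lambda>\<omega>. P \<omega> * Q (insert a K - {b}) \<omega>)"
    "expectation (\<lambda>\<omega>. P \<omega> * Q (insert a K - {b}) \<omega>) =
      (\<Sum>q | q permutes K. \<Prod>k\<in>K. if x k = y (?T b (q k)) then 1 else 0)"
      unfolding PQ[OF b] by auto
  qed
  have xa: "x a \<in> entries" using xK by simp
  have "wirtinger (x a) (\<lambda>\<omega>. g (x a) \<omega> * (P \<omega> * Q (insert a K) \<omega>)) (\<lambda>\<omega>. g (x a) \<omega> *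
     (0 * Q (insert a K) \<omega> + P \<omega> * (\<Sum>b\<in>insert a K. (if x a = y b then 1 else 0) * Q (insert a K - {b}) \<omega>)))"
    by (rule wirtinger.entry[OF D xa])
  then have int: "integrable M (\<lambda>\<omega>. g (x a) \<omega> * (P \<omega> * Q (insert a K) \<omega>))"
    by (rule wirtinger_integration_by_parts(1)) (rule xa)
  have "expectation (\<lambda>\<omega>. g (x a) \<omega> * (P \<omega> * Q (insert a K) \<omega>)) =
    expectation (\<lambda>\<omega>. 0 * Q (insert a K) \<omega> + P \<omega> * (\<Sum>b\<in>insert a K. (if x a = y b then 1 else 0) * Q (insert a K - {b}) \<omega>))"
    by (rule wirtinger_integration_by_parts(3)[OF D xa])
  also have "\<dots> = expectation (\<lambda>\<omega>. \<Sum>b\<in>insert a K. (if x a = y b then 1 else 0) * (P \<omega> * Q (insert a K - {b}) \<omega>))"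
    unfolding sum_distrib_left by (intro Bochner_Integration.integral_cong refl) (simp add: mult_ac)
  also have "\<dots> = (\<Sum>b\<in>insert a K. expectation (\<lambda>\<omega>. (if x a = y b then 1 else 0) * (P \<omega> * Q (insert a K - {b}) \<omega>)))"
    using IH(1) by (intro Bochner_Integration.integral_sum integrable_mult_right)
  also have "\<dots> = (\<Sum>b\<in>insert a K. (if x a = y b then 1 else 0) *
      (\<Sum>q | q permutes K. \<Prod>k\<in>K. if x k = y (?T b (q k)) then 1 else 0))"
    by (intro sum.cong refl) (simp only: integral_mult_right_zero IH(2))
  also have "\<dots> = (\<Sum>b\<in>insert a K. \<Sum>q | q permutes K.
      \<Prod>k\<in>insert a K. if x k = y ((?T b \<circ> q) k) then 1 else 0)"
    unfolding sum_distrib_left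
  proof (intro sum.cong refl)
    fix b q assume "q \<in> {q. q permutes K}"
    then have "q a = a" using insert.hyps by (auto intro: permutes_not_in)
    then show "(if x a = y b then 1 else 0) * (\<Prod>k\<in>K. if x k = y (?T b (q k)) then 1 else 0) =
       (\<Prod>k\<in>insert a K. if x k = y ((?T b \<circ> q) k) then 1 else (0::complex))"
      using insert.hyps by simp
  qed
  also have "\<dots> = (\<Sum>\<alpha> | \<alpha> permutes insert a K. \<Prod>k\<in>insert a K. if x k = y (\<alpha> k) then 1 else 0)"
    by (rule sum_over_permutations_insert[OF insert.hyps, symmetric])
  finally show ?case using int unfolding split by blast
qed

end

text \<open>Subtracting the diagonal of \<open>c\<close> from the factors of its permanent removes the permutations
  with fixed points.\<close>

lemma sum_fixed_point_free_permutations: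
  fixes c :: "nat \<Rightarrow> nat \<Rightarrow> complex"
  assumes K: "finite K"
  shows "(\<Sum>X\<in>Pow K. (\<Sum>\<alpha> | \<alpha> permutes X. \<Prod>k\<in>X. c k (\<alpha> k)) * (\<Prod>k\<in>K - X. - c k k)) =
    (\<Sum>\<alpha> | \<alpha> permutes K \<and> (\<forall>k\<in>K. \<alpha> k \<noteq> k). \<Prod>k\<in>K. c k (\<alpha> k))"
proof -
  let ?h = "\<lambda>\<alpha> X. (\<Prod>k\<in>X. c k (\<alpha> k)) * (\<Prod>k\<in>K - X. if \<alpha> k = k then - c k k else 0)"
  have fin: "finite {\<alpha>. \<alpha> permutes K}" using K by (rule finite_permutations)
  have "(\<Sum>\<alpha> | \<alpha> permutes K \<and> (\<forall>k\<in>K. \<alpha> k \<noteq> k). \<Prod>k\<in>K. c k (\<alpha> k)) =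
      (\<Sum>\<alpha> | \<alpha> permutes K. \<Prod>k\<in>K. c k (\<alpha> k) + (if \<alpha> k = k then - c k k else 0))"
  proof (rule sum.mono_neutral_cong_left[OF fin])
    show "\<forall>\<alpha>\<in>{\<alpha>. \<alpha> permutes K} - {\<alpha>. \<alpha> permutes K \<and> (\<forall>k\<in>K. \<alpha> k \<noteq> k)}.
       (\<Prod>k\<in>K. c k (\<alpha> k) + (if \<alpha> k = k then - c k k else 0)) = 0"
    proof
      fix \<alpha> assume "\<alpha> \<in> {\<alpha>. \<alpha> permutes K} - {\<alpha>. \<alpha> permutes K \<and> (\<forall>k\<in>K. \<alpha> k \<noteq> k)}"
      then obtain k where "k \<in> K" "\<alpha> k = k" by auto
      then show "(\<Prod>k\<in>K. c k (\<alpha> k) + (if \<alpha> k = k then - c k k else 0)) = 0"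
        using K by (intro prod_zero) auto
    qed
  qed (auto intro!: prod.cong)
  also have "\<dots> = (\<Sum>\<alpha> | \<alpha> permutes K. \<Sum>X\<in>Pow K. ?h \<alpha> X)"
    using K by (intro sum.cong refl prod_add)
  also have "\<dots> = (\<Sum>X\<in>Pow K. \<Sum>\<alpha> | \<alpha> permutes K. ?h \<alpha> X)" by (rule sum.swap)
  also have "\<dots> = (\<Sum>X\<in>Pow K. (\<Sum>\<alpha> | \<alpha> permutes X. \<Prod>k\<in>X. c k (\<alpha> k)) * (\<Prod>k\<in>K - X. - c k k))"
  proof (rule sum.cong[OF refl])
    fix X assume "X \<in> Pow K"
    then have X: "X \<subseteq> K" by simp
    have "(\<Sum>\<alpha> | \<alpha> permutes K. ?h \<alpha> X) = (\<Sum>\<alpha> | \<alpha> permutes X. (\<Prod>k\<in>X. c k (\<alpha> k)) * (\<Prod>k\<in>K - X. - c k k))"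
    proof (rule sum.mono_neutral_cong_right[OF fin])
      show "{\<alpha>. \<alpha> permutes X} \<subseteq> {\<alpha>. \<alpha> permutes K}" using X by (auto intro: permutes_subset)
      show "\<forall>\<alpha>\<in>{\<alpha>. \<alpha> permutes K} - {\<alpha>. \<alpha> permutes X}. ?h \<alpha> X = 0"
      proof
        fix \<alpha> assume \<alpha>: "\<alpha> \<in> {\<alpha>. \<alpha> permutes K} - {\<alpha>. \<alpha> permutes X}"
        have "\<exists>k\<in>K - X. \<alpha> k \<noteq> k"
        proof (rule ccontr)
          assume "\<not> (\<exists>k\<in>K - X. \<alpha> k \<noteq> k)"
          then have "\<And>k. k \<in> K - X \<Longrightarrow> \<alpha> k = k" by blast
          moreover have "\<alpha> permutes K" using \<alpha> by simp
          ultimately have "\<alpha> permutes X" by (intro permutes_superset[of \<alpha> K X])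
          then show False using \<alpha> by simp
        qed
        then have "(\<Prod>k\<in>K - X. if \<alpha> k = k then - c k k else 0) = 0"
          using K by (intro prod_zero) auto
        then show "?h \<alpha> X = 0" by simp
      qed
      fix \<alpha> assume "\<alpha> \<in> {\<alpha>. \<alpha> permutes X}"
      then have "\<alpha> k = k" if "k \<in> K - X" for k using that by (auto intro: permutes_not_in)
      then show "?h \<alpha> X = (\<Prod>k\<in>X. c k (\<alpha> k)) * (\<Prod>k\<in>K - X. - c k k)" by simp
    qed
    then show "(\<Sum>\<alpha> | \<alpha> permutes K. ?h \<alpha> X) = (\<Sum>\<alpha> | \<alpha> permutes X. \<Prod>k\<in>X. c k (\<alpha> k)) * (\<Prod>k\<in>K - X. - c k k)"
      by (simp only: sum_distrib_right)
  qed
  finally show ?thesis by simp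
qed

context gaussian_matrix
begin

text \<open>Expand the product over the set X of factors in which the constant is not chosen and
  apply \<open>wick\<close> on X; the alternating sum leaves only permutations without fixed
  points.\<close>

lemma wick_centered:
  fixes x y :: "nat \<Rightarrow> nat \<times> nat"
  assumes K: "finite K" and xy: "\<And>k. k \<in> K \<Longrightarrow> x k \<in> entries" "\<And>k. k \<in> K \<Longrightarrow> y k \<in> entries"
  shows "integrable M (\<lambda>\<omega>. \<Prod>k\<in>K. g (x k) \<omega> * cnj (g (y k) \<omega>) - (if x k = y k then 1 else 0))"
    and "expectation (\<lambda>\<omega>. \<Prod>k\<in>K. g (x k) \<omega> * cnj (g (y k) \<omega>) - (if x k = y k then 1 else 0)) =
      (\<Sum>\<alpha> | \<alpha> permutes K \<and> (\<forall>k\<in>K. \<alpha> k \<noteq> k). \<Prod>k\<in>K. if x k = y (\<alpha> k) then 1 else 0)"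
proof -
  let ?c = "\<lambda>k j. if x k = y j then 1 else (0::complex)"
  let ?F = "\<lambda>\<omega>. \<Prod>k\<in>K. g (x k) \<omega> * cnj (g (y k) \<omega>) - ?c k k"
  let ?W = "\<lambda>X \<omega>. \<Prod>k\<in>X. g (x k) \<omega> * cnj (g (y k) \<omega>)"
  have e: "?F \<omega> = (\<Sum>X\<in>Pow K. ?W X \<omega> * (\<Prod>k\<in>K - X. - ?c k k))" for \<omega>
    using prod_add[OF K, of "\<lambda>k. g (x k) \<omega> * cnj (g (y k) \<omega>)" "\<lambda>k. - ?c k k"] by simp
  have W: "integrable M (?W X)"
    "expectation (?W X) = (\<Sum>\<alpha> | \<alpha> permutes X. \<Prod>k\<in>X. ?c k (\<alpha> k))"
    if "X \<in> Pow K" for X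
    using that K xy wick[of X x y] by (auto intro: finite_subset)
  show "integrable M ?F"
    unfolding e by (intro Bochner_Integration.integrable_sum integrable_mult_left W)
  have "expectation ?F =
     (\<Sum>X\<in>Pow K. expectation (\<lambda>\<omega>. ?W X \<omega> * (\<Prod>k\<in>K - X. - ?c k k)))"
    unfolding e by (intro Bochner_Integration.integral_sum integrable_mult_left W)
  also have "\<dots> = (\<Sum>X\<in>Pow K. (\<Sum>\<alpha> | \<alpha> permutes X. \<Prod>k\<in>X. ?c k (\<alpha> k)) * (\<Prod>k\<in>K - X. - ?c k k))"
    by (intro sum.cong refl) (simp only: integral_mult_left_zero W(2))
  also have "\<dots> = (\<Sum>\<alpha> | \<alpha> permutes K \<and> (\<forall>k\<in>K. \<alpha> k \<noteq> k). \<Prod>k\<in>K. ?c k (\<alpha> k))"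
    using K by (rule sum_fixed_point_free_permutations)
  finally show "expectation ?F =
     (\<Sum>\<alpha> | \<alpha> permutes K \<and> (\<forall>k\<in>K. \<alpha> k \<noteq> k). \<Prod>k\<in>K. ?c k (\<alpha> k))" .
qed

end

lemma prod_indicator:
  "finite K \<Longrightarrow> (\<Prod>k\<in>K. if P k then 1 else (0 :: 'b :: comm_semiring_1)) = (if \<forall>k\<in>K. P k then 1 else 0)"
  by (induction K rule: finite_induct) simp_all

lemma sum_indicator_eq_card:
  assumes "finite A"
  shows "(\<Sum>l\<in>A. if P l then 1 else (0 :: complex)) = of_nat (card {l \<in> A. P l})"
  using assms by (simp flip: sum.inter_filter)

section \<open>The moments as sums over fixed-point-free permutations\<close>

context wishart_matrix
begin

text \<open>Expanding every factor over its column index turns the product into a sum over maps l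
  from K to the columns. The pairing condition separates into one on the rows and l(\<alpha> k) = l
  k, so the sum over l counts colourings.\<close>

lemma Z_prod_expectation:
  fixes a b :: "nat \<Rightarrow> nat"
  assumes K: "finite K" and ab: "\<And>k. k \<in> K \<Longrightarrow> a k < d" "\<And>k. k \<in> K \<Longrightarrow> b k < d"
  shows "integrable M (\<lambda>\<omega>. \<Prod>k\<in>K. Z \<omega> (a k) (b k))"
    and "expectation (\<lambda>\<omega>. \<Prod>k\<in>K. Z \<omega> (a k) (b k)) =
      (\<Sum>\<alpha> | \<alpha> permutes K \<and> (\<forall>k\<in>K. \<alpha> k \<noteq> k).
         (if \<forall>k\<in>K. a k = b (\<alpha> k) then 1 else 0) * of_nat (card (colourings K \<alpha> s))) /
      of_real (sqrt (real d * real s)) ^ card K"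
proof -
  let ?r = "complex_of_real (sqrt (real d * real s))"
  let ?L = "PiE K (\<lambda>_. {..<s})"
  let ?x = "\<lambda>l k. (a k, l k :: nat)" and ?y = "\<lambda>l k. (b k, l k :: nat)"
  let ?F = "{\<alpha>. \<alpha> permutes K \<and> (\<forall>k\<in>K. \<alpha> k \<noteq> k)}"
  let ?W = "\<lambda>l \<omega>. \<Prod>k\<in>K. g (?x l k) \<omega> * cnj (g (?y l k) \<omega>) - (if ?x l k = ?y l k then 1 else 0)"
  let ?V = "\<lambda>l \<alpha>. \<Prod>k\<in>K. if ?x l k = ?y l (\<alpha> k) then 1 else (0::complex)"
  have L: "finite ?L" using K by (intro finite_PiE) auto
  \<comment> \<open>The term s \<delta>_uv is spread evenly over the s columns, so that every
    summand is centred.\<close>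
  have Z: "Z \<omega> u v = (\<Sum>l<s. g (u, l) \<omega> * cnj (g (v, l) \<omega>) - (if u = v then 1 else 0)) / ?r" for \<omega> u v
    by (simp add: Z_def sum_subtractf)
  have e: "(\<Prod>k\<in>K. Z \<omega> (a k) (b k)) =
      (\<Sum>l\<in>?L. ?W l \<omega>) / ?r ^ card K" for \<omega>
    unfolding Z prod_dividef using K by (simp add: prod_sum_PiE)
  have xy: "?x l k \<in> entries" "?y l k \<in> entries" if "l \<in> ?L" "k \<in> K" for l k
    using that ab by auto
  have W: "integrable M (?W l)"
    "expectation (?W l) =
      (\<Sum>\<alpha>\<in>?F. ?V l \<alpha>)" if "l \<in> ?L" for l
    using wick_centered[of K "?x l" "?y l", OF K xy(1)[OF that] xy(2)[OF that]] by auto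
  show "integrable M (\<lambda>\<omega>. \<Prod>k\<in>K. Z \<omega> (a k) (b k))"
    unfolding e by (intro integrable_divide Bochner_Integration.integrable_sum W)
  have "expectation (\<lambda>\<omega>. \<Prod>k\<in>K. Z \<omega> (a k) (b k)) =
      (\<Sum>l\<in>?L. expectation (?W l)) / ?r ^ card K"
    unfolding e integral_divide_zero by (subst Bochner_Integration.integral_sum, rule W(1)) (rule refl | assumption)+
  also have "\<dots> = (\<Sum>l\<in>?L. \<Sum>\<alpha>\<in>?F. ?V l \<alpha>) / ?r ^ card K"
    by (simp only: W(2) cong: sum.cong)
  also have "(\<Sum>l\<in>?L. \<Sum>\<alpha>\<in>?F. ?V l \<alpha>) =
     (\<Sum>\<alpha>\<in>?F. \<Sum>l\<in>?L. ?V l \<alpha>)" by (rule sum.swap)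
  also have "\<dots> = (\<Sum>\<alpha>\<in>?F. (if \<forall>k\<in>K. a k = b (\<alpha> k) then 1 else 0) * of_nat (card (colourings K \<alpha> s)))"
  proof (rule sum.cong[OF refl])
    fix \<alpha>
    have "(\<Sum>l\<in>?L. ?V l \<alpha>) =
       (\<Sum>l\<in>?L. (if \<forall>k\<in>K. a k = b (\<alpha> k) then 1 else 0) * (if \<forall>k\<in>K. l (\<alpha> k) = l k then 1 else 0))"
      using K by (intro sum.cong refl) (auto simp: prod_indicator)
    also have "\<dots> = (if \<forall>k\<in>K. a k = b (\<alpha> k) then 1 else 0) * of_nat (card (colourings K \<alpha> s))"
      unfolding sum_distrib_left[symmetric] colourings_def
      by (simp only: sum_indicator_eq_card[OF L])
    finally show "(\<Sum>l\<in>?L. ?V l \<alpha>) =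
      (if \<forall>k\<in>K. a k = b (\<alpha> k) then 1 else 0) * of_nat (card (colourings K \<alpha> s))" .
  qed
  finally show "expectation (\<lambda>\<omega>. \<Prod>k\<in>K. Z \<omega> (a k) (b k)) =
      (\<Sum>\<alpha>\<in>?F. (if \<forall>k\<in>K. a k = b (\<alpha> k) then 1 else 0) * of_nat (card (colourings K \<alpha> s))) / ?r ^ card K" .
qed

text \<open>With the row indices i arranged along the cycle \<gamma>, the row condition says that i
  is constant on the cycles of \<gamma> \<alpha>; the sum over i therefore counts colourings as
  well.\<close>

lemma expectation_tr_colourings:
  assumes p: "p \<ge> 1"
  shows "expectation (tr p) = (\<Sum>\<alpha> | \<alpha> permutes {1..p} \<and> (\<forall>k\<in>{1..p}. \<alpha> k \<noteq> k).
      of_nat (card (colourings {1..p} (inv_into UNIV \<alpha> \<circ> full_cycle p) d)) *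
      of_nat (card (colourings {1..p} \<alpha> s))) /
    (of_nat d * of_real (sqrt (real d * real s)) ^ p)"
proof -
  let ?K = "{1..p}" and ?\<gamma> = "full_cycle p"
  let ?I = "PiE ?K (\<lambda>_. {..<d})" and ?r = "complex_of_real (sqrt (real d * real s))"
  let ?F = "{\<alpha>. \<alpha> permutes ?K \<and> (\<forall>k\<in>?K. \<alpha> k \<noteq> k)}"
  let ?T = "\<lambda>i \<alpha>. (if \<forall>k\<in>?K. i k = i (?\<gamma> (\<alpha> k)) then 1 else 0) * of_nat (card (colourings ?K \<alpha> s)) :: complex"
  have I: "finite ?I" by (intro finite_PiE) auto
  have \<gamma>: "?\<gamma> permutes ?K" by (rule full_cycle_permutes)
  have lt: "i k < d" "i (?\<gamma> k) < d" if "i \<in> ?I" "k \<in> ?K" for i k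
    using that permutes_in_image[OF \<gamma>, of k] by auto
  have E: "integrable M (\<lambda>\<omega>. \<Prod>k\<in>?K. Z \<omega> (i k) (i (?\<gamma> k)))"
    "expectation (\<lambda>\<omega>. \<Prod>k\<in>?K. Z \<omega> (i k) (i (?\<gamma> k))) = (\<Sum>\<alpha>\<in>?F.
         ?T i \<alpha>) / ?r ^ p"
    if "i \<in> ?I" for i
    using Z_prod_expectation[of ?K i "\<lambda>k. i (?\<gamma> k)"] lt[OF that] by auto
  have "expectation (tr p) = expectation (\<lambda>\<omega>. (\<Sum>i\<in>?I. \<Prod>k\<in>?K. Z \<omega> (i k) (i (?\<gamma> k))) / of_nat d)"
    by (intro Bochner_Integration.integral_cong refl) (simp add: tr_def trace_mpow_eq_sum_full_cycle[OF p])
  also have "\<dots> = (\<Sum>i\<in>?I. expectation (\<lambda>\<omega>. \<Prod>k\<in>?K. Z \<omega> (i k) (i (?\<gamma> k)))) / of_nat d"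
    unfolding integral_divide_zero by (subst Bochner_Integration.integral_sum, rule E(1)) (rule refl | assumption)+
  also have "(\<Sum>i\<in>?I. expectation (\<lambda>\<omega>. \<Prod>k\<in>?K. Z \<omega> (i k) (i (?\<gamma> k)))) = (\<Sum>i\<in>?I. \<Sum>\<alpha>\<in>?F.
         ?T i \<alpha>) / ?r ^ p"
    unfolding sum_divide_distrib[of _ ?I] by (intro sum.cong refl E)
  also have "(\<Sum>i\<in>?I. \<Sum>\<alpha>\<in>?F. ?T i \<alpha>)
    = (\<Sum>\<alpha>\<in>?F. \<Sum>i\<in>?I. ?T i \<alpha>)"
    by (rule sum.swap)
  also have "\<dots> = (\<Sum>\<alpha>\<in>?F. (of_nat (card (colourings ?K (?\<gamma> \<circ> \<alpha>) d)) * of_nat (card (colourings ?K \<alpha> s)) :: complex))"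
  proof -
    have "(\<forall>k\<in>?K. i k = i (?\<gamma> (\<alpha> k))) = (\<forall>k\<in>?K. i ((?\<gamma> \<circ> \<alpha>) k) = i k)" for i :: "nat \<Rightarrow> nat" and \<alpha>
      by (auto simp only: comp_apply)
    then show ?thesis
      unfolding sum_distrib_right[symmetric] colourings_def[of _ _ d]
      by (simp only: sum_indicator_eq_card[OF I])
  qed
  also have "\<dots> = (\<Sum>\<alpha>\<in>?F. of_nat (card (colourings ?K (inv_into UNIV \<alpha> \<circ> ?\<gamma>) d)) *
      of_nat (card (colourings ?K \<alpha> s)))"
  \<comment> \<open>Inverting \<alpha> and exchanging the two factors up to conjugation turns
    \<gamma> \<alpha> into the product in the definition of \<open>genus\<close>; neither changes
    the counts.\<close>
  proof (rule sum.reindex_bij_witness[where i = "inv_into UNIV" and j = "inv_into UNIV"])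
    fix \<alpha> assume "\<alpha> \<in> ?F"
    then have \<alpha>: "\<alpha> permutes ?K" and fpf: "\<And>k. k \<in> ?K \<Longrightarrow> \<alpha> k \<noteq> k" by auto
    show ii: "inv_into UNIV (inv_into UNIV \<alpha>) = \<alpha>" using \<alpha> by (rule permutes_inv_inv)
    show "inv_into UNIV (inv_into UNIV \<alpha>) = \<alpha>" by (rule ii)
    have "inv_into UNIV \<alpha> k \<noteq> k" if "k \<in> ?K" for k
    proof
      assume "inv_into UNIV \<alpha> k = k"
      then have "\<alpha> k = k" using permutes_inverses(1)[OF \<alpha>, of k] by simp
      then show False using fpf[OF that] by simp
    qed
    then show m: "inv_into UNIV \<alpha> \<in> ?F" using permutes_inv[OF \<alpha>] by simp
    show "inv_into UNIV \<alpha> \<in> ?F" by (rule m)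
    show "complex_of_nat (card (colourings ?K (inv_into UNIV (inv_into UNIV \<alpha>) \<circ> ?\<gamma>) d)) *
        of_nat (card (colourings ?K (inv_into UNIV \<alpha>) s)) =
      of_nat (card (colourings ?K (?\<gamma> \<circ> \<alpha>) d)) * of_nat (card (colourings ?K \<alpha> s))"
      unfolding ii using card_colourings_commute[OF \<alpha> \<gamma>] colourings_inv[OF \<alpha>] by simp
  qed
  finally show ?thesis by (simp add: mult.commute)
qed

lemma card_colourings_powr:
  assumes "\<alpha> permutes {1..p}" "n \<ge> 1"
  shows "real (card (colourings {1..p} \<alpha> n)) = real n powr (real p - real (perm_length \<alpha>))"
proof -
  have "card (colourings {1..p} \<alpha> n) * n ^ perm_length \<alpha> = n ^ p"
    using card_colourings[of "{1..p}" \<alpha> n] assms by simp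
  then have "real (card (colourings {1..p} \<alpha> n)) * real n ^ perm_length \<alpha> = real n ^ p"
    by (metis of_nat_mult of_nat_power)
  then show ?thesis using assms(2) by (simp add: powr_diff powr_realpow field_simps)
qed

text \<open>With A = |\<alpha>| and B the length of \<alpha>^-1 \<gamma>, the counts give d^(p - B)
  s^(p - A) over d (ds)^(p/2). The genus accounts for d^(p - A - B - 1), and the remaining d^(A -
  p/2) combines with s^(p/2 - A) to the power of d / s.\<close>

theorem expectation_tr:
  assumes p: "p \<ge> 1"
  shows "expectation (tr p) = complex_of_real
    (\<Sum>\<alpha> | \<alpha> permutes {1..p} \<and> (\<forall>i\<in>{1..p}. \<alpha> i \<noteq> i).
       real d powr (- 2 * genus p \<alpha>) * (real d / real s) powr (real (perm_length \<alpha>) - real p / 2))"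
proof -
  let ?F = "{\<alpha>. \<alpha> permutes {1..p} \<and> (\<forall>i\<in>{1..p}. \<alpha> i \<noteq> i)}"
  let ?t = "\<lambda>\<alpha>. real (card (colourings {1..p} (inv_into UNIV \<alpha> \<circ> full_cycle p) d)) *
      real (card (colourings {1..p} \<alpha> s)) / (real d * sqrt (real d * real s) ^ p)"
  let ?u = "\<lambda>\<alpha>. real d powr (- 2 * genus p \<alpha>) * (real d / real s) powr (real (perm_length \<alpha>) - real p / 2)"
  have d: "real d > 0" "real s > 0" using d_pos s_pos by auto
  have r: "sqrt (real d * real s) ^ p = real d powr (real p / 2) * real s powr (real p / 2)"
    using d by (simp add: powr_half_sqrt_powr[symmetric] powr_mult[symmetric] powr_powr powr_half_sqrt[symmetric] powr_realpow[symmetric])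
  have "expectation (tr p) = complex_of_real (\<Sum>\<alpha>\<in>?F. ?t \<alpha>)"
    unfolding expectation_tr_colourings[OF p] by (simp add: sum_divide_distrib)
  also have "(\<Sum>\<alpha>\<in>?F. ?t \<alpha>) = (\<Sum>\<alpha>\<in>?F. ?u \<alpha>)"
  proof (rule sum.cong[OF refl])
    fix \<alpha> assume "\<alpha> \<in> ?F"
    then have \<alpha>: "\<alpha> permutes {1..p}" by simp
    have "inv_into UNIV \<alpha> \<circ> full_cycle p permutes {1..p}"
      by (intro permutes_compose full_cycle_permutes permutes_inv \<alpha>)
    note c = card_colourings_powr[OF this d_pos] card_colourings_powr[OF \<alpha> s_pos]
    define A where "A = real (perm_length \<alpha>)"
    define B where "B = real (perm_length (inv_into UNIV \<alpha> \<circ> full_cycle p))"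
    have g: "- 2 * genus p \<alpha> = real p - A - B - 1" by (simp add: genus_def A_def B_def field_simps)
    have "real d powr (real p - B) * real s powr (real p - A) / (real d * (real d powr (real p / 2) * real s powr (real p / 2)))
      = real d powr (real p - B - 1 - real p / 2) * real s powr (real p - A - real p / 2)"
    proof -
      have "X * Y / (D * (U * V)) = (X / D / U) * (Y / V)" for X Y D U V :: real by simp
      moreover have "real d powr (real p - B) / real d / real d powr (real p / 2) = real d powr (real p - B - 1 - real p / 2)"
        using d by (simp only: powr_diff powr_one less_imp_le)
      moreover have "real s powr (real p - A) / real s powr (real p / 2) = real s powr (real p - A - real p / 2)"
        by (simp only: powr_diff)
      ultimately show ?thesis by (simp only:)
    qed
    also have "\<dots> = real d powr (real p - A - B - 1 + (A - real p / 2)) * real s powr (- (A - real p / 2))"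
      by (intro arg_cong2[where f = "\<lambda>u v. real d powr u * real s powr v"]) auto
    also have "\<dots> = real d powr (real p - A - B - 1) * (real d / real s) powr (A - real p / 2)"
    proof -
      have "(real d / real s) powr t = real d powr t * real s powr (- t)" for t
        using d by (simp add: powr_divide powr_minus_divide)
      then show ?thesis by (simp only: powr_add[of _ "real p - A - B - 1"] mult.assoc)
    qed
    finally show "?t \<alpha> = ?u \<alpha>"
      unfolding c r g by (simp add: A_def B_def)
  qed
  finally show ?thesis .
qed

end

theorem theoremA:
  fixes M :: "'a measure"
  assumes "prob_space M"
  shows "(\<forall>(d::nat) (s::nat) (p::nat) (W :: 'a \<Rightarrow> complex mat).
            d \<ge> 1 \<longrightarrow> s \<ge> 1 \<longrightarrow> p \<ge> 1 \<longrightarrow> complex_wishart M d s W \<longrightarrow>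
              integrable M
                (\<lambda>\<omega>. 1 / of_nat d * mat_trace (recentered_wishart d s (W \<omega>) ^\<^sub>m p)) \<and>
              prob_space.expectation M
                (\<lambda>\<omega>. 1 / of_nat d * mat_trace (recentered_wishart d s (W \<omega>) ^\<^sub>m p)) =
              complex_of_real
                (\<Sum>\<alpha> | \<alpha> permutes {1..p} \<and> (\<forall>i\<in>{1..p}. \<alpha> i \<noteq> i).
                   real d powr (- 2 * genus p \<alpha>) *
                   (real d / real s) powr (real (perm_length \<alpha>) - real p / 2)))
       \<and> (\<forall>(s :: nat \<Rightarrow> nat) (W :: nat \<Rightarrow> 'a \<Rightarrow> complex mat).
            (\<forall>d\<ge>1. s d \<ge> 1 \<and> complex_wishart M d (s d) (W d)) \<longrightarrow>
            filterlim (\<lambda>d. real (s d) / real d) at_top sequentially \<longrightarrow>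
              (AE \<omega> in M.
                 (\<lambda>d. largest_eigenvalue (recentered_wishart d (s d) (W d \<omega>)))
                   \<longlonglongrightarrow> 2 \<and>
                 (\<lambda>d. smallest_eigenvalue (recentered_wishart d (s d) (W d \<omega>)))
                   \<longlonglongrightarrow> - 2))"
proof (intro conjI allI impI)
  fix d s p :: nat and W :: "'a \<Rightarrow> complex mat"
  assume dsp: "d \<ge> 1" "s \<ge> 1" "p \<ge> 1" and W: "complex_wishart M d s W"
  obtain G where G: "wishart_matrix M d s G" and WG: "\<forall>\<omega>\<in>space M. W \<omega> = G \<omega> * mat_adjoint (G \<omega>)"
    using complex_wishart_matrix[OF assms W dsp(1,2)] by (elim exE conjE)
  interpret wishart_matrix M d s G by (rule G)
  have tr: "1 / of_nat d * mat_trace (recentered_wishart d s (W \<omega>) ^\<^sub>m p) = tr p \<omega>" if "\<omega> \<in> space M" for \<omega>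
    using tr_eq[OF that, of p] WG that by simp
  show "integrable M (\<lambda>\<omega>. 1 / of_nat d * mat_trace (recentered_wishart d s (W \<omega>) ^\<^sub>m p))"
    using integrable_tr[of p] by (subst Bochner_Integration.integrable_cong[OF refl tr])
  show "prob_space.expectation M (\<lambda>\<omega>. 1 / of_nat d * mat_trace (recentered_wishart d s (W \<omega>) ^\<^sub>m p)) =
    complex_of_real (\<Sum>\<alpha> | \<alpha> permutes {1..p} \<and> (\<forall>i\<in>{1..p}. \<alpha> i \<noteq> i).
       real d powr (- 2 * genus p \<alpha>) * (real d / real s) powr (real (perm_length \<alpha>) - real p / 2))"
    using expectation_tr[OF dsp(3)] by (subst Bochner_Integration.integral_cong[OF refl tr])
next
  fix s :: "nat \<Rightarrow> nat" and W :: "nat \<Rightarrow> 'a \<Rightarrow> complex mat"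
  assume "\<forall>d\<ge>1. s d \<ge> 1 \<and> complex_wishart M d (s d) (W d)"
    and "filterlim (\<lambda>d. real (s d) / real d) at_top sequentially"
  then show "AE \<omega> in M.
      (\<lambda>d. largest_eigenvalue (recentered_wishart d (s d) (W d \<omega>))) \<longlonglongrightarrow> 2 \<and>
      (\<lambda>d. smallest_eigenvalue (recentered_wishart d (s d) (W d \<omega>))) \<longlonglongrightarrow> - 2"
    by (intro extreme_eigenvalues_tendsto[OF assms]) auto
qed

end
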